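(* Let $G$ be a torsion-free word-hyperbolic $\mathbb{R}$-Poincaré duality group of cohomological dimension $n\geq 3$. Then $G$ admits no injective homomorphism into $\mathrm{PL}(S^1)$.
   Context: $S^1=\mathbb{R}/\mathbb{Z}$, and $\mathrm{PL}(S^1)$ is the group of homeomorphisms of $S^1$ (possibly orientation reversing) which, away from a finite set of points, are locally given by affine maps $x\mapsto \alpha x+\beta$ with $\alpha\ne 0$. A finitely generated group is word-hyperbolic if its Cayley graph with respect to a finite generating set is Gromov hyperbolic. For a commutative ring $R$ and $n\in\mathbb{N}$, a group $G$ is an $R$-Poincaré duality group of dimension $n$ (a $PD^n_R$ group) if it admits a dualizing module $D$, i.e. an $R[G]$-module isomorphic to $R$ as an $R$-module, such that $H^i(G,A)\cong H_{n-i}(G,D\otimes A)$ for all $R[G]$-modules $A$ and all $i$, where the isomorphism is natural and is induced by cap product with a class $\mu\in H_n(G,D)$. Here $R=\mathbb{R}$ is the field of real numbers. *)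

theory Defs
  imports "HOL-Analysis.Analysis" "HOL-Algebra.Module" "HOL-Algebra.Elementary_Groups"
    "HOL-Algebra.Product_Groups" "HOL-Algebra.Free_Abelian_Groups"
begin

section \<open>Piecewise linear homeomorphisms of the circle\<close>

quotient_type circle = real / "\<lambda>x y. x - y \<in> \<int>"
  morphisms rep_circle circle_of
proof (rule equivpI)
  show "reflp (\<lambda>x y::real. x - y \<in> \<int>)"
    by (simp add: reflp_def)
  show "symp (\<lambda>x y::real. x - y \<in> \<int>)"
    by (metis (no_types, lifting) Ints_minus minus_diff_eq sympI)
  show "transp (\<lambda>x y::real. x - y \<in> \<int>)"
    by (rule transpI) (metis (no_types, lifting) Ints_add add_diff_cancel_left' diff_add_cancel diff_add_eq)
qed

instantiation circle :: topological_space
begin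

definition open_circle :: "circle set \<Rightarrow> bool"
  where "open_circle U \<longleftrightarrow> open (circle_of -` U)"

instance
  by standard (auto simp: open_circle_def vimage_Union)

end

definition locally_affine_at :: "(circle \<Rightarrow> circle) \<Rightarrow> real \<Rightarrow> bool"
  where "locally_affine_at f x \<longleftrightarrow>
    (\<exists>\<alpha> \<beta> \<epsilon>. \<alpha> \<noteq> 0 \<and> \<epsilon> > 0 \<and>
      (\<forall>y. \<bar>y - x\<bar> < \<epsilon> \<longrightarrow> f (circle_of y) = circle_of (\<alpha> * y + \<beta>)))"

definition PL_circle :: "(circle \<Rightarrow> circle) monoid"
  where "PL_circle =
    \<lparr>carrier = {f. (\<exists>g. homeomorphism UNIV UNIV f g) \<and>
       (\<exists>F. finite F \<and> (\<forall>x. circle_of x \<notin> F \<longrightarrow> locally_affine_at f x))},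
     mult = (\<circ>), one = id\<rparr>"


section \<open>Torsion-free and word-hyperbolic groups\<close>

definition torsion_free :: "('g, 'b) monoid_scheme \<Rightarrow> bool"
  where "torsion_free G \<longleftrightarrow>
    (\<forall>x\<in>carrier G. \<forall>n::nat. n > 0 \<longrightarrow> x [^]\<^bsub>G\<^esub> n = \<one>\<^bsub>G\<^esub> \<longrightarrow> x = \<one>\<^bsub>G\<^esub>)"

definition cayley_edges :: "('g, 'b) monoid_scheme \<Rightarrow> 'g set \<Rightarrow> ('g \<times> 'g) set"
  where "cayley_edges G S =
    {(x, x \<otimes>\<^bsub>G\<^esub> s) | x s. x \<in> carrier G \<and> s \<in> S \<union> m_inv G ` S}"

definition graph_dist :: "('v \<times> 'v) set \<Rightarrow> 'v \<Rightarrow> 'v \<Rightarrow> nat"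
  where "graph_dist E x y = (LEAST n. (x, y) \<in> E ^^ n)"

definition geodesic_path :: "('v \<times> 'v) set \<Rightarrow> 'v \<Rightarrow> 'v \<Rightarrow> (nat \<Rightarrow> 'v) \<Rightarrow> nat \<Rightarrow> bool"
  where "geodesic_path E x y p l \<longleftrightarrow>
    p 0 = x \<and> p l = y \<and> (\<forall>i<l. (p i, p (Suc i)) \<in> E) \<and> l = graph_dist E x y"

text \<open>
  Slim geodesic triangles. It is enough to consider triangles with corners in the vertex set and
  to measure distances between vertices: passing to the geometric realisation of the graph only
  changes the constant. Only one side is mentioned because the corners can be permuted and
  (in a symmetric graph) geodesics can be reversed.
\<close>

definition gromov_hyperbolic_graph :: "'v set \<Rightarrow> ('v \<times> 'v) set \<Rightarrow> bool"
  where "gromov_hyperbolic_graph V E \<longleftrightarrow>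
    (\<exists>\<delta>. \<forall>x\<in>V. \<forall>y\<in>V. \<forall>z\<in>V. \<forall>p k q l r m.
      geodesic_path E x y p k \<longrightarrow> geodesic_path E y z q l \<longrightarrow> geodesic_path E x z r m \<longrightarrow>
      (\<forall>i\<le>k. (\<exists>j\<le>l. graph_dist E (p i) (q j) \<le> \<delta>) \<or> (\<exists>j\<le>m. graph_dist E (p i) (r j) \<le> \<delta>)))"

definition word_hyperbolic :: "('g, 'b) monoid_scheme \<Rightarrow> bool"
  where "word_hyperbolic G \<longleftrightarrow>
    (\<exists>S. finite S \<and> S \<subseteq> carrier G \<and> generate G S = carrier G \<and>
      gromov_hyperbolic_graph (carrier G) (cayley_edges G S))"


section \<open>Modules over group rings\<close>

text \<open>
  An \<open>R[G]\<close>-module is given as an \<open>R\<close>-module with an \<open>R\<close>-linear action of \<open>G\<close> (the library locale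
  \<open>module\<close> only covers commutative rings of scalars).
\<close>

record ('r, 'm, 'g) gmodule = "('r, 'm) module" +
  gact :: "'g \<Rightarrow> 'm \<Rightarrow> 'm"

locale gmodule = module R M + group G
  for R :: "('r, 'a) ring_scheme" and G :: "('g, 'b) monoid_scheme"
    and M :: "('r, 'm, 'g, 'c) gmodule_scheme" +
  assumes gact_closed: "\<lbrakk>g \<in> carrier G; x \<in> carrier M\<rbrakk> \<Longrightarrow> gact M g x \<in> carrier M"
    and gact_add: "\<lbrakk>g \<in> carrier G; x \<in> carrier M; y \<in> carrier M\<rbrakk>
      \<Longrightarrow> gact M g (x \<oplus>\<^bsub>M\<^esub> y) = gact M g x \<oplus>\<^bsub>M\<^esub> gact M g y"
    and gact_smult: "\<lbrakk>g \<in> carrier G; r \<in> carrier R; x \<in> carrier M\<rbrakk>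
      \<Longrightarrow> gact M g (r \<odot>\<^bsub>M\<^esub> x) = r \<odot>\<^bsub>M\<^esub> gact M g x"
    and gact_one: "x \<in> carrier M \<Longrightarrow> gact M \<one>\<^bsub>G\<^esub> x = x"
    and gact_mult: "\<lbrakk>g \<in> carrier G; h \<in> carrier G; x \<in> carrier M\<rbrakk>
      \<Longrightarrow> gact M (g \<otimes>\<^bsub>G\<^esub> h) x = gact M g (gact M h x)"

text \<open>
  The tensor product over \<open>R\<close> is the free abelian group on pairs modulo biadditivity and
  \<open>R\<close>-balancedness; \<open>G\<close> acts diagonally.
\<close>

definition tensor_free ::
    "('r, 'm, 'g, 'c) gmodule_scheme \<Rightarrow> ('r, 'n, 'g, 'd) gmodule_scheme \<Rightarrow> ('m \<times> 'n \<Rightarrow>\<^sub>0 int) monoid"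
  where "tensor_free M N = free_Abelian_group (carrier M \<times> carrier N)"

definition tensor_relations ::
    "('r, 'a) ring_scheme \<Rightarrow> ('r, 'm, 'g, 'c) gmodule_scheme \<Rightarrow> ('r, 'n, 'g, 'd) gmodule_scheme
      \<Rightarrow> ('m \<times> 'n \<Rightarrow>\<^sub>0 int) set"
  where "tensor_relations R M N = generate (tensor_free M N)
    ({frag_of (x \<oplus>\<^bsub>M\<^esub> x', y) - (frag_of (x, y) + frag_of (x', y)) | x x' y.
        x \<in> carrier M \<and> x' \<in> carrier M \<and> y \<in> carrier N} \<union>
     {frag_of (x, y \<oplus>\<^bsub>N\<^esub> y') - (frag_of (x, y) + frag_of (x, y')) | x y y'.
        x \<in> carrier M \<and> y \<in> carrier N \<and> y' \<in> carrier N} \<union>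
     {frag_of (r \<odot>\<^bsub>M\<^esub> x, y) - frag_of (x, r \<odot>\<^bsub>N\<^esub> y) | r x y.
        r \<in> carrier R \<and> x \<in> carrier M \<and> y \<in> carrier N})"

definition tensor_class ::
    "('r, 'a) ring_scheme \<Rightarrow> ('r, 'm, 'g, 'c) gmodule_scheme \<Rightarrow> ('r, 'n, 'g, 'd) gmodule_scheme
      \<Rightarrow> ('m \<times> 'n \<Rightarrow>\<^sub>0 int) \<Rightarrow> ('m \<times> 'n \<Rightarrow>\<^sub>0 int) set"
  where "tensor_class R M N t = tensor_relations R M N #>\<^bsub>tensor_free M N\<^esub> t"

definition tensor ::
    "('r, 'a) ring_scheme \<Rightarrow> ('r, 'm, 'g, 'c) gmodule_scheme \<Rightarrow> ('r, 'n, 'g, 'd) gmodule_scheme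
      \<Rightarrow> ('r, ('m \<times> 'n \<Rightarrow>\<^sub>0 int) set, 'g) gmodule"
  where "tensor R M N =
    \<lparr>carrier = rcosets\<^bsub>tensor_free M N\<^esub> tensor_relations R M N,
     mult = undefined, one = undefined,
     ring.zero = tensor_relations R M N,
     ring.add = set_mult (tensor_free M N),
     smult = (\<lambda>r T. \<Union>t\<in>T. tensor_class R M N
       (frag_extend (\<lambda>(x, y). frag_of (r \<odot>\<^bsub>M\<^esub> x, y)) t)),
     gact = (\<lambda>g T. \<Union>t\<in>T. tensor_class R M N
       (frag_extend (\<lambda>(x, y). frag_of (gact M g x, gact N g y)) t))\<rparr>"


section \<open>Group homology and cohomology\<close>

text \<open>
  Both are computed by the inhomogeneous bar complex. With
  \<open>[g\<^sub>1|\<dots>|g\<^sub>n]\<close> standing for \<open>(1, g\<^sub>1, g\<^sub>1g\<^sub>2, \<dots>, g\<^sub>1\<cdots>g\<^sub>n)\<close> in the homogeneous bar resolution \<open>F\<close>,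
  a list \<open>[g\<^sub>1, \<dots>, g\<^sub>n]\<close> represents a basis element of \<open>F\<^sub>n\<close>. Cochains are functions
  on such lists, i.e. elements of \<open>Hom\<^sub>G(F\<^sub>n, M)\<close>, and chains are the finitely supported ones, i.e.
  elements of the coinvariants \<open>(F\<^sub>n \<otimes> M)\<^sub>G\<close> for the diagonal action.
\<close>

definition bar_tuples :: "('g, 'b) monoid_scheme \<Rightarrow> nat \<Rightarrow> 'g list set"
  where "bar_tuples G n = {ws. length ws = n \<and> set ws \<subseteq> carrier G}"

definition cochain_group ::
    "('g, 'b) monoid_scheme \<Rightarrow> ('r, 'm, 'g, 'c) gmodule_scheme \<Rightarrow> nat \<Rightarrow> ('g list \<Rightarrow> 'm) monoid"
  where "cochain_group G M n = product_group (bar_tuples G n) (\<lambda>_. add_monoid M)"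

definition bar_chain_group ::
    "('g, 'b) monoid_scheme \<Rightarrow> ('r, 'm, 'g, 'c) gmodule_scheme \<Rightarrow> nat \<Rightarrow> ('g list \<Rightarrow> 'm) monoid"
  where "bar_chain_group G M n = sum_group (bar_tuples G n) (\<lambda>_. add_monoid M)"

text \<open>The \<open>k\<close>-th face of a list of length \<open>n\<close>, for \<open>k \<le> n\<close>, without its coefficient.\<close>

definition bar_face :: "('g, 'b) monoid_scheme \<Rightarrow> nat \<Rightarrow> 'g list \<Rightarrow> 'g list"
  where "bar_face G k ws =
    (if k = 0 then tl ws
     else if k = length ws then butlast ws
     else take (k - 1) ws @ [ws ! (k - 1) \<otimes>\<^bsub>G\<^esub> ws ! k] @ drop (k + 1) ws)"

definition alternate :: "('m, 'c) ring_scheme \<Rightarrow> nat \<Rightarrow> 'm \<Rightarrow> 'm"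
  where "alternate M k x = (if even k then x else \<ominus>\<^bsub>M\<^esub> x)"

text \<open>\<open>(\<delta>u)[g\<^sub>0|\<dots>|g\<^sub>n] = g\<^sub>0 u[g\<^sub>1|\<dots>|g\<^sub>n] + \<dots>\<close>\<close>

definition coboundary ::
    "('g, 'b) monoid_scheme \<Rightarrow> ('r, 'm, 'g, 'c) gmodule_scheme \<Rightarrow> nat
      \<Rightarrow> ('g list \<Rightarrow> 'm) \<Rightarrow> ('g list \<Rightarrow> 'm)"
  where "coboundary G M n u = (\<lambda>ws\<in>bar_tuples G (Suc n).
    finsum M (\<lambda>k. alternate M k
        (if k = 0 then gact M (hd ws) (u (bar_face G k ws)) else u (bar_face G k ws)))
      {0..Suc n})"

text \<open>
  The boundary from degree \<open>Suc n\<close> to degree \<open>n\<close>, given by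
  \<open>\<partial>([g\<^sub>0|\<dots>|g\<^sub>n] \<otimes> x) = [g\<^sub>1|\<dots>|g\<^sub>n] \<otimes> g\<^sub>0\<^sup>-\<^sup>1x + \<dots>\<close>; the value at \<open>ws\<close> collects all faces
  equal to \<open>ws\<close>.
\<close>

definition bar_boundary ::
    "('g, 'b) monoid_scheme \<Rightarrow> ('r, 'm, 'g, 'c) gmodule_scheme \<Rightarrow> nat
      \<Rightarrow> ('g list \<Rightarrow> 'm) \<Rightarrow> ('g list \<Rightarrow> 'm)"
  where "bar_boundary G M n c = (\<lambda>ws\<in>bar_tuples G n.
    finsum M (\<lambda>(vs, k). alternate M k
        (if k = 0 then gact M (inv\<^bsub>G\<^esub> (hd vs)) (c vs) else c vs))
      {(vs, k). vs \<in> bar_tuples G (Suc n) \<and> c vs \<noteq> \<zero>\<^bsub>M\<^esub> \<and> k \<le> Suc n \<and> bar_face G k vs = ws})"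

definition cocycles ::
    "('g, 'b) monoid_scheme \<Rightarrow> ('r, 'm, 'g, 'c) gmodule_scheme \<Rightarrow> nat \<Rightarrow> ('g list \<Rightarrow> 'm) set"
  where "cocycles G M n =
    kernel (cochain_group G M n) (cochain_group G M (Suc n)) (coboundary G M n)"

definition coboundaries ::
    "('g, 'b) monoid_scheme \<Rightarrow> ('r, 'm, 'g, 'c) gmodule_scheme \<Rightarrow> nat \<Rightarrow> ('g list \<Rightarrow> 'm) set"
  where "coboundaries G M n =
    (case n of 0 \<Rightarrow> {\<one>\<^bsub>cochain_group G M 0\<^esub>}
     | Suc k \<Rightarrow> coboundary G M k ` carrier (cochain_group G M k))"

definition cohomology ::
    "('g, 'b) monoid_scheme \<Rightarrow> ('r, 'm, 'g, 'c) gmodule_scheme \<Rightarrow> nat \<Rightarrow> ('g list \<Rightarrow> 'm) set monoid"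
  where "cohomology G M n =
    (cochain_group G M n)\<lparr>carrier := cocycles G M n\<rparr> Mod coboundaries G M n"

definition bar_cycles ::
    "('g, 'b) monoid_scheme \<Rightarrow> ('r, 'm, 'g, 'c) gmodule_scheme \<Rightarrow> nat \<Rightarrow> ('g list \<Rightarrow> 'm) set"
  where "bar_cycles G M n =
    (case n of 0 \<Rightarrow> carrier (bar_chain_group G M 0)
     | Suc k \<Rightarrow> kernel (bar_chain_group G M (Suc k)) (bar_chain_group G M k) (bar_boundary G M k))"

definition bar_boundaries ::
    "('g, 'b) monoid_scheme \<Rightarrow> ('r, 'm, 'g, 'c) gmodule_scheme \<Rightarrow> nat \<Rightarrow> ('g list \<Rightarrow> 'm) set"
  where "bar_boundaries G M n = bar_boundary G M n ` carrier (bar_chain_group G M (Suc n))"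

definition homology ::
    "('g, 'b) monoid_scheme \<Rightarrow> ('r, 'm, 'g, 'c) gmodule_scheme \<Rightarrow> nat \<Rightarrow> ('g list \<Rightarrow> 'm) set monoid"
  where "homology G M n =
    (bar_chain_group G M n)\<lparr>carrier := bar_cycles G M n\<rparr> Mod bar_boundaries G M n"

text \<open>
  The cap product of an \<open>n\<close>-chain with an \<open>i\<close>-cochain (\<open>i \<le> n\<close>), from the Alexander--Whitney
  diagonal on \<open>F\<close>, up to a sign depending only on \<open>n\<close> and \<open>i\<close>:
  \<open>([g\<^sub>1|\<dots>|g\<^sub>n] \<otimes> d) \<inter> u = [g\<^sub>1|\<dots>|g\<^sub>n\<^sub>-\<^sub>i] \<otimes> (d \<otimes> g\<^sub>1\<cdots>g\<^sub>n\<^sub>-\<^sub>i u[g\<^sub>n\<^sub>-\<^sub>i\<^sub>+\<^sub>1|\<dots>|g\<^sub>n])\<close>.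
\<close>

definition bar_cap ::
    "('r, 'a) ring_scheme \<Rightarrow> ('g, 'b) monoid_scheme
      \<Rightarrow> ('r, 'd, 'g, 'c) gmodule_scheme \<Rightarrow> ('r, 'm, 'g, 'e) gmodule_scheme \<Rightarrow> nat \<Rightarrow> nat
      \<Rightarrow> ('g list \<Rightarrow> 'd) \<Rightarrow> ('g list \<Rightarrow> 'm) \<Rightarrow> ('g list \<Rightarrow> ('d \<times> 'm \<Rightarrow>\<^sub>0 int) set)"
  where "bar_cap R G D A n i z u = (\<lambda>vs\<in>bar_tuples G (n - i).
    finsum (tensor R D A)
      (\<lambda>ws. tensor_class R D A
        (frag_of (z (vs @ ws), gact A (foldr (mult G) vs \<one>\<^bsub>G\<^esub>) (u ws))))
      {ws \<in> bar_tuples G i. z (vs @ ws) \<noteq> \<zero>\<^bsub>D\<^esub>})"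

definition cap_product ::
    "('r, 'a) ring_scheme \<Rightarrow> ('g, 'b) monoid_scheme
      \<Rightarrow> ('r, 'd, 'g, 'c) gmodule_scheme \<Rightarrow> ('r, 'm, 'g, 'e) gmodule_scheme \<Rightarrow> nat \<Rightarrow> nat
      \<Rightarrow> ('g list \<Rightarrow> 'd) set \<Rightarrow> ('g list \<Rightarrow> 'm) set \<Rightarrow> ('g list \<Rightarrow> ('d \<times> 'm \<Rightarrow>\<^sub>0 int) set) set"
  where "cap_product R G D A n i Z U =
    (\<Union>z\<in>Z. \<Union>u\<in>U. bar_boundaries G (tensor R D A) (n - i)
      #>\<^bsub>bar_chain_group G (tensor R D A) (n - i)\<^esub> bar_cap R G D A n i z u)"


section \<open>Poincare duality groups\<close>

text \<open>
  Definitions cannot quantify over types, so the coefficient modules \<open>A\<close> have their elements in the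
  type \<open>'g list \<Rightarrow> 'r\<close>. If \<open>R\<close> is not the zero ring, this type is large enough to contain a copy of
  every \<open>R[G]\<close>-module of cardinality at most \<open>max(|R|, |G|, \<aleph>\<^sub>0)\<close>, in particular of every subquotient of a
  countably generated free module; by the Bieri--Eckmann finiteness criterion, duality for these
  coefficients implies duality for all \<open>R[G]\<close>-modules. Similarly, the dualizing module may
  be taken on the type of \<open>R\<close>, as it is isomorphic to \<open>R\<close> as an \<open>R\<close>-module.

  Taking the cap product with a fixed class is automatically natural in \<open>A\<close> and \<open>R\<close>-linear. The last
  clause is the case of negative homological degree \<open>n - i\<close>.
\<close>

definition dualizing_module ::
    "('r, 'a) ring_scheme \<Rightarrow> ('g, 'b) monoid_scheme \<Rightarrow> ('r, 'r, 'g) gmodule \<Rightarrow> bool"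
  where "dualizing_module R G D \<longleftrightarrow> gmodule R G D \<and>
    (\<exists>\<phi>. bij_betw \<phi> (carrier R) (carrier D) \<and>
      (\<forall>x\<in>carrier R. \<forall>y\<in>carrier R. \<phi> (x \<oplus>\<^bsub>R\<^esub> y) = \<phi> x \<oplus>\<^bsub>D\<^esub> \<phi> y) \<and>
      (\<forall>r\<in>carrier R. \<forall>x\<in>carrier R. \<phi> (r \<otimes>\<^bsub>R\<^esub> x) = r \<odot>\<^bsub>D\<^esub> \<phi> x))"

definition PD_group :: "('r, 'a) ring_scheme \<Rightarrow> ('g, 'b) monoid_scheme \<Rightarrow> nat \<Rightarrow> bool"
  where "PD_group R G n \<longleftrightarrow> cring R \<and> group G \<and>
    (\<exists>D. dualizing_module R G D \<and>
      (\<exists>\<mu>\<in>carrier (homology G D n).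
        \<forall>A :: ('r, 'g list \<Rightarrow> 'r, 'g) gmodule. gmodule R G A \<longrightarrow>
          (\<forall>i\<le>n. cap_product R G D A n i \<mu> \<in> iso (cohomology G A i) (homology G (tensor R D A) (n - i))) \<and>
          (\<forall>i>n. trivial_group (cohomology G A i))))"

definition real_ring :: "real ring"
  where "real_ring = \<lparr>carrier = UNIV, mult = (*), one = 1, ring.zero = 0, ring.add = (+)\<rparr>"

end

theory Submission
  imports Defs
begin

text \<open>
  Suppose that \<open>G\<close> acts faithfully on the circle by piecewise linear homeomorphisms. The idea is to
  remove all break points of the action by changing the affine structure of the circle; the
  obstruction is a cohomology class of degree 1, which duality moves to homology of degree
  \<open>n - 1 \<ge> 2\<close>, where it vanishes because the point stabilisers are cyclic.

  Point stabilisers. The orientation preserving elements that fix a point act on an interval by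
  increasing piecewise linear maps. By an argument of Brin and Squier
  (\<open>noncommuting_imp_disjoint_commuting\<close>), if two of them do not commute, then there are commuting
  elements \<open>v\<close> and \<open>w \<noteq> 1\<close> and a point that is fixed by \<open>w\<close> but not by \<open>v\<close>. In a torsion-free
  hyperbolic group, however, every element that commutes with \<open>w\<close> has a positive power in the cyclic
  group generated by \<open>w\<close>, because balls meet the centraliser of \<open>w\<close> in a set of linear size
  (\<open>centralizer_linear_growth\<close>). So the orientation preserving part of the stabiliser is
  commutative, hence cyclic, and then the whole stabiliser is cyclic (\<open>stabilizer_cyclic\<close>).

  The cocycle. For \<open>g\<close> in \<open>G\<close> and a point \<open>c\<close> of the circle let \<open>J(g, c)\<close> be the logarithm of the
  quotient of the slopes of \<open>g\<close> on the two sides of \<open>c\<close>. It vanishes for all but finitely many \<open>c\<close>,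
  and the chain rule reads \<open>J(gh, c) = J(h, c) \<plusminus> J(g, hc)\<close>, with a minus sign if \<open>h\<close> reverses the
  orientation. So \<open>g \<mapsto> J(g\<^sup>-\<^sup>1, \<cdot>)\<close> is a 1-cocycle with values in a module of finitely supported real
  functions on a set of points, on which \<open>G\<close> permutes the basis vectors up to sign. Duality identifies
  its class with a homology class of degree \<open>n - 1\<close> with coefficients in a module of the same kind.
  Up to Shapiro's lemma this is a sum of homology classes of cyclic groups, which have homological
  dimension at most one; the bar complex is contracted directly in degrees at least 2
  (\<open>cycle_is_boundary\<close>). Hence \<open>J(g, c) = \<plusminus> f(gc) - f(c)\<close> for a finitely supported \<open>f\<close>
  (\<open>jump_coboundary\<close>).

  The new affine structure. Let \<open>\<psi>\<close> be an increasing piecewise linear function on the line, with jumps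
  \<open>-f\<close>. It conjugates lifts of orientation preserving elements of \<open>G\<close>, and also the translation by 1,
  to maps without jumps, that is, to affine maps \<open>s \<mapsto> As + B\<close> and \<open>s \<mapsto> Cs + D\<close>. The former commute with
  the latter, which has no fixed point on the image of \<open>\<psi>\<close>, and therefore they commute with each other
  (\<open>positive_commutative\<close>). So the orientation preserving part of \<open>G\<close> is commutative, and as above
  \<open>G\<close> is cyclic. But then the homology of \<open>G\<close> vanishes in degree \<open>n\<close>, so by duality \<open>H\<^sup>0(G, \<real>) = 0\<close>,
  although the constants are invariant (\<open>no_PD_action\<close>).
\<close>

section \<open>Cayley graphs\<close>

lemma graph_dist_le: "(x, y) \<in> E ^^ n \<Longrightarrow> graph_dist E x y \<le> n"
  unfolding graph_dist_def by (rule Least_le)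

lemma graph_dist_attained: "(x, y) \<in> E ^^ n \<Longrightarrow> (x, y) \<in> E ^^ graph_dist E x y"
  unfolding graph_dist_def by (rule LeastI)

locale connected_cayley_graph = group G for G :: "('g, 'b) monoid_scheme" (structure) +
  fixes S :: "'g set"
  assumes fin_S: "finite S" and S_sub: "S \<subseteq> carrier G" and gen_S: "generate G S = carrier G"
begin

abbreviation E where "E \<equiv> cayley_edges G S"
abbreviation cay_dist where "cay_dist \<equiv> graph_dist E"

lemma edge_closed: "(x, y) \<in> E \<Longrightarrow> x \<in> carrier G \<and> y \<in> carrier G"
  using S_sub unfolding cayley_edges_def by blast

lemma edge_translate: "g \<in> carrier G \<Longrightarrow> (x, y) \<in> E \<Longrightarrow> (g \<otimes> x, g \<otimes> y) \<in> E"
proof -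
  assume g: "g \<in> carrier G" and "(x, y) \<in> E"
  then obtain s where s: "x \<in> carrier G" "s \<in> S \<union> m_inv G ` S" "y = x \<otimes> s"
    unfolding cayley_edges_def by blast
  then have "s \<in> carrier G" using S_sub by auto
  then have "g \<otimes> y = (g \<otimes> x) \<otimes> s" using s g by (simp add: m_assoc)
  then show ?thesis unfolding cayley_edges_def using s g by blast
qed

lemma edge_sym: "(x, y) \<in> E \<Longrightarrow> (y, x) \<in> E"
proof -
  assume "(x, y) \<in> E"
  then obtain s where s: "x \<in> carrier G" "s \<in> S \<union> m_inv G ` S" "y = x \<otimes> s"
    unfolding cayley_edges_def by blast
  then have c: "s \<in> carrier G" using S_sub by auto
  have i: "inv s \<in> S \<union> m_inv G ` S" using s(2) S_sub by auto
  have "x = y \<otimes> inv s" using s c by (simp add: m_assoc)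
  moreover have "(y, y \<otimes> inv s) \<in> E"
    unfolding cayley_edges_def mem_Collect_eq using i s(1) c s(3)
    by (intro exI[of _ y] exI[of _ "inv s"]) simp
  ultimately show ?thesis by simp
qed

lemma path_closed: "(x, y) \<in> E ^^ n \<Longrightarrow> x \<in> carrier G \<Longrightarrow> y \<in> carrier G"
  by (induction n arbitrary: y) (auto dest: edge_closed)

lemma path_translate: "g \<in> carrier G \<Longrightarrow> (x, y) \<in> E ^^ n \<Longrightarrow> (g \<otimes> x, g \<otimes> y) \<in> E ^^ n"
proof (induction n arbitrary: y)
  case (Suc n)
  from Suc.prems(2) obtain z where "(x, z) \<in> E ^^ n" "(z, y) \<in> E" by (rule relpow_Suc_E)
  then show ?case using Suc.IH Suc.prems(1) edge_translate relpow_Suc_I by metis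
qed simp

lemma path_sym: "(x, y) \<in> E ^^ n \<Longrightarrow> (y, x) \<in> E ^^ n"
proof (induction n arbitrary: y)
  case (Suc n)
  from Suc.prems obtain z where "(x, z) \<in> E ^^ n" "(z, y) \<in> E" by (rule relpow_Suc_E)
  then show ?case using relpow_Suc_I2[OF edge_sym Suc.IH] by simp
qed simp

lemma path_from_one: "x \<in> carrier G \<Longrightarrow> \<exists>n. (\<one>, x) \<in> E ^^ n"
proof -
  have "x \<in> generate G S \<Longrightarrow> \<exists>n. (\<one>, x) \<in> E ^^ n" for x
  proof (induction rule: generate.induct)
    case one
    show ?case using relpow_0_I[of "\<one>" E] by blast
  next
    case (incl h)
    have "(\<one>, \<one> \<otimes> h) \<in> E" using incl unfolding cayley_edges_def by blast
    then have "(\<one>, h) \<in> E ^^ 1" using incl S_sub by auto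
    then show ?case by blast
  next
    case (inv h)
    have "(\<one>, \<one> \<otimes> inv h) \<in> E" using inv unfolding cayley_edges_def by blast
    then have "(\<one>, inv h) \<in> E ^^ 1" using inv S_sub by auto
    then show ?case by blast
  next
    case (eng h1 h2)
    then obtain m n where mn: "(\<one>, h1) \<in> E ^^ m" "(\<one>, h2) \<in> E ^^ n" by blast
    have h: "h1 \<in> carrier G" using eng gen_S by blast
    have "(h1, h1 \<otimes> h2) \<in> E ^^ n" using path_translate[OF h mn(2)] h by simp
    then have "(\<one>, h1 \<otimes> h2) \<in> E ^^ (m + n)" using mn(1) by (auto simp: relpow_add)
    then show ?case by blast
  qed
  then show "x \<in> carrier G \<Longrightarrow> \<exists>n. (\<one>, x) \<in> E ^^ n" using gen_S by blast
qed

lemma path_exists: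
  assumes "x \<in> carrier G" "y \<in> carrier G"
  shows "(x, y) \<in> E ^^ cay_dist x y"
proof -
  obtain n where "(\<one>, inv x \<otimes> y) \<in> E ^^ n" using path_from_one assms by blast
  from path_translate[OF assms(1) this] have "(x, y) \<in> E ^^ n"
    using assms by (simp add: m_assoc[symmetric])
  then show ?thesis by (rule graph_dist_attained)
qed

lemma dist_translate:
  assumes "g \<in> carrier G" "x \<in> carrier G" "y \<in> carrier G"
  shows "cay_dist (g \<otimes> x) (g \<otimes> y) = cay_dist x y"
proof (rule antisym)
  show "cay_dist (g \<otimes> x) (g \<otimes> y) \<le> cay_dist x y"
    by (rule graph_dist_le[OF path_translate[OF assms(1) path_exists[OF assms(2,3)]]])
  have "(inv g \<otimes> (g \<otimes> x), inv g \<otimes> (g \<otimes> y)) \<in> E ^^ cay_dist (g \<otimes> x) (g \<otimes> y)"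
    using assms by (intro path_translate path_exists) auto
  then show "cay_dist x y \<le> cay_dist (g \<otimes> x) (g \<otimes> y)"
    using assms by (intro graph_dist_le) (simp add: m_assoc[symmetric])
qed

lemma dist_triangle:
  assumes "x \<in> carrier G" "y \<in> carrier G" "z \<in> carrier G"
  shows "cay_dist x z \<le> cay_dist x y + cay_dist y z"
  using relcompI[OF path_exists[OF assms(1,2)] path_exists[OF assms(2,3)]]
  by (intro graph_dist_le) (simp only: relpow_add)

lemma dist_commute:
  assumes "x \<in> carrier G" "y \<in> carrier G"
  shows "cay_dist x y = cay_dist y x"
  by (rule antisym; rule graph_dist_le; rule path_sym; rule path_exists) (use assms in simp_all)

definition word_length where "word_length x = cay_dist \<one> x"

lemma dist_word_length:
  assumes "x \<in> carrier G" "y \<in> carrier G"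
  shows "cay_dist x y = word_length (inv x \<otimes> y)"
  using dist_translate[of "inv x" x y] assms by (simp add: word_length_def)

lemma word_length_mult:
  assumes "x \<in> carrier G" "y \<in> carrier G"
  shows "word_length (x \<otimes> y) \<le> word_length x + word_length y"
  using dist_triangle[of "\<one>" x "x \<otimes> y"] dist_word_length[of x "x \<otimes> y"] assms
  by (simp add: word_length_def m_assoc[symmetric])

lemma word_length_pow:
  assumes "x \<in> carrier G"
  shows "word_length (x [^] (n::nat)) \<le> n * word_length x"
proof (induction n)
  case 0
  have "cay_dist \<one> \<one> \<le> 0" by (rule graph_dist_le) simp
  then show ?case by (simp add: word_length_def)
next
  case (Suc n)
  then show ?case using word_length_mult[of "x [^] n" x] assms by simp
qed

lemma finite_ball: "finite {x \<in> carrier G. word_length x \<le> r}"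
proof -
  have fin: "finite {x. (\<one>, x) \<in> E ^^ n}" for n
  proof (induction n)
    case (Suc n)
    have "{x. (\<one>, x) \<in> E ^^ Suc n} \<subseteq>
        (\<lambda>(y, s). y \<otimes> s) ` ({x. (\<one>, x) \<in> E ^^ n} \<times> (S \<union> m_inv G ` S))"
      by (force simp: cayley_edges_def image_iff)
    then show ?case using Suc fin_S by (meson finite_SigmaI finite_UnI finite_imageI finite_subset)
  qed simp
  have "{x \<in> carrier G. word_length x \<le> r} \<subseteq> (\<Union>n\<in>{..r}. {x. (\<one>, x) \<in> E ^^ n})"
    using path_exists by (auto simp: word_length_def)
  then show ?thesis using fin by (meson finite_UN_I finite_atMost finite_subset)
qed

lemma countable_carrier: "countable (carrier G)"
proof -
  have "countable (\<Union>r. {x \<in> carrier G. word_length x \<le> r})"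
    by (rule countable_UN[OF countableI_type countable_finite[OF finite_ball]])
  moreover have "(\<Union>r. {x \<in> carrier G. word_length x \<le> r}) = carrier G" by auto
  ultimately show ?thesis by simp
qed

lemma geodesic_exists:
  assumes "x \<in> carrier G" "y \<in> carrier G"
  obtains p where "geodesic_path E x y p (cay_dist x y)"
  using path_exists[OF assms] unfolding relpow_fun_conv geodesic_path_def by blast

lemma geodesic_dist:
  assumes "geodesic_path E x y p l" "x \<in> carrier G" "y \<in> carrier G" "i \<le> l"
  shows "p i \<in> carrier G" "cay_dist x (p i) = i" "cay_dist (p i) y = l - i"
proof -
  have step: "\<And>i. i < l \<Longrightarrow> (p i, p (Suc i)) \<in> E" and ends: "p 0 = x" "p l = y" "l = cay_dist x y"
    using assms(1) by (auto simp: geodesic_path_def)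
  have seg: "(p j, p (j + k)) \<in> E ^^ k" if "j + k \<le> l" for j k
    using that
  proof (induction k)
    case (Suc k)
    then show ?case using relpow_Suc_I[of "p j" "p (j + k)" k E] step[of "j + k"] by simp
  qed simp
  have a: "(x, p i) \<in> E ^^ i" using seg[of 0 i] assms(4) ends by simp
  have b: "(p i, y) \<in> E ^^ (l - i)" using seg[of i "l - i"] assms(4) ends by simp
  show c: "p i \<in> carrier G" using path_closed[OF a assms(2)] .
  have "cay_dist x (p i) \<le> i" "cay_dist (p i) y \<le> l - i"
    by (rule graph_dist_le[OF a], rule graph_dist_le[OF b])
  moreover have "l \<le> cay_dist x (p i) + cay_dist (p i) y"
    unfolding ends(3) by (rule dist_triangle) (use assms c in auto)
  ultimately show "cay_dist x (p i) = i" "cay_dist (p i) y = l - i" using assms(4) by auto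
qed

lemma geodesic_translate:
  assumes "geodesic_path E x y p l" "x \<in> carrier G" "y \<in> carrier G" "g \<in> carrier G"
  shows "geodesic_path E (g \<otimes> x) (g \<otimes> y) (\<lambda>i. g \<otimes> p i) l"
  using assms unfolding geodesic_path_def by (auto simp: edge_translate dist_translate)

end

section \<open>Centralisers in hyperbolic groups\<close>

locale hyperbolic_cayley_graph = connected_cayley_graph +
  fixes \<delta> :: nat
  assumes slim: "\<lbrakk>x \<in> carrier G; y \<in> carrier G; z \<in> carrier G;
      geodesic_path E x y p k; geodesic_path E y z q l; geodesic_path E x z r m; i \<le> k\<rbrakk>
      \<Longrightarrow> (\<exists>j\<le>l. cay_dist (p i) (q j) \<le> \<delta>) \<or> (\<exists>j\<le>m. cay_dist (p i) (r j) \<le> \<delta>)"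
begin

text \<open>
  A diagonal cuts the quadrilateral into two slim triangles, so the point \<open>p i\<close> is within \<open>2\<delta>\<close> of one of
  the other three sides. The hypotheses \<open>far\<close> say that it is too far from the ends of its own side to be
  that close to one of the two adjacent sides; so it is close to the opposite side.
\<close>

lemma slim_quadrilateral:
  assumes c: "x \<in> carrier G" "y \<in> carrier G" "z \<in> carrier G" "w \<in> carrier G"
    and p: "geodesic_path E x y p k" and q: "geodesic_path E w z q m" and i: "i \<le> k"
    and far: "cay_dist x w + 2 * \<delta> < i" "cay_dist y z + 2 * \<delta> < k - i"
  shows "\<exists>j\<le>m. cay_dist (p i) (q j) \<le> 2 * \<delta>"
proof -
  obtain yz where yz: "geodesic_path E y z yz (cay_dist y z)" using geodesic_exists c by metis
  obtain xz where xz: "geodesic_path E x z xz (cay_dist x z)" using geodesic_exists c by metis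
  obtain xw where xw: "geodesic_path E x w xw (cay_dist x w)" using geodesic_exists c by metis
  have zx: "geodesic_path E x z xz (cay_dist x z)" by (rule xz)
  note P = geodesic_dist[OF p c(1,2) i]
  have not_yz: "\<not> cay_dist (p i) (yz j) \<le> 2 * \<delta>" if "j \<le> cay_dist y z" for j
  proof
    assume A: "cay_dist (p i) (yz j) \<le> 2 * \<delta>"
    note Q = geodesic_dist[OF yz c(2,3) that]
    have "k - i \<le> cay_dist (p i) (yz j) + cay_dist (yz j) y"
      unfolding P(3)[symmetric] by (rule dist_triangle) (use P Q c in auto)
    also have "cay_dist (yz j) y = j" using Q(2) dist_commute[OF Q(1) c(2)] by simp
    finally show False using A far that by linarith
  qed
  have not_xw: "\<not> cay_dist (p i) (xw j) \<le> 2 * \<delta>" if "j \<le> cay_dist x w" for j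
  proof
    assume A: "cay_dist (p i) (xw j) \<le> 2 * \<delta>"
    note Q = geodesic_dist[OF xw c(1,4) that]
    have "i \<le> cay_dist x (xw j) + cay_dist (xw j) (p i)"
      using dist_triangle[of x "xw j" "p i"] P Q c by simp
    also have "cay_dist (xw j) (p i) = cay_dist (p i) (xw j)" by (rule dist_commute[OF Q(1) P(1)])
    finally show False using A far that Q by linarith
  qed
  have "\<not> (\<exists>j\<le>cay_dist y z. cay_dist (p i) (yz j) \<le> \<delta>)" using not_yz by force
  then obtain j where j: "j \<le> cay_dist x z" "cay_dist (p i) (xz j) \<le> \<delta>"
    using slim[OF c(1,2,3) p yz xz i] by blast
  note XZ = geodesic_dist[OF xz c(1,3) j(1)]
  have via: "cay_dist (p i) u \<le> 2 * \<delta>" if "u \<in> carrier G" "cay_dist (xz j) u \<le> \<delta>" for u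
    using dist_triangle[of "p i" "xz j" u] P XZ that j by simp
  \<comment> \<open>The diagonal is compared with the other two sides of the triangle \<open>x, z, w\<close>; for this its side from
     \<open>w\<close> to \<open>z\<close> has to be traversed backwards.\<close>
  have rev: "geodesic_path E z w (\<lambda>j. q (m - j)) m"
    unfolding geodesic_path_def
  proof (intro conjI allI impI)
    fix j assume "j < m"
    then have "(q (m - Suc j), q (Suc (m - Suc j))) \<in> E" "Suc (m - Suc j) = m - j"
      using q by (auto simp: geodesic_path_def)
    then show "(q (m - j), q (m - Suc j)) \<in> E" by (metis edge_sym)
  qed (use q c dist_commute in \<open>auto simp: geodesic_path_def\<close>)
  from slim[OF c(1,3,4) xz rev xw j(1)]
  show ?thesis
  proof
    assume "\<exists>t\<le>m. cay_dist (xz j) (q (m - t)) \<le> \<delta>"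
    then obtain t where t: "t \<le> m" "cay_dist (xz j) (q (m - t)) \<le> \<delta>" by blast
    then have "cay_dist (p i) (q (m - t)) \<le> 2 * \<delta>"
      using geodesic_dist[OF q c(4,3), of "m - t"] via by simp
    then show ?thesis by (meson diff_le_self)
  next
    assume "\<exists>t\<le>cay_dist x w. cay_dist (xz j) (xw t) \<le> \<delta>"
    then obtain t where t: "t \<le> cay_dist x w" "cay_dist (xz j) (xw t) \<le> \<delta>" by (elim exE conjE)
    have "cay_dist (p i) (xw t) \<le> 2 * \<delta>"
      by (rule via[OF geodesic_dist(1)[OF xw c(1,4) t(1)] t(2)])
    then show ?thesis using not_xw[OF t(1)] by simp
  qed
qed

text \<open>
  Let \<open>x\<close> commute with \<open>a\<close> and have length at most \<open>R\<close>. Choose \<open>N\<close>, depending only on \<open>R\<close>, such that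
  \<open>a ^ N\<close> is much longer than \<open>R\<close>. A geodesic \<open>p\<close> from \<open>1\<close> to \<open>a ^ N\<close> and its translate \<open>x p\<close>, which ends at
  \<open>x a ^ N = a ^ N x\<close>, are long opposite sides of a quadrilateral whose other sides have length at most
  \<open>R\<close>. So the middle \<open>p i\<close> of the first side is close to some point \<open>x p j\<close> of the second one, and
  \<open>x = p i \<cdot> u \<cdot> (p j)\<^sup>-\<^sup>1\<close> with \<open>u\<close> of length at most \<open>2\<delta>\<close>. As \<open>i\<close> is fixed and \<open>j\<close> differs from it by at
  most \<open>R + 2\<delta>\<close>, the number of pairs \<open>(u, j)\<close>, and hence of elements \<open>x\<close>, is linear in \<open>R\<close>.
\<close>

lemma centralizer_linear_growth:
  assumes a: "a \<in> carrier G" and inf: "\<And>n::nat. n > 0 \<Longrightarrow> a [^] n \<noteq> \<one>"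
  defines "b \<equiv> card {x \<in> carrier G. word_length x \<le> 2 * \<delta>}"
  shows "card {x \<in> carrier G. a \<otimes> x = x \<otimes> a \<and> word_length x \<le> R} \<le> b * (2 * R + 4 * \<delta> + 1)"
proof -
  have "\<exists>N::nat. word_length (a [^] N) > 2 * R + 4 * \<delta> + 4"
  proof (rule ccontr)
    assume "\<not> ?thesis"
    then have "range (\<lambda>N::nat. a [^] N) \<subseteq> {x \<in> carrier G. word_length x \<le> 2 * R + 4 * \<delta> + 4}"
      using a by (auto simp: not_less)
    then have "finite (range (\<lambda>N::nat. a [^] N))" using finite_ball finite_subset by blast
    then have "\<not> inj (\<lambda>N::nat. a [^] N)" using finite_imageD infinite_UNIV_nat by blast
    then obtain m n :: nat where "a [^] m = a [^] n" "m \<noteq> n" by (auto simp: inj_def)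
    then obtain m n :: nat where mn: "a [^] m = a [^] n" "m < n" by (metis nat_neq_iff)
    then have "a [^] (n - m) = \<one>" using pow_eq_div2[OF a, of n m] by simp
    then show False using inf mn by simp
  qed
  then obtain N :: nat where N: "word_length (a [^] N) > 2 * R + 4 * \<delta> + 4" by blast
  define L where "L = word_length (a [^] N)"
  define i where "i = L div 2"
  have aN: "a [^] N \<in> carrier G" using a by simp
  obtain p where p: "geodesic_path E \<one> (a [^] N) p L"
    using geodesic_exists[of "\<one>" "a [^] N"] aN unfolding L_def word_length_def by auto
  have iL: "i \<le> L" and i1: "R + 2 * \<delta> < i" and i2: "R + 2 * \<delta> < L - i"
    using N unfolding i_def L_def by linarith+
  note P = geodesic_dist[OF p one_closed aN]
  let ?B = "{x \<in> carrier G. word_length x \<le> 2 * \<delta>}" and ?J = "{i - (R + 2 * \<delta>)..i + (R + 2 * \<delta>)}"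
  let ?C = "{x \<in> carrier G. a \<otimes> x = x \<otimes> a \<and> word_length x \<le> R}"
  have "?C \<subseteq> (\<lambda>(u, j). p i \<otimes> u \<otimes> inv (p j)) ` (?B \<times> (?J \<inter> {..L}))"
  proof
    fix x assume "x \<in> ?C"
    then have x: "x \<in> carrier G" and comm: "a \<otimes> x = x \<otimes> a" and len: "word_length x \<le> R" by auto
    have comm': "x \<otimes> a [^] N = a [^] N \<otimes> x"
      using comm x a by (metis nat_pow_Suc2 pow_mult_distrib group_commutes_pow)
    have q: "geodesic_path E x (x \<otimes> a [^] N) (\<lambda>i. x \<otimes> p i) L"
      using geodesic_translate[OF p one_closed aN x] x by simp
    have d1: "cay_dist \<one> x \<le> R" using len by (simp add: word_length_def)
    have d2: "cay_dist (a [^] N) (x \<otimes> a [^] N) \<le> R"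
      unfolding comm' using dist_translate[OF aN one_closed x] aN d1 by simp
    have "\<exists>j\<le>L. cay_dist (p i) (x \<otimes> p j) \<le> 2 * \<delta>"
      by (rule slim_quadrilateral[OF one_closed aN _ x p q iL]) (use d1 d2 i1 i2 x aN in auto)
    then obtain j where j: "j \<le> L" "cay_dist (p i) (x \<otimes> p j) \<le> 2 * \<delta>" by blast
    note pi = P[OF iL] and pj = P[OF j(1)]
    have xpj: "cay_dist x (x \<otimes> p j) = j" using dist_translate[OF x one_closed pj(1)] x pj by simp
    have "i \<le> cay_dist \<one> x + (cay_dist x (x \<otimes> p j) + cay_dist (x \<otimes> p j) (p i))"
      using dist_triangle[of "\<one>" x "p i"] dist_triangle[of x "x \<otimes> p j" "p i"] pi pj x by simp
    moreover have "cay_dist (x \<otimes> p j) (p i) = cay_dist (p i) (x \<otimes> p j)"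
      using dist_commute pi pj x by simp
    moreover have "cay_dist x (x \<otimes> p j) \<le> cay_dist x \<one> + (cay_dist \<one> (p i) + cay_dist (p i) (x \<otimes> p j))"
      using dist_triangle[of x "\<one>" "x \<otimes> p j"] dist_triangle[of "\<one>" "p i" "x \<otimes> p j"] pi pj x by simp
    moreover have "cay_dist x \<one> = cay_dist \<one> x" using dist_commute x by simp
    ultimately have jJ: "j \<in> ?J" using d1 j(2) xpj pi(2) by auto
    define u where "u = inv (p i) \<otimes> (x \<otimes> p j)"
    have u: "u \<in> ?B" using j(2) dist_word_length[of "p i" "x \<otimes> p j"] x pi pj by (simp add: u_def)
    have "x = p i \<otimes> u \<otimes> inv (p j)"
      unfolding u_def using x pi pj by (simp add: m_assoc[symmetric]) (simp add: m_assoc)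
    then show "x \<in> (\<lambda>(u, j). p i \<otimes> u \<otimes> inv (p j)) ` (?B \<times> (?J \<inter> {..L}))" using u jJ j(1) by auto
  qed
  then have "card ?C \<le> card (?B \<times> (?J \<inter> {..L}))" by (rule surj_card_le[rotated]) (simp add: finite_ball)
  also have "\<dots> \<le> b * card ?J" unfolding b_def card_cartesian_product by (intro mult_left_mono card_mono) auto
  also have "card ?J \<le> 2 * R + 4 * \<delta> + 1" by simp
  finally show ?thesis by simp
qed

text \<open>
  If \<open>1, x, \<dots>, x ^ M\<close> were in distinct cosets of the group generated by \<open>a\<close>, then the products
  \<open>a ^ i x ^ j\<close> with \<open>i < R\<close> and \<open>j \<le> M\<close> would be \<open>R (M + 1)\<close> distinct elements of the centraliser of \<open>a\<close>, of
  length at most \<open>R \<bar>a\<bar>\<close> plus a constant. For large \<open>M\<close>, depending only on \<open>a\<close>, this exceeds the linear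
  growth of the centraliser as soon as \<open>R\<close> is large.
\<close>

lemma power_of_centralizing_element:
  assumes a: "a \<in> carrier G" and inf: "\<And>n::nat. n > 0 \<Longrightarrow> a [^] n \<noteq> \<one>"
  shows "\<exists>M::nat. \<forall>x\<in>carrier G. a \<otimes> x = x \<otimes> a \<longrightarrow> (\<exists>k\<in>{1..M}. \<exists>n::int. x [^] k = a [^] n)"
proof -
  define b where "b = card {x \<in> carrier G. word_length x \<le> 2 * \<delta>}"
  define l where "l = word_length a"
  define M where "M = 2 * b * l + 1"
  have "\<exists>k\<in>{1..M}. \<exists>n::int. x [^] k = a [^] n" if x: "x \<in> carrier G" and comm: "a \<otimes> x = x \<otimes> a" for x
  proof (rule ccontr)
    assume no: "\<not> ?thesis"
    define m where "m = M * word_length x"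
    define R where "R = b * (2 * m + 4 * \<delta> + 1) + 1"
    let ?C = "{x \<in> carrier G. a \<otimes> x = x \<otimes> a \<and> word_length x \<le> R * l + m}"
    let ?f = "\<lambda>(i::nat, j::nat). a [^] i \<otimes> x [^] j"
    have a_i: "a [^] (int i) = a [^] i" for i :: nat by (simp add: int_pow_int)
    have diff: False if "i < R" "i' < R" "j < j'" "j' < Suc M" "a [^] i \<otimes> x [^] j = a [^] i' \<otimes> x [^] j'"
      for i i' j j' :: nat
    proof -
      have "a [^] i \<otimes> x [^] j = (a [^] i' \<otimes> x [^] (j' - j)) \<otimes> x [^] j"
        using that x a by (simp add: m_assoc nat_pow_mult)
      then have "a [^] i = a [^] i' \<otimes> x [^] (j' - j)" using x a by simp
      then have "x [^] (j' - j) = inv (a [^] i') \<otimes> a [^] i" using x a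
        by (simp add: m_assoc[symmetric])
      also have "\<dots> = a [^] (int i - int i')"
        using a int_pow_mult[of a "- int i'" "int i"] by (simp add: int_pow_neg a_i)
      finally have "x [^] (j' - j) = a [^] (int i - int i')" .
      moreover have "j' - j \<in> {1..M}" using that by auto
      ultimately show False using no by blast
    qed
    have inj_a: "i = i'" if "a [^] i = a [^] i'" for i i' :: nat
    proof -
      have "\<not> i < i'" if "a [^] i = a [^] i'" for i i' :: nat
      proof
        assume "i < i'"
        have "a [^] (i' - i) = \<one>" using pow_eq_div2[OF a, of i' i] that by simp
        then show False using inf \<open>i < i'\<close> by simp
      qed
      then show ?thesis using that by (metis nat_neq_iff)
    qed
    have "inj_on ?f ({..<R} \<times> {..<Suc M})"
    proof (rule inj_onI, clarsimp)
      fix i j i' j' :: nat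
      assume A: "i < R" "i' < R" "j < Suc M" "j' < Suc M" "a [^] i \<otimes> x [^] j = a [^] i' \<otimes> x [^] j'"
      have "j = j'" using diff[of i i' j j'] diff[of i' i j' j] A by (metis nat_neq_iff)
      with A have "a [^] i = a [^] i'" using a x by simp
      then show "i = i' \<and> j = j'" using inj_a \<open>j = j'\<close> by simp
    qed
    then have "R * Suc M = card (?f ` ({..<R} \<times> {..<Suc M}))" by (simp add: card_image)
    also have "\<dots> \<le> card ?C"
    proof (rule card_mono)
      have "?C \<subseteq> {x \<in> carrier G. word_length x \<le> R * l + m}" by auto
      then show "finite ?C" using finite_ball finite_subset by blast
      show "?f ` ({..<R} \<times> {..<Suc M}) \<subseteq> ?C"
      proof clarsimp
        fix i j :: nat assume ij: "i < R" "j < Suc M"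
        have "a \<otimes> x [^] j = x [^] j \<otimes> a"
          using group_commutes_pow[of x a j] comm x a by simp
        then have *: "a \<otimes> (a [^] i \<otimes> x [^] j) = a [^] i \<otimes> x [^] j \<otimes> a"
          using a x by (simp add: m_assoc[symmetric] nat_pow_Suc2[symmetric]) (simp add: m_assoc)
        moreover have "word_length (a [^] i \<otimes> x [^] j) \<le> i * l + j * word_length x"
          using word_length_mult[of "a [^] i" "x [^] j"] word_length_pow[of a i] word_length_pow[of x j] a x
          by (simp add: l_def)
        moreover have "i * l \<le> R * l" "j * word_length x \<le> m"
          using ij unfolding m_def by (auto intro!: mult_right_mono)
        ultimately have "word_length (a [^] i \<otimes> x [^] j) \<le> R * l + m" by linarith
        then show "a [^] i \<otimes> x [^] j \<in> carrier G \<and> a \<otimes> (a [^] i \<otimes> x [^] j) = a [^] i \<otimes> x [^] j \<otimes> a \<and>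
            word_length (a [^] i \<otimes> x [^] j) \<le> R * l + m"
          using a x * by auto
      qed
    qed
    also have "\<dots> \<le> b * (2 * (R * l + m) + 4 * \<delta> + 1)"
      unfolding b_def by (rule centralizer_linear_growth[OF a inf])
    finally have "R * (2 * b * l + 2) \<le> 2 * b * l * R + (R - 1)"
      unfolding M_def by (simp add: R_def algebra_simps)
    then have "2 * R \<le> R - 1" by (simp add: algebra_simps)
    then show False by (simp add: R_def)
  qed
  then show ?thesis by blast
qed

end

lemma word_hyperbolic_cayley_graph:
  assumes "group G" "word_hyperbolic G"
  obtains S \<delta> where "hyperbolic_cayley_graph G S \<delta>"
proof -
  obtain S where S: "finite S" "S \<subseteq> carrier G" "generate G S = carrier G"
      "gromov_hyperbolic_graph (carrier G) (cayley_edges G S)"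
    using assms(2) unfolding word_hyperbolic_def by blast
  interpret connected_cayley_graph G S
    using assms(1) S by (simp add: connected_cayley_graph_def connected_cayley_graph_axioms_def)
  obtain \<delta> where \<delta>: "\<forall>x\<in>carrier G. \<forall>y\<in>carrier G. \<forall>z\<in>carrier G. \<forall>p k q l r m.
      geodesic_path E x y p k \<longrightarrow> geodesic_path E y z q l \<longrightarrow> geodesic_path E x z r m \<longrightarrow>
      (\<forall>i\<le>k. (\<exists>j\<le>l. cay_dist (p i) (q j) \<le> \<delta>) \<or> (\<exists>j\<le>m. cay_dist (p i) (r j) \<le> \<delta>))"
    using S(4) unfolding gromov_hyperbolic_graph_def by blast
  have "hyperbolic_cayley_graph G S \<delta>"
    by unfold_locales (use \<delta> in fast)
  then show ?thesis by (rule that)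
qed

section \<open>Commutative subgroups of hyperbolic groups\<close>

lemma torsion_freeD:
  fixes G (structure)
  assumes "torsion_free G" "group G" "x \<in> carrier G" "x [^] (k::int) = \<one>" "k \<noteq> 0"
  shows "x = \<one>"
proof -
  interpret group G by fact
  obtain n :: nat where n: "k = int n \<or> k = - int n" by (metis int_cases2)
  then have "x [^] n = \<one>"
    using assms(3,4) by (auto simp: int_pow_int int_pow_neg)
  then show ?thesis using bspec[OF assms(1)[unfolded torsion_free_def] assms(3)] assms(5) n by auto
qed

lemma int_pow_cancel:
  fixes G (structure)
  assumes "torsion_free G" "group G" "x \<in> carrier G" "x \<noteq> \<one>" "x [^] (k::int) = x [^] l"
  shows "k = l"
proof -
  interpret group G by fact
  have "x [^] (k - l) = \<one>" using assms(3,5) by (simp add: int_pow_diff)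
  then have "k - l = 0" using torsion_freeD[OF assms(1-3)] assms(4) by blast
  then show ?thesis by simp
qed

lemma hyperbolic_commensurable:
  fixes G (structure)
  assumes "group G" "torsion_free G" "word_hyperbolic G" "a \<in> carrier G" "a \<noteq> \<one>"
  shows "\<exists>M::nat. \<forall>x\<in>carrier G. a \<otimes> x = x \<otimes> a \<longrightarrow>
    (\<exists>k\<in>{1..M}. \<exists>n::int. x [^] k = a [^] n)"
proof -
  obtain S \<delta> where "hyperbolic_cayley_graph G S \<delta>"
    using word_hyperbolic_cayley_graph assms(1,3) by blast
  then interpret hyperbolic_cayley_graph G S \<delta> .
  show ?thesis
    by (rule power_of_centralizing_element[OF assms(4)])
      (use assms(2,4,5) in \<open>auto simp: torsion_free_def\<close>)
qed

lemma hyperbolic_countable: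
  fixes G (structure)
  assumes "group G" "word_hyperbolic G"
  shows "countable (carrier G)"
proof -
  obtain S \<delta> where "hyperbolic_cayley_graph G S \<delta>"
    using word_hyperbolic_cayley_graph assms by blast
  then interpret hyperbolic_cayley_graph G S \<delta> .
  show ?thesis by (rule countable_carrier)
qed

text \<open>
  With \<open>a \<noteq> 1\<close> in \<open>A\<close>, some power \<open>P\<close> moves all of \<open>A\<close> into the infinite cyclic group generated by \<open>a\<close>.
  Since there is no torsion, the exponent \<open>\<nu> x\<close> in \<open>x ^ P = a ^ \<nu> x\<close> embeds \<open>A\<close> into the integers.
\<close>

lemma hyperbolic_commutative_subgroup_cyclic:
  fixes G (structure)
  assumes G: "group G" "torsion_free G" "word_hyperbolic G"
    and A: "subgroup A G" and comm: "\<And>x y. x \<in> A \<Longrightarrow> y \<in> A \<Longrightarrow> x \<otimes> y = y \<otimes> x"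
  shows "\<exists>c\<in>A. \<forall>x\<in>A. \<exists>k::int. x = c [^] k"
proof (cases "A = {\<one>}")
  case True
  interpret group G by fact
  show ?thesis using True by (auto intro!: exI[of _ "0::int"])
next
  case False
  interpret group G by fact
  interpret A: subgroup A G by fact
  obtain a where a: "a \<in> A" "a \<noteq> \<one>" using False A.one_closed by blast
  obtain M :: nat where M: "\<forall>x\<in>carrier G. a \<otimes> x = x \<otimes> a \<longrightarrow>
      (\<exists>k\<in>{1..M}. \<exists>n::int. x [^] k = a [^] n)"
    using hyperbolic_commensurable[OF G, of a] a by auto
  define P :: int where "P = fact M"
  have P: "P \<noteq> 0" by (simp add: P_def)
  have "\<exists>n::int. x [^] P = a [^] n" if xA: "x \<in> A" for x
  proof -
    obtain k n where k: "k \<in> {1..M}" "x [^] k = a [^] (n::int)"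
      using bspec[OF M A.mem_carrier[OF xA]] comm[OF a(1) xA] by blast
    have "int k dvd P" unfolding P_def using k(1) dvd_fact[of k M]
      by (metis atLeastAtMost_iff of_nat_dvd_iff of_nat_fact)
    then obtain q where q: "P = int k * q" by blast
    have "x [^] P = (x [^] int k) [^] q"
      using xA by (simp add: q int_pow_pow)
    also have "\<dots> = a [^] (n * q)" using k(2) a by (simp add: int_pow_int int_pow_pow)
    finally show ?thesis by blast
  qed
  then obtain \<nu> where \<nu>: "\<And>x. x \<in> A \<Longrightarrow> x [^] P = a [^] (\<nu> x :: int)" by metis
  have \<nu>_eq: "\<nu> x = n" if "x \<in> A" "x [^] P = a [^] n" for x n
    using int_pow_cancel[OF G(2,1), of a "\<nu> x" n] a \<nu>[OF that(1)] that(2) by simp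
  have \<nu>_mult: "\<nu> (x \<otimes> y) = \<nu> x + \<nu> y" if "x \<in> A" "y \<in> A" for x y
  proof (rule \<nu>_eq)
    have "(x \<otimes> y) [^] P = x [^] P \<otimes> y [^] P"
      using that comm[OF that] by (intro int_pow_mult_distrib) auto
    then show "(x \<otimes> y) [^] P = a [^] (\<nu> x + \<nu> y)"
      using \<nu>[OF that(1)] \<nu>[OF that(2)] a by (simp add: int_pow_mult)
  qed (use that in auto)
  have \<nu>_pow: "x [^] k \<in> A \<and> \<nu> (x [^] k) = k * \<nu> x" if "x \<in> A" for x and k :: int
  proof -
    have A1: "x [^] k \<in> A" using that A subgroup_int_pow_closed by blast
    have "(x [^] k) [^] P = (x [^] P) [^] k"
      using that by (simp add: int_pow_pow mult.commute)
    also have "\<dots> = a [^] (k * \<nu> x)" using \<nu>[OF that] a by (simp add: int_pow_pow mult.commute)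
    finally show ?thesis using \<nu>_eq[OF A1] A1 by simp
  qed
  have \<nu>_0: "x = \<one>" if "x \<in> A" "\<nu> x = 0" for x
    using torsion_freeD[OF G(2,1), of x P] that P \<nu>[of x] by simp
  have "\<nu> a \<noteq> 0" using \<nu>_0 a by blast
  then have ex: "\<exists>n>0. \<exists>c\<in>A. nat \<bar>\<nu> c\<bar> = n" using a
    by (intro exI[of _ "nat \<bar>\<nu> a\<bar>"] conjI bexI[of _ a]) auto
  define d where "d = (LEAST n. n > 0 \<and> (\<exists>c\<in>A. nat \<bar>\<nu> c\<bar> = n))"
  have "d > 0 \<and> (\<exists>c\<in>A. nat \<bar>\<nu> c\<bar> = d)"
    unfolding d_def by (rule LeastI_ex) (use ex in blast)
  then obtain c where c: "c \<in> A" "nat \<bar>\<nu> c\<bar> = d" and d: "d > 0" by blast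
  have least: "nat \<bar>\<nu> y\<bar> \<ge> d" if "y \<in> A" "\<nu> y \<noteq> 0" for y
    unfolding d_def by (rule Least_le) (use that in auto)
  have "x = c [^] (\<nu> x div \<nu> c)" if x: "x \<in> A" for x
  proof -
    define q where "q = \<nu> x div \<nu> c"
    define y where "y = x \<otimes> c [^] (- q)"
    have y: "y \<in> A" unfolding y_def using x \<nu>_pow[OF c(1)] by blast
    have "\<nu> y = \<nu> x - q * \<nu> c" unfolding y_def using \<nu>_mult[OF x] \<nu>_pow[OF c(1), of "- q"] by simp
    also have "\<dots> = \<nu> x mod \<nu> c" unfolding q_def by (simp add: minus_div_mult_eq_mod)
    finally have "\<nu> y = \<nu> x mod \<nu> c" .
    then have "\<bar>\<nu> y\<bar> < \<bar>\<nu> c\<bar>" using abs_mod_less[of "\<nu> c" "\<nu> x"] c d by auto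
    then have "\<nu> y = 0" using least[OF y] c(2) d by linarith
    then have "y = \<one>" using \<nu>_0 y by blast
    then have "x \<otimes> inv (c [^] q) = \<one>" unfolding y_def using c x by (simp add: int_pow_neg)
    then show ?thesis unfolding q_def[symmetric] using x c
      by (metis A.mem_carrier int_pow_closed inv_solve_right' l_one one_closed)
  qed
  then show ?thesis using c(1) by blast
qed

text \<open>
  If \<open>c\<close> is trivial, then exponents are not unique and have to be chosen additive, here as zero.
\<close>

lemma cyclic_coordinates:
  fixes G (structure)
  assumes "group G" "torsion_free G" "c \<in> carrier G" "\<And>x. x \<in> A \<Longrightarrow> \<exists>k::int. x = c [^] k"
  shows "\<exists>N. \<forall>x\<in>A. x = c [^] (N x :: int) \<and> (\<forall>y\<in>A. x \<otimes> y \<in> A \<longrightarrow> N (x \<otimes> y) = N x + N y)"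
proof (cases "c = \<one>")
  case True
  interpret group G by fact
  show ?thesis using assms(4) True by (intro exI[of _ "\<lambda>_. 0"]) auto
next
  case False
  interpret group G by fact
  obtain N where N: "\<And>x. x \<in> A \<Longrightarrow> x = c [^] (N x :: int)" using assms(4) by metis
  have add: "N (x \<otimes> y) = N x + N y" if "x \<in> A" "y \<in> A" "x \<otimes> y \<in> A" for x y
  proof (rule int_pow_cancel[OF assms(2,1,3) False])
    show "c [^] N (x \<otimes> y) = c [^] (N x + N y)"
      using N[OF that(1)] N[OF that(2)] N[OF that(3)] assms(3) by (simp add: int_pow_mult)
  qed
  show ?thesis
  proof (intro exI[of _ N] ballI conjI impI)
    show "x = c [^] N x" if "x \<in> A" for x by (rule N[OF that])
  qed (rule add)
qed

text \<open>
  Let \<open>g\<close> be an element outside \<open>K\<close>. Its square is a nontrivial power \<open>c ^ k\<close>, which \<open>g\<close> centralises. As \<open>g\<close>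
  conjugates \<open>c\<close> to some \<open>c ^ e\<close>, this gives \<open>e k = k\<close>, so \<open>e = 1\<close>: torsion-freeness excludes infinite dihedral
  groups.
\<close>

lemma commutative_if_index_two_cyclic:
  fixes G (structure)
  assumes G: "group G" "torsion_free G" and H: "subgroup H G" and K: "subgroup K G" "K \<subseteq> H"
    and index: "\<And>x y. x \<in> H \<Longrightarrow> y \<in> H \<Longrightarrow> x \<notin> K \<Longrightarrow> y \<notin> K \<Longrightarrow> x \<otimes> y \<in> K"
    and c: "c \<in> K" "\<And>x. x \<in> K \<Longrightarrow> \<exists>k::int. x = c [^] k"
    and xy: "x \<in> H" "y \<in> H"
  shows "x \<otimes> y = y \<otimes> x"
proof -
  interpret group G by fact
  interpret H: subgroup H G by fact
  interpret K: subgroup K G by fact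
  have inK: "x \<otimes> y = y \<otimes> x" if xyK: "x \<in> K" "y \<in> K" for x y
  proof -
    obtain i j :: int where "x = c [^] i" "y = c [^] j"
      using c(2)[OF xyK(1)] c(2)[OF xyK(2)] by blast
    then show ?thesis using c(1) by (simp add: int_pow_mult[symmetric] add.commute)
  qed
  have out: "g \<otimes> x = x \<otimes> g" if g: "g \<in> H" "g \<notin> K" and x: "x \<in> K" for g x
  proof -
    have gc: "g \<in> carrier G" and cc: "c \<in> carrier G" using g c by auto
    obtain k :: int where k: "g \<otimes> g = c [^] k" using c(2)[OF index[OF g(1) g(1) g(2) g(2)]] by blast
    have gg: "g \<otimes> g \<noteq> \<one>"
    proof
      assume "g \<otimes> g = \<one>"
      then have "g [^] (2::int) = \<one>" using gc int_pow_mult[of g 1 1] by simp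
      then show False using torsion_freeD[OF G(2,1) gc, of 2] g(2) K.one_closed by simp
    qed
    have k0: "k \<noteq> 0" using gg unfolding k by (cases "k = 0") simp_all
    have c1: "c \<noteq> \<one>" using gg unfolding k by (cases "c = \<one>") simp_all
    have "inv g \<notin> K" using g(2) K.m_inv_closed[of "inv g"] inv_inv[OF gc] by auto
    moreover have "g \<otimes> c \<notin> K"
    proof
      assume "g \<otimes> c \<in> K"
      then have "g \<otimes> c \<otimes> inv c \<in> K" using c(1) by blast
      then show False using g(2) gc cc by (simp add: m_assoc)
    qed
    ultimately have "g \<otimes> c \<otimes> inv g \<in> K"
      using index[of "g \<otimes> c" "inv g"] H.m_closed[OF g(1) subsetD[OF K(2) c(1)]] H.m_inv_closed[OF g(1)] by simp
    then obtain e :: int where e: "g \<otimes> c \<otimes> inv g = c [^] e" using c(2) by meson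
    have conj_nat: "(g \<otimes> z \<otimes> inv g) [^] n = g \<otimes> z [^] n \<otimes> inv g"
      if z: "z \<in> carrier G" for z and n :: nat
    proof (induction n)
      case (Suc n)
      have "inv g \<otimes> (g \<otimes> w) = w" if "w \<in> carrier G" for w
        using gc that by (simp add: m_assoc[symmetric])
      then show ?case using Suc gc z by (simp add: m_assoc)
    qed (use gc in simp)
    have conj: "(g \<otimes> c \<otimes> inv g) [^] i = g \<otimes> c [^] i \<otimes> inv g" for i :: int
    proof -
      obtain n :: nat where n: "i = int n \<or> i = - int n" by (metis int_cases2)
      then show ?thesis
      proof
        assume "i = int n"
        then show ?thesis using conj_nat[OF cc, of n] by (simp add: int_pow_int)
      next
        assume i: "i = - int n"
        have "(g \<otimes> c \<otimes> inv g) [^] i = inv (g \<otimes> c [^] n \<otimes> inv g)"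
          using conj_nat[OF cc, of n] gc cc by (simp add: i int_pow_neg int_pow_int)
        also have "\<dots> = g \<otimes> inv (c [^] n) \<otimes> inv g"
          using gc cc by (simp add: inv_mult_group m_assoc)
        finally show ?thesis using cc by (simp add: i int_pow_neg int_pow_int)
      qed
    qed
    have "c [^] (e * k) = (c [^] e) [^] k" using cc by (simp add: int_pow_pow)
    also have "\<dots> = g \<otimes> (g \<otimes> g) \<otimes> inv g" using conj[of k] unfolding e k .
    also have "\<dots> = c [^] k" using gc unfolding k[symmetric] by (simp add: m_assoc)
    finally have "e * k = k" using int_pow_cancel[OF G(2,1) cc c1] by blast
    then have "e = 1" using k0 by simp
    obtain i :: int where i: "x = c [^] i" using c(2)[OF x] by blast
    have "g \<otimes> x \<otimes> inv g = x" using conj[of i] e \<open>e = 1\<close> cc i by simp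
    then have "(g \<otimes> x \<otimes> inv g) \<otimes> g = x \<otimes> g" by simp
    moreover have "x \<in> carrier G" using i cc by simp
    ultimately show ?thesis using gc by (simp add: m_assoc)
  qed
  show ?thesis
  proof (cases "x \<in> K")
    case True
    then show ?thesis using inK[OF True] out[OF xy(2) _ True] by (cases "y \<in> K") simp_all
  next
    case x: False
    show ?thesis
    proof (cases "y \<in> K")
      case True
      then show ?thesis by (rule out[OF xy(1) x])
    next
      case False
      then have "inv x \<otimes> y \<in> K"
        using index[of "inv x" y] x xy K.m_inv_closed[of "inv x"] inv_inv[OF H.mem_carrier[OF xy(1)]] by auto
      from out[OF xy(1) x this] have "y = inv x \<otimes> y \<otimes> x" using xy
        by (simp add: m_assoc[symmetric])
      then have "x \<otimes> y = x \<otimes> (inv x \<otimes> y \<otimes> x)" by simp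
      then show ?thesis using xy by (simp add: m_assoc[symmetric])
    qed
  qed
qed

section \<open>Formal real linear combinations\<close>

definition smul :: "real \<Rightarrow> ('a \<Rightarrow>\<^sub>0 real) \<Rightarrow> ('a \<Rightarrow>\<^sub>0 real)"
  where "smul r p = Poly_Mapping.map ((*) r) p"

definition lin :: "('a \<Rightarrow> ('b \<Rightarrow>\<^sub>0 real)) \<Rightarrow> ('a \<Rightarrow>\<^sub>0 real) \<Rightarrow> ('b \<Rightarrow>\<^sub>0 real)"
  where "lin f p = (\<Sum>a\<in>Poly_Mapping.keys p. smul (Poly_Mapping.lookup p a) (f a))"

abbreviation gen :: "'a \<Rightarrow> ('a \<Rightarrow>\<^sub>0 real)"
  where "gen a \<equiv> Poly_Mapping.single a 1"

lemma lookup_smul [simp]: "Poly_Mapping.lookup (smul r p) a = r * Poly_Mapping.lookup p a"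
  by (simp add: smul_def Poly_Mapping.map.rep_eq when_def)

lemma smul_0 [simp]: "smul r 0 = 0" "smul 0 p = 0"
  by (auto intro!: poly_mapping_eqI)

lemma smul_1 [simp]: "smul 1 p = p"
  by (auto intro!: poly_mapping_eqI)

lemma smul_smul [simp]: "smul r (smul s p) = smul (r * s) p"
  by (auto intro!: poly_mapping_eqI)

lemma lookup_sum_poly: "Poly_Mapping.lookup (sum f A) b = (\<Sum>a\<in>A. Poly_Mapping.lookup (f a) b)"
  by (induction A rule: infinite_finite_induct) (auto simp: lookup_add)

lemma lookup_lin:
  assumes "finite S" "Poly_Mapping.keys p \<subseteq> S"
  shows "Poly_Mapping.lookup (lin f p) b = (\<Sum>a\<in>S. Poly_Mapping.lookup p a * Poly_Mapping.lookup (f a) b)"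
  unfolding lin_def lookup_sum_poly lookup_smul
  by (rule sum.mono_neutral_left) (use assms in \<open>auto simp: in_keys_iff\<close>)

lemma lin_add [simp]: "lin f (p + q) = lin f p + lin f q"
proof (rule poly_mapping_eqI)
  fix b
  let ?S = "Poly_Mapping.keys p \<union> Poly_Mapping.keys q"
  have "Poly_Mapping.keys (p + q) \<subseteq> ?S" by (rule Poly_Mapping.keys_add)
  then show "Poly_Mapping.lookup (lin f (p + q)) b = Poly_Mapping.lookup (lin f p + lin f q) b"
    by (simp add: lookup_lin[where S = ?S] lookup_add sum.distrib[symmetric] algebra_simps)
qed

lemma lin_smul [simp]: "lin f (smul r p) = smul r (lin f p)"
proof (rule poly_mapping_eqI)
  fix b
  have "Poly_Mapping.keys (smul r p) \<subseteq> Poly_Mapping.keys p" by (auto simp: in_keys_iff)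
  then show "Poly_Mapping.lookup (lin f (smul r p)) b = Poly_Mapping.lookup (smul r (lin f p)) b"
    by (simp add: lookup_lin[where S = "Poly_Mapping.keys p"] sum_distrib_left mult.assoc)
qed

lemma smul_minus_1: "smul (-1) p = - p"
  by (auto intro!: poly_mapping_eqI)

lemma lin_0 [simp]: "lin f 0 = 0"
  by (simp add: lin_def)

lemma lin_minus [simp]: "lin f (- p) = - lin f p"
  by (simp add: smul_minus_1[symmetric])

lemma lin_diff [simp]: "lin f (p - q) = lin f p - lin f q"
  using lin_add[of f p "- q"] by simp

lemma lin_sum: "lin f (sum g A) = (\<Sum>a\<in>A. lin f (g a))"
  by (induction A rule: infinite_finite_induct) auto

lemma lin_gen [simp]: "lin f (gen a) = f a"
  by (simp add: lin_def)

lemma smul_add: "smul r (p + q) = smul r p + smul r q"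
  by (auto intro!: poly_mapping_eqI simp: lookup_add algebra_simps)

lemma smul_sum: "smul r (sum f A) = (\<Sum>a\<in>A. smul r (f a))"
  by (induction A rule: infinite_finite_induct) (auto simp: smul_add)

lemma smul_diff: "smul r (p - q) = smul r p - smul r q"
  by (auto intro!: poly_mapping_eqI simp: lookup_minus right_diff_distrib)

lemma lin_cong: "(\<And>a. a \<in> Poly_Mapping.keys p \<Longrightarrow> f a = g a) \<Longrightarrow> lin f p = lin g p"
  by (simp add: lin_def)

lemma lin_lin: "lin g (lin f p) = lin (\<lambda>a. lin g (f a)) p"
  by (simp add: lin_def[of f] lin_sum) (simp add: lin_def[of "\<lambda>a. lin g (f a)"])

lemma lin_gen_id [simp]: "lin gen p = p"
  by (rule poly_mapping_eqI)
    (simp add: lookup_lin[OF _ order_refl] lookup_single when_def in_keys_iff if_distrib cong: if_cong)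

lemma lin_fun_diff: "lin (\<lambda>a. f a - g a) p = lin f p - lin g p"
  by (simp add: lin_def smul_diff sum_subtractf)

lemma keys_lin: "Poly_Mapping.keys (lin f p) \<subseteq> (\<Union>a\<in>Poly_Mapping.keys p. Poly_Mapping.keys (f a))"
proof
  fix b assume "b \<in> Poly_Mapping.keys (lin f p)"
  then have "(\<Sum>a\<in>Poly_Mapping.keys p. Poly_Mapping.lookup p a * Poly_Mapping.lookup (f a) b) \<noteq> 0"
    using lookup_lin[of "Poly_Mapping.keys p" p f b] by (simp add: in_keys_iff)
  then obtain a where "a \<in> Poly_Mapping.keys p" "Poly_Mapping.lookup p a * Poly_Mapping.lookup (f a) b \<noteq> 0"
    by (meson sum.neutral)
  then show "b \<in> (\<Union>a\<in>Poly_Mapping.keys p. Poly_Mapping.keys (f a))" by (auto simp: in_keys_iff)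
qed

lemma keys_lin_subset:
  assumes "Poly_Mapping.keys p \<subseteq> A" "\<And>a. a \<in> A \<Longrightarrow> Poly_Mapping.keys (f a) \<subseteq> B"
  shows "Poly_Mapping.keys (lin f p) \<subseteq> B"
  using keys_lin[of f p] assms by fastforce

lemma keys_diff_subset:
  assumes "Poly_Mapping.keys p \<subseteq> A" "Poly_Mapping.keys q \<subseteq> A"
  shows "Poly_Mapping.keys (p - q :: _ \<Rightarrow>\<^sub>0 real) \<subseteq> A"
  using assms keys_diff[of p q] by blast

section \<open>Simplices\<close>

definition cone_over :: "'a \<Rightarrow> ('a list \<Rightarrow>\<^sub>0 real) \<Rightarrow> ('a list \<Rightarrow>\<^sub>0 real)"
  where "cone_over h = lin (\<lambda>\<sigma>. gen (h # \<sigma>))"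

text \<open>
  The recursion says that the boundary of a cone is its base minus the cone over the boundary of the
  base. Applied to the empty simplex, this makes \<open>[h]\<close> a simplex with boundary \<open>[]\<close>, so the chain complex is
  augmented and the formula holds in all degrees.
\<close>

primrec simplex_boundary :: "'a list \<Rightarrow> ('a list \<Rightarrow>\<^sub>0 real)" where
  "simplex_boundary [] = 0"
| "simplex_boundary (h # \<sigma>) = gen \<sigma> - cone_over h (simplex_boundary \<sigma>)"

abbreviation simplices :: "'a set \<Rightarrow> nat \<Rightarrow> 'a list set"
  where "simplices V n \<equiv> {\<sigma>. length \<sigma> = n \<and> set \<sigma> \<subseteq> V}"

lemma cone_simps [simp]:
  "cone_over h (gen \<sigma>) = gen (h # \<sigma>)" "cone_over h (p + q) = cone_over h p + cone_over h q"
  "cone_over h (p - q) = cone_over h p - cone_over h q" "cone_over h 0 = 0"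
  by (simp_all add: cone_over_def)

lemma boundary_cone: "lin simplex_boundary (cone_over h p) = p - cone_over h (lin simplex_boundary p)"
  by (simp add: cone_over_def lin_lin lin_fun_diff)

lemma boundary_boundary: "lin simplex_boundary (simplex_boundary \<sigma>) = 0"
  by (induction \<sigma>) (simp_all add: boundary_cone)

lemma keys_cone: "Poly_Mapping.keys p \<subseteq> simplices V n \<Longrightarrow> h \<in> V \<Longrightarrow> Poly_Mapping.keys (cone_over h p) \<subseteq> simplices V (Suc n)"
  unfolding cone_over_def by (rule keys_lin_subset) auto

lemma keys_simplex_boundary:
  "\<sigma> \<in> simplices V (Suc n) \<Longrightarrow> Poly_Mapping.keys (simplex_boundary \<sigma>) \<subseteq> simplices V n"
proof (induction \<sigma> arbitrary: n)
  case (Cons h \<sigma>)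
  have "Poly_Mapping.keys (cone_over h (simplex_boundary \<sigma>)) \<subseteq> simplices V n"
  proof (cases n)
    case 0
    then show ?thesis using Cons.prems by simp
  next
    case (Suc m)
    then show ?thesis using Cons keys_cone[of "simplex_boundary \<sigma>" m V h] by auto
  qed
  then show ?case using Cons.prems by (simp del: keys_single) (rule keys_diff_subset, auto)
qed simp

lemma simplex_boundary_alternating:
  "simplex_boundary \<sigma> = (\<Sum>i<length \<sigma>. smul ((-1) ^ i) (gen (take i \<sigma> @ drop (Suc i) \<sigma>)))"
proof (induction \<sigma>)
  case (Cons h \<sigma>)
  have "cone_over h (simplex_boundary \<sigma>) = (\<Sum>i<length \<sigma>. smul ((-1) ^ i) (gen (h # take i \<sigma> @ drop (Suc i) \<sigma>)))"
    by (simp add: Cons.IH cone_over_def lin_sum)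
  moreover have "- smul ((-1) ^ i) p = smul ((-1) ^ Suc i) p" for i and p :: "'a list \<Rightarrow>\<^sub>0 real"
    by (auto intro!: poly_mapping_eqI)
  ultimately show ?case
    by (simp add: sum.lessThan_Suc_shift sum_negf[symmetric] del: sum.lessThan_Suc)
qed simp

section \<open>A homotopy to a chain map\<close>

text \<open>
  A chain map \<open>r\<close> of the augmented complex of all simplices that is the identity in the lowest degree is
  homotopic to the identity, because that complex is contracted by cones. The recursion uses the first
  vertex of each simplex as the vertex of the cone. This involves no choice, so the homotopy inherits
  all symmetries of \<open>r\<close> (\<open>cone_homotopy_equivariant\<close>).
\<close>

primrec cone_homotopy :: "('a list \<Rightarrow> ('a list \<Rightarrow>\<^sub>0 real)) \<Rightarrow> nat \<Rightarrow> 'a list \<Rightarrow> ('a list \<Rightarrow>\<^sub>0 real)" where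
  "cone_homotopy r 0 = (\<lambda>\<sigma>. 0)"
| "cone_homotopy r (Suc n) = (\<lambda>\<sigma>. cone_over (hd \<sigma>)
     (gen \<sigma> - r \<sigma> - lin (cone_homotopy r n) (simplex_boundary \<sigma>)))"

lemma keys_cone_homotopy:
  assumes r: "\<And>n \<sigma>. \<sigma> \<in> simplices V n \<Longrightarrow> Poly_Mapping.keys (r \<sigma>) \<subseteq> simplices V n"
  shows "\<sigma> \<in> simplices V n \<Longrightarrow> Poly_Mapping.keys (cone_homotopy r n \<sigma>) \<subseteq> simplices V (Suc n)"
proof (induction n arbitrary: \<sigma>)
  case (Suc n)
  have "Poly_Mapping.keys (lin (cone_homotopy r n) (simplex_boundary \<sigma>)) \<subseteq> simplices V (Suc n)"
    by (rule keys_lin_subset[OF keys_simplex_boundary[OF Suc.prems] Suc.IH])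
  then have "Poly_Mapping.keys (gen \<sigma> - r \<sigma> - lin (cone_homotopy r n) (simplex_boundary \<sigma>)) \<subseteq> simplices V (Suc n)"
    using r[OF Suc.prems] Suc.prems by (intro keys_diff_subset) auto
  moreover have "hd \<sigma> \<in> V" using Suc.prems by (cases \<sigma>) auto
  ultimately show ?case unfolding cone_homotopy.simps by (rule keys_cone)
qed simp

text \<open>
  By induction, the chain that is coned off is a cycle, so it is the boundary of its cone.
\<close>

lemma cone_homotopy:
  assumes r0: "r [] = gen []"
    and r: "\<And>n \<sigma>. \<sigma> \<in> simplices V n \<Longrightarrow> lin simplex_boundary (r \<sigma>) = lin r (simplex_boundary \<sigma>)"
    and \<sigma>: "\<sigma> \<in> simplices V (Suc n)"
  shows "lin simplex_boundary (cone_homotopy r (Suc n) \<sigma>) =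
    gen \<sigma> - r \<sigma> - lin (cone_homotopy r n) (simplex_boundary \<sigma>)"
proof -
  have cyc: "lin simplex_boundary (cone_homotopy r (Suc n) \<sigma>) =
      gen \<sigma> - r \<sigma> - lin (cone_homotopy r n) (simplex_boundary \<sigma>)"
    if "lin simplex_boundary (lin (cone_homotopy r n) (simplex_boundary \<sigma>)) =
        simplex_boundary \<sigma> - lin r (simplex_boundary \<sigma>)"
      "\<sigma> \<in> simplices V (Suc n)" for n \<sigma>
    using that(1) r[OF that(2)] by (simp add: boundary_cone)
  show ?thesis using \<sigma>
  proof (induction n arbitrary: \<sigma>)
    case 0
    then obtain h where h: "\<sigma> = [h]" "h \<in> V" by (cases \<sigma>) auto
    show ?case by (rule cyc[OF _ 0]) (simp add: h r0)
  next
    case (Suc n)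
    have "lin simplex_boundary (lin (cone_homotopy r (Suc n)) (simplex_boundary \<sigma>)) =
        lin (\<lambda>\<tau>. gen \<tau> - r \<tau> - lin (cone_homotopy r n) (simplex_boundary \<tau>)) (simplex_boundary \<sigma>)"
      unfolding lin_lin
      by (rule lin_cong, rule Suc.IH) (use keys_simplex_boundary[OF Suc.prems] in blast)
    also have "\<dots> = simplex_boundary \<sigma> - lin r (simplex_boundary \<sigma>)"
      by (simp add: lin_fun_diff lin_lin[symmetric] boundary_boundary)
    finally show ?case by (rule cyc[OF _ Suc.prems])
  qed
qed

definition push :: "('a \<Rightarrow> 'b) \<Rightarrow> ('a list \<Rightarrow>\<^sub>0 real) \<Rightarrow> ('b list \<Rightarrow>\<^sub>0 real)"
  where "push f = lin (\<lambda>\<sigma>. gen (map f \<sigma>))"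

lemma push_simps [simp]:
  "push f (gen \<sigma>) = gen (map f \<sigma>)" "push f (p + q) = push f p + push f q"
  "push f (p - q) = push f p - push f q" "push f 0 = 0"
  by (simp_all add: push_def)

lemma push_cone: "push f (cone_over h p) = cone_over (f h) (push f p)"
  by (simp add: push_def cone_over_def lin_lin)

lemma simplex_boundary_map: "simplex_boundary (map f \<sigma>) = push f (simplex_boundary \<sigma>)"
  by (induction \<sigma>) (simp_all add: push_cone)

lemma cone_homotopy_equivariant:
  assumes r: "\<And>n \<sigma>. \<sigma> \<in> simplices V n \<Longrightarrow> r' (map f \<sigma>) = push f (r \<sigma>)"
  shows "\<sigma> \<in> simplices V n \<Longrightarrow> cone_homotopy r' n (map f \<sigma>) = push f (cone_homotopy r n \<sigma>)"
proof (induction n arbitrary: \<sigma>)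
  case (Suc n)
  have "lin (cone_homotopy r' n) (push f (simplex_boundary \<sigma>)) =
      lin (\<lambda>\<tau>. push f (cone_homotopy r n \<tau>)) (simplex_boundary \<sigma>)"
    unfolding push_def lin_lin lin_gen
    by (rule lin_cong) (use Suc.IH keys_simplex_boundary[OF Suc.prems] in \<open>auto simp: push_def\<close>)
  also have "\<dots> = push f (lin (cone_homotopy r n) (simplex_boundary \<sigma>))"
    by (simp add: push_def lin_lin)
  finally show ?case
    using Suc.prems r[OF Suc.prems] by (cases \<sigma>) (simp_all add: push_cone simplex_boundary_map del: simplex_boundary.simps map_map list.map, simp_all)
qed simp

section \<open>Signed sums over integer intervals\<close>

text \<open>
  The sum over the steps of the walk from \<open>0\<close> to \<open>n\<close> along the integers, where backward steps count
  negatively. This convention makes it additive in \<open>n\<close> (\<open>zsum_add\<close>).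
\<close>

definition zsum :: "(int \<Rightarrow> 'b::ab_group_add) \<Rightarrow> int \<Rightarrow> 'b"
  where "zsum f n = sum f {0..<n} - sum f {n..<0}"

lemma zsum_0 [simp]: "zsum f 0 = 0"
  by (simp add: zsum_def)

lemma zsum_step: "zsum f (n + 1) = zsum f n + f n"
proof (cases "n \<ge> 0")
  case True
  then have "{0..<n + 1} = insert n {0..<n}" "{n + 1..<0} = {}" "{n..<0} = {}" by auto
  then show ?thesis by (simp add: zsum_def)
next
  case False
  then have "{n..<0} = insert n {n + 1..<0}" "{0..<n + 1} = {}" "{0..<n} = {}" by auto
  then show ?thesis by (simp add: zsum_def)
qed

lemma zsum_step': "zsum f (n - 1) = zsum f n - f (n - 1)"
  using zsum_step[of f "n - 1"] by simp

lemma zsum_add: "zsum f (m + n) = zsum f m + zsum (\<lambda>i. f (m + i)) n"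
proof (induction n rule: int_induct[where k = 0])
  case base
  show ?case by simp
next
  case (step1 i)
  then show ?case using zsum_step[of f "m + i"] by (simp add: zsum_step add.assoc)
next
  case (step2 i)
  then show ?case using zsum_step'[of f "m + i"] by (simp add: zsum_step' add_diff_eq)
qed

lemma zsum_telescope: "zsum (\<lambda>i. F (i + 1) - F i) n = F n - F 0"
proof (induction n rule: int_induct[where k = 0])
  case (step1 i)
  then show ?case by (simp add: zsum_step)
next
  case (step2 i)
  then show ?case by (simp add: zsum_step')
qed simp

lemma lin_zsum: "lin f (zsum g n) = zsum (\<lambda>i. lin f (g i)) n"
  by (simp add: zsum_def lin_sum)

lemma keys_zsum:
  assumes "\<And>i. Poly_Mapping.keys (f i) \<subseteq> A"
  shows "Poly_Mapping.keys (zsum f n :: _ \<Rightarrow>\<^sub>0 real) \<subseteq> A"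
proof (induction n rule: int_induct[where k = 0])
  case (step1 i)
  then show ?case using assms[of i] keys_add[of "zsum f i" "f i"] unfolding zsum_step by blast
next
  case (step2 i)
  then show ?case using assms[of "i - 1"] unfolding zsum_step' by (intro keys_diff_subset)
qed simp

section \<open>Monomial actions\<close>

locale monomial_action = group G for G :: "('g, 'b) monoid_scheme" (structure) +
  fixes Y :: "'y set" and act :: "'g \<Rightarrow> 'y \<Rightarrow> 'y" and \<mu> :: "'g \<Rightarrow> real"
  assumes act_closed [simp]: "\<lbrakk>g \<in> carrier G; y \<in> Y\<rbrakk> \<Longrightarrow> act g y \<in> Y"
    and act_one [simp]: "y \<in> Y \<Longrightarrow> act \<one> y = y"
    and act_mult: "\<lbrakk>g \<in> carrier G; h \<in> carrier G; y \<in> Y\<rbrakk> \<Longrightarrow> act (g \<otimes> h) y = act g (act h y)"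
    and \<mu>_one [simp]: "\<mu> \<one> = 1"
    and \<mu>_mult: "\<lbrakk>g \<in> carrier G; h \<in> carrier G\<rbrakk> \<Longrightarrow> \<mu> (g \<otimes> h) = \<mu> g * \<mu> h"
begin

definition stab :: "'y \<Rightarrow> 'g set" where "stab y = {g \<in> carrier G. act g y = y}"

lemma act_inv [simp]: "\<lbrakk>g \<in> carrier G; y \<in> Y\<rbrakk> \<Longrightarrow> act (inv g) (act g y) = y"
    "\<lbrakk>g \<in> carrier G; y \<in> Y\<rbrakk> \<Longrightarrow> act g (act (inv g) y) = y"
  by (simp_all add: act_mult[symmetric])

lemma \<mu>_inv: "g \<in> carrier G \<Longrightarrow> \<mu> (inv g) * \<mu> g = 1"
  by (simp add: \<mu>_mult[symmetric])

text \<open>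
  A pair of a simplex \<open>\<sigma>\<close> with vertices in \<open>G\<close> and a point \<open>y\<close> of \<open>Y\<close> is a generator of the homogeneous
  bar resolution with coefficients in the free vector space on \<open>Y\<close>, on which \<open>g\<close> maps the basis vector
  of \<open>y\<close> to \<open>\<mu> g\<close> times that of \<open>act g y\<close>. The projection \<open>coinv\<close> to the coinvariants moves the first vertex to \<open>1\<close>
  and records the steps between successive vertices; it is split by \<open>vertices \<one>\<close>. The boundary operator of
  the inhomogeneous complex is \<open>face_sum\<close>.
\<close>

fun steps :: "'g list \<Rightarrow> 'g list" where
  "steps (h # h' # \<sigma>) = (inv h \<otimes> h') # steps (h' # \<sigma>)"
| "steps \<sigma> = []"

primrec vertices :: "'g \<Rightarrow> 'g list \<Rightarrow> 'g list" where
  "vertices h [] = [h]"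
| "vertices h (w # ws) = h # vertices (h \<otimes> w) ws"

definition coinv :: "'y \<Rightarrow> 'g list \<Rightarrow> ('g list \<times> 'y \<Rightarrow>\<^sub>0 real)"
  where "coinv y \<sigma> = smul (\<mu> (inv (hd \<sigma>))) (gen (steps \<sigma>, act (inv (hd \<sigma>)) y))"

definition face_sum :: "'g list \<times> 'y \<Rightarrow> ('g list \<times> 'y \<Rightarrow>\<^sub>0 real)"
  where "face_sum = (\<lambda>(ws, y). \<Sum>k\<le>length ws. smul ((-1) ^ k)
     (if k = 0 then smul (\<mu> (inv (hd ws))) (gen (bar_face G 0 ws, act (inv (hd ws)) y))
      else gen (bar_face G k ws, y)))"

lemma length_steps [simp]: "length (steps \<sigma>) = length \<sigma> - 1"
  by (induction \<sigma> rule: steps.induct) auto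

lemma set_steps: "set \<sigma> \<subseteq> carrier G \<Longrightarrow> set (steps \<sigma>) \<subseteq> carrier G"
  by (induction \<sigma> rule: steps.induct) auto

lemma length_vertices [simp]: "length (vertices h ws) = Suc (length ws)"
  by (induction ws arbitrary: h) auto

lemma hd_vertices [simp]: "hd (vertices h ws) = h" and vertices_not_Nil [simp]: "vertices h ws \<noteq> []"
  by (cases ws; simp)+

lemma set_vertices: "\<lbrakk>h \<in> carrier G; set ws \<subseteq> carrier G\<rbrakk> \<Longrightarrow> set (vertices h ws) \<subseteq> carrier G"
  by (induction ws arbitrary: h) auto

lemma steps_vertices: "\<lbrakk>h \<in> carrier G; set ws \<subseteq> carrier G\<rbrakk> \<Longrightarrow> steps (vertices h ws) = ws"
proof (induction ws arbitrary: h)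
  case (Cons w ws)
  obtain \<tau> where \<tau>: "vertices (h \<otimes> w) ws = (h \<otimes> w) # \<tau>" by (cases ws) auto
  show ?case using Cons.IH[of "h \<otimes> w"] Cons.prems by (simp add: \<tau> m_assoc[symmetric])
qed simp

lemma map_vertices: "\<lbrakk>g \<in> carrier G; h \<in> carrier G; set ws \<subseteq> carrier G\<rbrakk> \<Longrightarrow>
    map ((\<otimes>) g) (vertices h ws) = vertices (g \<otimes> h) ws"
  by (induction ws arbitrary: h) (simp_all add: m_assoc)

lemma vertices_steps: "\<lbrakk>\<sigma> \<noteq> []; set \<sigma> \<subseteq> carrier G\<rbrakk> \<Longrightarrow> vertices (hd \<sigma>) (steps \<sigma>) = \<sigma>"
  by (induction \<sigma> rule: steps.induct) (simp_all add: m_assoc[symmetric])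

lemma steps_map: "\<lbrakk>g \<in> carrier G; set \<sigma> \<subseteq> carrier G\<rbrakk> \<Longrightarrow> steps (map ((\<otimes>) g) \<sigma>) = steps \<sigma>"
  by (induction \<sigma> rule: steps.induct) (simp_all add: inv_mult_group m_assoc, simp add: m_assoc[symmetric])

lemma coinv_vertices: "\<lbrakk>y \<in> Y; set ws \<subseteq> carrier G\<rbrakk> \<Longrightarrow> coinv y (vertices \<one> ws) = gen (ws, y)"
  by (simp add: coinv_def steps_vertices)

lemma coinv_translate:
  assumes "g \<in> carrier G" "y \<in> Y" "\<sigma> \<noteq> []" "set \<sigma> \<subseteq> carrier G"
  shows "coinv (act g y) (map ((\<otimes>) g) \<sigma>) = smul (\<mu> (inv g)) (coinv y \<sigma>)"
proof -
  have h: "hd \<sigma> \<in> carrier G" using assms by auto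
  have "act (inv (g \<otimes> hd \<sigma>)) (act g y) = act (inv (hd \<sigma>)) y"
    using assms h by (simp add: inv_mult_group act_mult)
  moreover have "\<mu> (inv (g \<otimes> hd \<sigma>)) = \<mu> (inv g) * \<mu> (inv (hd \<sigma>))"
    using assms h by (simp add: inv_mult_group \<mu>_mult)
  ultimately show ?thesis
    using assms by (simp add: coinv_def hd_map steps_map)
qed

lemma bar_face_closed: "\<lbrakk>vs \<in> bar_tuples G (Suc n); k \<le> Suc n\<rbrakk> \<Longrightarrow> bar_face G k vs \<in> bar_tuples G n"
proof -
  assume vs: "vs \<in> bar_tuples G (Suc n)" and k: "k \<le> Suc n"
  have tl: "set (tl vs) \<subseteq> carrier G" using vs by (cases vs) (auto simp: bar_tuples_def)
  have bl: "set (butlast vs) \<subseteq> carrier G" using vs in_set_butlastD by (fastforce simp: bar_tuples_def)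
  have mid: "vs ! (k - 1) \<otimes> vs ! k \<in> carrier G" if "0 < k" "k < Suc n"
  proof (rule m_closed)
    show "vs ! (k - 1) \<in> carrier G" "vs ! k \<in> carrier G"
      using that vs nth_mem[of "k - 1" vs] nth_mem[of k vs] unfolding bar_tuples_def by auto
  qed
  show ?thesis using vs k tl bl mid set_take_subset[of "k - 1" vs] set_drop_subset[of "k + 1" vs]
    by (auto simp: bar_face_def bar_tuples_def min_def)
qed

lemma bar_face_Suc_Suc:
  "0 < k \<Longrightarrow> k \<le> length ws \<Longrightarrow> ws \<noteq> [] \<Longrightarrow> bar_face G (Suc k) (w # ws) = w # bar_face G k ws"
  by (cases k) (auto simp: bar_face_def)

lemma steps_delete:
  assumes "set \<sigma> \<subseteq> carrier G" "0 < i" "i < length \<sigma>"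
  shows "steps (take i \<sigma> @ drop (Suc i) \<sigma>) = bar_face G i (steps \<sigma>)"
  using assms
proof (induction \<sigma> arbitrary: i)
  case (Cons h \<sigma>)
  then obtain j where j: "i = Suc j" "j < length \<sigma>" by (cases i) auto
  then obtain h' \<sigma>' where \<sigma>: "\<sigma> = h' # \<sigma>'" by (cases \<sigma>) auto
  show ?case
  proof (cases "j = 0")
    case True
    show ?thesis
    proof (cases \<sigma>')
      case Nil
      then show ?thesis using j True by (simp add: \<sigma> bar_face_def)
    next
      case (Cons h'' \<tau>)
      have "inv h \<otimes> h' \<otimes> (inv h' \<otimes> h'') = inv h \<otimes> h''"
        using Cons.prems Cons \<sigma> by (simp add: m_assoc) (simp add: m_assoc[symmetric])
      then show ?thesis using j True Cons by (simp add: \<sigma> bar_face_def)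
    qed
  next
    case False
    then obtain k where k: "j = Suc k" "k < length \<sigma>'" using j \<sigma> by (cases j) auto
    have "steps (take j \<sigma> @ drop (Suc j) \<sigma>) = bar_face G j (steps \<sigma>)"
      using Cons False j by simp
    then have "steps (take i (h # \<sigma>) @ drop (Suc i) (h # \<sigma>)) = (inv h \<otimes> h') # bar_face G j (steps \<sigma>)"
      using j k \<sigma> by simp
    also have "\<dots> = bar_face G i (steps (h # \<sigma>))"
    proof -
      have "length (steps \<sigma>) = length \<sigma>'" by (simp add: \<sigma>)
      moreover from this have "steps \<sigma> \<noteq> []" using k by (metis list.size(3) not_less_zero)
      ultimately have "0 < j" "j \<le> length (steps \<sigma>)" "steps \<sigma> \<noteq> []" using j k by auto
      from bar_face_Suc_Suc[OF this] show ?thesis by (simp add: \<sigma> j)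
    qed
    finally show ?thesis .
  qed
qed simp

text \<open>
  Deleting the first vertex of a simplex changes the vertex that has to be moved to \<open>1\<close>. This is why
  the first face in the inhomogeneous complex, and only this one, acts on the coefficients.
\<close>

lemma face_sum_coinv:
  assumes "y \<in> Y" "\<sigma> \<in> simplices (carrier G) (Suc (Suc n))"
  shows "lin face_sum (coinv y \<sigma>) = lin (coinv y) (simplex_boundary \<sigma>)"
proof -
  obtain h h' \<tau> where \<sigma>: "\<sigma> = h # h' # \<tau>" using assms(2) by (auto simp: length_Suc_conv)
  have c: "h \<in> carrier G" "h' \<in> carrier G" "set \<sigma> \<subseteq> carrier G" using assms(2) \<sigma> by auto
  have len: "length \<sigma> = Suc (length (steps \<sigma>))" by (simp add: \<sigma>)
  have "lin face_sum (coinv y \<sigma>) = (\<Sum>k<length \<sigma>. smul (\<mu> (inv h)) (smul ((-1) ^ k)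
     (if k = 0 then smul (\<mu> (inv (inv h \<otimes> h'))) (gen (tl (steps \<sigma>), act (inv (inv h \<otimes> h')) (act (inv h) y)))
      else gen (bar_face G k (steps \<sigma>), act (inv h) y))))"
  proof -
    have hd: "hd \<sigma> = h" "hd (steps \<sigma>) = inv h \<otimes> h'" "bar_face G 0 (steps \<sigma>) = tl (steps \<sigma>)"
      by (simp_all add: \<sigma> bar_face_def)
    have "lin face_sum (coinv y \<sigma>) = smul (\<mu> (inv h)) (face_sum (steps \<sigma>, act (inv h) y))"
      by (simp add: coinv_def hd)
    then show ?thesis
      by (simp only: face_sum_def case_prod_conv len lessThan_Suc_atMost hd smul_sum)
  qed
  also have "\<dots> = (\<Sum>k<length \<sigma>. smul ((-1) ^ k) (coinv y (take k \<sigma> @ drop (Suc k) \<sigma>)))"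
  proof (rule sum.cong[OF refl])
    fix k assume k: "k \<in> {..<length \<sigma>}"
    show "smul (\<mu> (inv h)) (smul ((-1) ^ k)
     (if k = 0 then smul (\<mu> (inv (inv h \<otimes> h'))) (gen (tl (steps \<sigma>), act (inv (inv h \<otimes> h')) (act (inv h) y)))
      else gen (bar_face G k (steps \<sigma>), act (inv h) y))) = smul ((-1) ^ k) (coinv y (take k \<sigma> @ drop (Suc k) \<sigma>))"
    proof (cases "k = 0")
      case True
      have "inv (inv h \<otimes> h') \<otimes> inv h = inv h'" using c by (simp add: inv_mult_group m_assoc)
      then have "act (inv (inv h \<otimes> h')) (act (inv h) y) = act (inv h') y"
          "\<mu> (inv h) * \<mu> (inv (inv h \<otimes> h')) = \<mu> (inv h')"
        using c assms(1) by (metis act_mult inv_closed m_closed, metis \<mu>_mult inv_closed m_closed mult.commute)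
      then show ?thesis using True by (simp add: coinv_def \<sigma>)
    next
      case False
      then have "hd (take k \<sigma> @ drop (Suc k) \<sigma>) = h" using \<sigma> by (cases k) auto
      then show ?thesis using False k c(3) steps_delete[of \<sigma> k] by (simp add: coinv_def mult.commute)
    qed
  qed
  also have "\<dots> = lin (coinv y) (simplex_boundary \<sigma>)"
    by (simp add: simplex_boundary_alternating lin_sum)
  finally show ?thesis .
qed

end

section \<open>Cyclic stabilisers\<close>

text \<open>
  Over a point \<open>y\<close> there is a line: its vertices are the elements of \<open>G\<close> that move the base point of the
  orbit of \<open>y\<close> to \<open>y\<close>, and its edges join \<open>v\<close> and \<open>v c\<close>, where \<open>c\<close> generates the stabiliser of the base point.
  (If \<open>c = 1\<close>, it is a single vertex with a loop, which no path uses.) The elements of \<open>G\<close> permute these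
  lines, and a simplex in \<open>G\<close> can be pushed to the line over \<open>y\<close>. Since the line has dimension one, this
  kills all simplices with at least three vertices.
\<close>

locale cyclic_stabilizers = monomial_action +
  assumes cyclic: "y \<in> Y \<Longrightarrow> \<exists>c\<in>stab y. \<exists>N::'a \<Rightarrow> int. \<forall>h\<in>stab y. h = c [^] N h \<and>
      (\<forall>h'\<in>stab y. N (h \<otimes> h') = N h + N h')"
begin

definition root :: "'c \<Rightarrow> 'c" where "root y = (SOME y'. \<exists>g\<in>carrier G. y' = act g y)"
definition transport :: "'c \<Rightarrow> 'a" where "transport y = (SOME g. g \<in> carrier G \<and> act g (root y) = y)"

lemma root_act:
  assumes "g \<in> carrier G" "y \<in> Y"
  shows "root (act g y) = root y"
proof -
  have "(\<exists>h\<in>carrier G. y' = act h (act g y)) \<longleftrightarrow> (\<exists>h\<in>carrier G. y' = act h y)" for y'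
  proof
    assume "\<exists>h\<in>carrier G. y' = act h (act g y)"
    then show "\<exists>h\<in>carrier G. y' = act h y" using assms by (metis act_mult m_closed)
  next
    assume "\<exists>h\<in>carrier G. y' = act h y"
    then obtain h where h: "h \<in> carrier G" "y' = act h y" by blast
    then have "y' = act (h \<otimes> inv g) (act g y)" using assms by (simp add: act_mult)
    then show "\<exists>h\<in>carrier G. y' = act h (act g y)" using h assms by blast
  qed
  then show ?thesis by (simp add: root_def)
qed

lemma root: "y \<in> Y \<Longrightarrow> \<exists>g\<in>carrier G. root y = act g y"
  unfolding root_def by (rule someI_ex) (use act_one in blast)

lemma root_closed: "y \<in> Y \<Longrightarrow> root y \<in> Y"
  using root by force

lemma transport: "y \<in> Y \<Longrightarrow> transport y \<in> carrier G \<and> act (transport y) (root y) = y"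
proof -
  assume y: "y \<in> Y"
  obtain g where "g \<in> carrier G" "root y = act g y" using root y by blast
  then have "inv g \<in> carrier G \<and> act (inv g) (root y) = y" using y by simp
  then show ?thesis unfolding transport_def by (rule someI)
qed

text \<open>
  The map of vertices from \<open>G\<close> to the line over \<open>y\<close>. The correction on the right depends on \<open>g\<close> and \<open>y\<close> only
  through \<open>g\<^sup>-\<^sup>1 y\<close>, which makes the map equivariant (\<open>frame_translate\<close>).
\<close>

definition frame :: "'c \<Rightarrow> 'a \<Rightarrow> 'a" where "frame y g = g \<otimes> transport (act (inv g) y)"

lemma frame:
  assumes "g \<in> carrier G" "y \<in> Y"
  shows "frame y g \<in> carrier G" "act (frame y g) (root y) = y"
proof -
  have y: "act (inv g) y \<in> Y" using assms by simp
  have r: "root (act (inv g) y) = root y" using assms root_act by simp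
  note t = transport[OF y, unfolded r]
  show "frame y g \<in> carrier G" using t assms by (simp add: frame_def)
  show "act (frame y g) (root y) = y"
    using t assms root_closed by (simp add: frame_def act_mult)
qed

lemma frame_translate:
  assumes "g \<in> carrier G" "h \<in> carrier G" "y \<in> Y"
  shows "frame (act h y) (h \<otimes> g) = h \<otimes> frame y g"
proof -
  have "act (inv (h \<otimes> g)) (act h y) = act (inv g) y"
    using assms by (simp add: inv_mult_group act_mult)
  then show ?thesis using assms transport[of "act (inv g) y"] by (simp add: frame_def m_assoc)
qed

definition loop :: "'c \<Rightarrow> 'a" where
  "loop y = (SOME c. c \<in> stab y \<and> (\<exists>N::'a \<Rightarrow> int. \<forall>h\<in>stab y. h = c [^] N h \<and>
      (\<forall>h'\<in>stab y. N (h \<otimes> h') = N h + N h')))"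
definition winding :: "'c \<Rightarrow> 'a \<Rightarrow> int" where
  "winding y = (SOME N. \<forall>h\<in>stab y. h = loop y [^] N h \<and> (\<forall>h'\<in>stab y. N (h \<otimes> h') = N h + N h'))"

lemma loop_winding:
  assumes "y \<in> Y"
  shows "loop y \<in> carrier G" "h \<in> stab y \<Longrightarrow> loop y [^] winding y h = h"
    "h \<in> stab y \<Longrightarrow> h' \<in> stab y \<Longrightarrow> winding y (h \<otimes> h') = winding y h + winding y h'"
proof -
  have L: "loop y \<in> stab y \<and> (\<exists>N::'a \<Rightarrow> int. \<forall>h\<in>stab y. h = loop y [^] N h \<and>
      (\<forall>h'\<in>stab y. N (h \<otimes> h') = N h + N h'))"
    unfolding loop_def by (rule someI_ex) (use cyclic[OF assms] in blast)
  then show "loop y \<in> carrier G" by (simp add: stab_def)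
  have "\<forall>h\<in>stab y. h = loop y [^] winding y h \<and>
      (\<forall>h'\<in>stab y. winding y (h \<otimes> h') = winding y h + winding y h')"
    unfolding winding_def by (rule someI_ex[OF conjunct2[OF L]])
  then show "h \<in> stab y \<Longrightarrow> loop y [^] winding y h = h"
    "h \<in> stab y \<Longrightarrow> h' \<in> stab y \<Longrightarrow> winding y (h \<otimes> h') = winding y h + winding y h'" by auto
qed

definition edge_path :: "'c \<Rightarrow> 'a \<Rightarrow> 'a \<Rightarrow> ('a list \<Rightarrow>\<^sub>0 real)" where
  "edge_path y v v' = zsum (\<lambda>i. gen [v \<otimes> loop (root y) [^] i, v \<otimes> loop (root y) [^] (i + 1)])
     (winding (root y) (inv v \<otimes> v'))"

definition frames :: "'c \<Rightarrow> 'a set" where "frames y = {v \<in> carrier G. act v (root y) = y}"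

lemma frames_diff: "\<lbrakk>y \<in> Y; v \<in> frames y; v' \<in> frames y\<rbrakk> \<Longrightarrow> inv v \<otimes> v' \<in> stab (root y)"
proof -
  assume y: "y \<in> Y" and v: "v \<in> frames y" "v' \<in> frames y"
  have vr: "act v (root y) = y" using v by (simp add: frames_def)
  have "act (inv v) (act v (root y)) = root y"
    using v y root_closed by (intro act_inv(1)) (auto simp: frames_def)
  then have "act (inv v) y = root y" unfolding vr .
  then show ?thesis using v y root_closed by (simp add: frames_def stab_def act_mult)
qed

lemma boundary_edge_path:
  assumes "y \<in> Y" "v \<in> frames y" "v' \<in> frames y"
  shows "lin simplex_boundary (edge_path y v v') = gen [v'] - gen [v]"
proof -
  let ?c = "loop (root y)" and ?n = "winding (root y) (inv v \<otimes> v')"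
  have c: "?c [^] ?n = inv v \<otimes> v'"
    using loop_winding(2)[OF root_closed frames_diff] assms by blast
  have vc: "v \<in> carrier G" "v' \<in> carrier G" using assms by (auto simp: frames_def)
  have "lin simplex_boundary (edge_path y v v') =
      zsum (\<lambda>i. gen [v \<otimes> ?c [^] (i + 1)] - gen [v \<otimes> ?c [^] i]) ?n"
    by (simp add: edge_path_def lin_zsum)
  also have "\<dots> = gen [v \<otimes> ?c [^] ?n] - gen [v \<otimes> ?c [^] (0::int)]"
    by (rule zsum_telescope)
  finally show ?thesis using vc by (simp add: c m_assoc[symmetric])
qed

text \<open>
  The additivity of \<open>winding\<close> makes paths in the line over \<open>y\<close> compose, so the boundary of a triangle is
  pushed to a trivial chain.
\<close>

lemma edge_path_add:
  assumes "y \<in> Y" "u \<in> frames y" "v \<in> frames y" "w \<in> frames y"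
  shows "edge_path y u w = edge_path y u v + edge_path y v w"
proof -
  let ?c = "loop (root y)" and ?n = "winding (root y) (inv u \<otimes> v)"
  have c: "?c [^] ?n = inv u \<otimes> v" "?c \<in> carrier G"
    using loop_winding(1,2)[OF root_closed] frames_diff assms by blast+
  have vc: "u \<in> carrier G" "v \<in> carrier G" "w \<in> carrier G" using assms by (auto simp: frames_def)
  have uw: "inv u \<otimes> w = (inv u \<otimes> v) \<otimes> (inv v \<otimes> w)"
    using vc by (simp add: m_assoc) (simp add: m_assoc[symmetric])
  have wind: "winding (root y) (inv u \<otimes> w) = ?n + winding (root y) (inv v \<otimes> w)"
    unfolding uw using loop_winding(3)[OF root_closed] frames_diff assms by blast
  have shift: "v \<otimes> ?c [^] i = u \<otimes> ?c [^] (?n + i)" for i :: int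
    using vc c by (simp add: int_pow_mult m_assoc[symmetric])
  show ?thesis unfolding edge_path_def wind zsum_add by (simp add: shift add.assoc)
qed

lemma edge_path_translate:
  assumes "y \<in> Y" "v \<in> frames y" "v' \<in> frames y" "h \<in> carrier G"
  shows "edge_path (act h y) (h \<otimes> v) (h \<otimes> v') = push ((\<otimes>) h) (edge_path y v v')"
proof -
  have vc: "v \<in> carrier G" "v' \<in> carrier G" using assms by (auto simp: frames_def)
  have c: "loop (root y) \<in> carrier G" using loop_winding(1) root_closed assms by blast
  have "inv (h \<otimes> v) \<otimes> (h \<otimes> v') = inv v \<otimes> v'"
    using vc assms by (simp add: inv_mult_group m_assoc) (simp add: m_assoc[symmetric])
  then show ?thesis using assms vc c
    by (simp add: edge_path_def root_act push_def lin_zsum m_assoc)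
qed

fun straighten :: "'c \<Rightarrow> 'a list \<Rightarrow> ('a list \<Rightarrow>\<^sub>0 real)" where
  "straighten y [] = gen []"
| "straighten y [g] = gen [frame y g]"
| "straighten y [g, g'] = edge_path y (frame y g) (frame y g')"
| "straighten y _ = 0"

lemma straighten_long: "length \<sigma> \<ge> 3 \<Longrightarrow> straighten y \<sigma> = 0"
  by (cases "(y, \<sigma>)" rule: straighten.cases) auto

lemma frame_frames: "y \<in> Y \<Longrightarrow> g \<in> carrier G \<Longrightarrow> frame y g \<in> frames y"
  using frame by (simp add: frames_def)

lemma keys_straighten:
  assumes "y \<in> Y" "\<sigma> \<in> simplices (carrier G) n"
  shows "Poly_Mapping.keys (straighten y \<sigma>) \<subseteq> simplices (carrier G) n"
proof -
  have "Poly_Mapping.keys (edge_path y (frame y g) (frame y g')) \<subseteq> simplices (carrier G) 2"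
    if "g \<in> carrier G" "g' \<in> carrier G" for g g'
    unfolding edge_path_def using frame(1)[OF that(1) assms(1)] loop_winding(1)[OF root_closed[OF assms(1)]]
    by (intro keys_zsum) auto
  then show ?thesis using assms(2) frame(1)[OF _ assms(1)]
    by (cases "(y, \<sigma>)" rule: straighten.cases) (auto simp: numeral_2_eq_2)
qed

lemma straighten_chain_map:
  assumes "y \<in> Y" "\<sigma> \<in> simplices (carrier G) n"
  shows "lin simplex_boundary (straighten y \<sigma>) = lin (straighten y) (simplex_boundary \<sigma>)"
proof (cases "(y, \<sigma>)" rule: straighten.cases)
  case (3 y g g')
  then show ?thesis using assms frame_frames by (simp add: boundary_edge_path)
next
  case (4 y g0 g1 g2 \<tau>)
  show ?thesis
  proof (cases \<tau>)
    case Nil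
    have "edge_path y (frame y g0) (frame y g2) =
        edge_path y (frame y g0) (frame y g1) + edge_path y (frame y g1) (frame y g2)"
      using assms 4 by (intro edge_path_add frame_frames) auto
    then show ?thesis using 4 Nil by simp
  next
    case (Cons g3 \<tau>')
    have "lin (straighten y) (simplex_boundary \<sigma>) = lin (\<lambda>_. 0) (simplex_boundary \<sigma>)"
    proof (rule lin_cong)
      fix \<rho> assume "\<rho> \<in> Poly_Mapping.keys (simplex_boundary \<sigma>)"
      moreover have "\<sigma> \<in> simplices (carrier G) (Suc (3 + length \<tau>'))"
        using assms(2) 4 Cons by simp
      ultimately have "length \<rho> = 3 + length \<tau>'" using keys_simplex_boundary by blast
      then show "straighten y \<rho> = 0" by (cases "(y, \<rho>)" rule: straighten.cases) auto
    qed
    then show ?thesis using 4 by (simp add: lin_def)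
  qed
qed (use assms in auto)

lemma straighten_translate:
  assumes "y \<in> Y" "h \<in> carrier G" "\<sigma> \<in> simplices (carrier G) n"
  shows "straighten (act h y) (map ((\<otimes>) h) \<sigma>) = push ((\<otimes>) h) (straighten y \<sigma>)"
  using assms
  by (cases "(y, \<sigma>)" rule: straighten.cases)
    (simp_all add: frame_translate edge_path_translate frame_frames)

text \<open>
  The homotopy \<open>K\<close> from the identity to \<open>straighten\<close> is equivariant and hence descends to a homotopy on
  the coinvariants. There it bounds every cycle of degree at least 2, because \<open>straighten\<close> vanishes on
  simplices with at least three vertices.
\<close>

lemma cycle_is_boundary:
  fixes c :: "'a list \<times> 'c \<Rightarrow>\<^sub>0 real"
  assumes k: "k \<ge> 2" and keys: "Poly_Mapping.keys c \<subseteq> bar_tuples G k \<times> Y" and cyc: "lin face_sum c = 0"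
  shows "\<exists>b. Poly_Mapping.keys b \<subseteq> bar_tuples G (Suc k) \<times> Y \<and> lin face_sum b = c"
proof -
  define K where "K n y = cone_homotopy (straighten y) n" for n and y
  define \<Phi> where "\<Phi> n = (\<lambda>(ws, y). lin (coinv y) (K n y (vertices \<one> ws)))" for n
  define b where "b = lin (\<Phi> (Suc k)) c"
  have vert: "vertices \<one> ws \<in> simplices (carrier G) (Suc n)" if "ws \<in> bar_tuples G n" for ws n
    using that set_vertices by (auto simp: bar_tuples_def)
  have keysK: "Poly_Mapping.keys (K n y \<sigma>) \<subseteq> simplices (carrier G) (Suc n)"
    if "y \<in> Y" "\<sigma> \<in> simplices (carrier G) n" for n y \<sigma>
    unfolding K_def by (rule keys_cone_homotopy[OF keys_straighten[OF that(1)] that(2)])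
  have coinv_keys: "Poly_Mapping.keys (coinv y \<sigma>) \<subseteq> bar_tuples G n \<times> Y"
    if "y \<in> Y" "\<sigma> \<in> simplices (carrier G) (Suc n)" for y \<sigma> n
  proof -
    have "hd \<sigma> \<in> carrier G" using that by (cases \<sigma>) auto
    then show ?thesis using that set_steps[of \<sigma>] by (auto simp: coinv_def bar_tuples_def in_keys_iff lookup_single when_def split: if_splits)
  qed
  have "Poly_Mapping.keys b \<subseteq> bar_tuples G (Suc k) \<times> Y"
    unfolding b_def
  proof (rule keys_lin_subset[OF keys], clarify)
    fix ws y b1 b2 assume a: "ws \<in> bar_tuples G k" "y \<in> Y" "(b1, b2) \<in> Poly_Mapping.keys (\<Phi> (Suc k) (ws, y))"
    have "Poly_Mapping.keys (\<Phi> (Suc k) (ws, y)) \<subseteq> bar_tuples G (Suc k) \<times> Y"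
      unfolding \<Phi>_def case_prod_conv
      by (rule keys_lin_subset[OF keysK[OF a(2) vert[OF a(1)]] coinv_keys[OF a(2)]])
    then show "b1 \<in> bar_tuples G (Suc k) \<and> b2 \<in> Y" using a(3) by blast
  qed
  moreover have "lin face_sum b = c"
  proof -
    \<comment> \<open>Although \<open>\<Phi>\<close> is defined by means of the representatives with first vertex \<open>1\<close>, it is compatible with
      \<open>K\<close> on all simplices.\<close>
    have descend: "lin (coinv y) (K (Suc n) y \<sigma>) = lin (\<Phi> (Suc n)) (coinv y \<sigma>)"
      if y: "y \<in> Y" and \<sigma>: "\<sigma> \<in> simplices (carrier G) (Suc n)" for n y \<sigma>
    proof -
      define h where "h = hd \<sigma>"
      have h: "h \<in> carrier G" and ne: "\<sigma> \<noteq> []" using \<sigma> by (cases \<sigma>; auto simp: h_def)+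
      have v: "vertices \<one> (steps \<sigma>) = map ((\<otimes>) (inv h)) \<sigma>"
        using map_vertices[of "inv h" h "steps \<sigma>"] vertices_steps[OF ne] \<sigma> h set_steps[of \<sigma>]
        by (simp add: h_def)
      have "K (Suc n) (act (inv h) y) (map ((\<otimes>) (inv h)) \<sigma>) = push ((\<otimes>) (inv h)) (K (Suc n) y \<sigma>)"
        unfolding K_def
        by (rule cone_homotopy_equivariant[where V = "carrier G" and r = "straighten y", OF _ \<sigma>])
          (use h straighten_translate[OF y, of "inv h"] in auto)
      then have "lin (\<Phi> (Suc n)) (coinv y \<sigma>) = smul (\<mu> (inv h))
          (lin (coinv (act (inv h) y)) (push ((\<otimes>) (inv h)) (K (Suc n) y \<sigma>)))"
        by (simp add: \<Phi>_def coinv_def h_def[symmetric] v)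
      also have "lin (coinv (act (inv h) y)) (push ((\<otimes>) (inv h)) (K (Suc n) y \<sigma>)) =
          lin (\<lambda>\<tau>. smul (\<mu> h) (coinv y \<tau>)) (K (Suc n) y \<sigma>)"
        unfolding push_def lin_lin lin_gen
      proof (rule lin_cong)
        fix \<tau> assume "\<tau> \<in> Poly_Mapping.keys (K (Suc n) y \<sigma>)"
        then have "\<tau> \<in> simplices (carrier G) (Suc (Suc n))" using keysK[OF y \<sigma>] by blast
        then show "coinv (act (inv h) y) (map ((\<otimes>) (inv h)) \<tau>) = smul (\<mu> h) (coinv y \<tau>)"
          using coinv_translate[of "inv h" y \<tau>] h y by (cases "\<tau> = []") auto
      qed
      also have "smul (\<mu> (inv h)) \<dots> = lin (coinv y) (K (Suc n) y \<sigma>)"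
        unfolding lin_smul[symmetric] lin_def smul_sum using \<mu>_inv[OF h] by (simp add: mult.assoc[symmetric] mult.commute mult.left_commute)
      finally show ?thesis by simp
    qed
    obtain m where m: "k = Suc m" using k by (cases k) auto
    have step: "lin face_sum (\<Phi> (Suc k) (ws, y)) = gen (ws, y) - lin (\<Phi> k) (face_sum (ws, y))"
      if ws: "ws \<in> bar_tuples G k" and y: "y \<in> Y" for ws y
    proof -
      let ?\<sigma> = "vertices \<one> ws"
      have wsc: "set ws \<subseteq> carrier G" using ws by (simp add: bar_tuples_def)
      have "lin face_sum (\<Phi> (Suc k) (ws, y)) = lin (\<lambda>\<tau>. lin (coinv y) (simplex_boundary \<tau>)) (K (Suc k) y ?\<sigma>)"
        unfolding \<Phi>_def case_prod_conv lin_lin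
      proof (rule lin_cong)
        fix \<tau> assume "\<tau> \<in> Poly_Mapping.keys (K (Suc k) y ?\<sigma>)"
        then have "\<tau> \<in> simplices (carrier G) (Suc (Suc k))" using keysK[OF y vert[OF ws]] by blast
        then show "lin face_sum (coinv y \<tau>) = lin (coinv y) (simplex_boundary \<tau>)" by (rule face_sum_coinv[OF y])
      qed
      also have "\<dots> = lin (coinv y) (lin simplex_boundary (K (Suc k) y ?\<sigma>))" by (simp add: lin_lin)
      also have "lin simplex_boundary (K (Suc k) y ?\<sigma>) = gen ?\<sigma> - straighten y ?\<sigma> - lin (K k y) (simplex_boundary ?\<sigma>)"
        unfolding K_def by (rule cone_homotopy[OF _ straighten_chain_map[OF y] vert[OF ws]]) simp_all
      also have "straighten y ?\<sigma> = 0"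
      proof -
        have "length ?\<sigma> \<ge> 3" using ws k by (simp add: bar_tuples_def)
        then show ?thesis by (rule straighten_long)
      qed
      also have "lin (coinv y) (gen ?\<sigma> - 0 - lin (K k y) (simplex_boundary ?\<sigma>)) =
          gen (ws, y) - lin (\<lambda>\<tau>. lin (coinv y) (K k y \<tau>)) (simplex_boundary ?\<sigma>)"
        by (simp add: coinv_vertices[OF y wsc] lin_lin)
      also have "lin (\<lambda>\<tau>. lin (coinv y) (K k y \<tau>)) (simplex_boundary ?\<sigma>) =
          lin (\<lambda>\<tau>. lin (\<Phi> k) (coinv y \<tau>)) (simplex_boundary ?\<sigma>)"
        unfolding m by (rule lin_cong, rule descend[OF y])
          (use keys_simplex_boundary[OF vert[OF ws]] m in blast)
      also have "\<dots> = lin (\<Phi> k) (lin (coinv y) (simplex_boundary ?\<sigma>))" by (simp add: lin_lin)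
      also have "lin (coinv y) (simplex_boundary ?\<sigma>) = face_sum (ws, y)"
        using face_sum_coinv[OF y vert[OF ws, unfolded m]] by (simp add: coinv_vertices[OF y wsc])
      finally show ?thesis .
    qed
    have "lin face_sum b = lin (\<lambda>a. gen a - lin (\<Phi> k) (face_sum a)) c"
      unfolding b_def lin_lin by (rule lin_cong) (use keys step in fastforce)
    also have "\<dots> = c - lin (\<Phi> k) (lin face_sum c)"
      by (simp add: lin_fun_diff lin_lin)
    finally show ?thesis by (simp add: cyc)
  qed
  ultimately show ?thesis by blast
qed

end

lemma cring_real_ring: "cring real_ring"
proof (intro cringI abelian_groupI comm_monoidI)
  show "\<And>x. x \<in> carrier real_ring \<Longrightarrow> \<exists>y\<in>carrier real_ring. y \<oplus>\<^bsub>real_ring\<^esub> x = \<zero>\<^bsub>real_ring\<^esub>"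
    unfolding real_ring_def by (auto intro!: exI[of _ "- x" for x])
qed (auto simp: real_ring_def algebra_simps)

section \<open>Monomial modules\<close>

definition monomial_module ::
    "('g, 'b) monoid_scheme \<Rightarrow> 'y set \<Rightarrow> ('g \<Rightarrow> 'y \<Rightarrow> 'y) \<Rightarrow> ('g \<Rightarrow> real) \<Rightarrow> (real, 'y \<Rightarrow> real, 'g) gmodule"
  where "monomial_module G Y act \<mu> =
    \<lparr>carrier = {a. finite {y. a y \<noteq> 0} \<and> {y. a y \<noteq> 0} \<subseteq> Y},
     mult = undefined, one = undefined,
     ring.zero = (\<lambda>_. 0), ring.add = (\<lambda>a b y. a y + b y),
     smult = (\<lambda>r a y. r * a y),
     gact = (\<lambda>g a y. if y \<in> Y then \<mu> g * a (act (inv\<^bsub>G\<^esub> g) y) else 0)\<rparr>"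

context monomial_action
begin

abbreviation A where "A \<equiv> monomial_module G Y act \<mu>"

definition translate :: "('g \<Rightarrow> real) \<Rightarrow> 'g \<Rightarrow> ('y \<Rightarrow> real) \<Rightarrow> 'y \<Rightarrow> real"
  where "translate \<nu> g a = (\<lambda>y. if y \<in> Y then \<nu> g * a (act (inv g) y) else 0)"

lemma A_simps [simp]:
  "(a \<in> carrier A) = (finite {y. a y \<noteq> 0} \<and> {y. a y \<noteq> 0} \<subseteq> Y)"
  "\<zero>\<^bsub>A\<^esub> = (\<lambda>_. 0)" "a \<oplus>\<^bsub>A\<^esub> b = (\<lambda>y. a y + b y)" "r \<odot>\<^bsub>A\<^esub> a = (\<lambda>y. r * a y)"
  "gact A g a = translate \<mu> g a"
  by (simp_all add: monomial_module_def translate_def)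

lemma A_add_closed:
  assumes "a \<in> carrier A" "b \<in> carrier A"
  shows "(\<lambda>y. a y + b y) \<in> carrier A"
proof -
  have "{y. a y + b y \<noteq> 0} \<subseteq> {y. a y \<noteq> 0} \<union> {y. b y \<noteq> 0}" by auto
  then show ?thesis using assms by (simp add: finite_subset[OF _ finite_UnI]) blast
qed

lemma A_smult_closed: "a \<in> carrier A \<Longrightarrow> (\<lambda>y. r * a y) \<in> carrier A"
  unfolding A_simps by (auto intro: finite_subset[of _ "{y. a y \<noteq> 0}"])

lemma A_uminus_closed: "a \<in> carrier A \<Longrightarrow> (\<lambda>y. - a y) \<in> carrier A"
  unfolding A_simps by auto

lemma A_zero_closed: "(\<lambda>_. 0) \<in> carrier A"
  by simp

lemma translate_closed:
  assumes "a \<in> carrier A" "g \<in> carrier G"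
  shows "translate \<nu> g a \<in> carrier A"
proof -
  have "{y. translate \<nu> g a y \<noteq> 0} \<subseteq> act g ` {y. a y \<noteq> 0}"
  proof
    fix y assume "y \<in> {y. translate \<nu> g a y \<noteq> 0}"
    then have "y \<in> Y" "a (act (inv g) y) \<noteq> 0" by (auto simp: translate_def split: if_splits)
    then show "y \<in> act g ` {y. a y \<noteq> 0}" using assms by (intro image_eqI[of _ _ "act (inv g) y"]) auto
  qed
  moreover have "finite {y. a y \<noteq> 0}" using assms(1) by simp
  ultimately have "finite {y. translate \<nu> g a y \<noteq> 0}" by (rule finite_subset[OF _ finite_imageI])
  moreover have "{y. translate \<nu> g a y \<noteq> 0} \<subseteq> Y" by (auto simp: translate_def)
  ultimately show ?thesis by simp
qed

lemma A_sum_closed: "finite I \<Longrightarrow> (\<And>i. i \<in> I \<Longrightarrow> a i \<in> carrier A) \<Longrightarrow> (\<lambda>y. \<Sum>i\<in>I. a i y) \<in> carrier A"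
proof (induction I rule: finite_induct)
  case (insert i I)
  then show ?case using A_add_closed[of "a i" "\<lambda>y. \<Sum>i\<in>I. a i y"] by simp
qed simp

lemma gmodule_A: "gmodule real_ring G A"
proof -
  have "abelian_group A"
  proof (rule abelian_groupI)
    fix a assume "a \<in> carrier A"
    then show "\<exists>b\<in>carrier A. b \<oplus>\<^bsub>A\<^esub> a = \<zero>\<^bsub>A\<^esub>"
      by (intro bexI[of _ "\<lambda>y. - a y"] A_uminus_closed) auto
  qed (use A_add_closed in \<open>auto simp: algebra_simps\<close>)
  then have "module real_ring A"
    using cring_real_ring A_smult_closed
    by (intro module.intro module_axioms.intro) (auto simp: real_ring_def algebra_simps)
  then show ?thesis
    using is_group translate_closed
    by (intro gmodule.intro gmodule_axioms.intro)
      (auto simp: translate_def fun_eq_iff algebra_simps act_mult inv_mult_group \<mu>_mult)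
qed

end

section \<open>Coefficients isomorphic to a monomial module\<close>

text \<open>
  In the application \<open>T\<close> is the tensor product of the dualizing module and a monomial module. Chains with
  values in \<open>T\<close> are coded by formal linear combinations, in which bar complexes are easier to handle.
\<close>

locale monomial_coefficients = monomial_action G Y act \<nu>
  for G :: "('g, 'b) monoid_scheme" (structure) and Y :: "'y set" and act \<nu> +
  fixes T :: "('r, 't, 'g, 'e) gmodule_scheme" and \<kappa> :: "('y \<Rightarrow> real) \<Rightarrow> 't"
  assumes \<kappa>_bij: "bij_betw \<kappa> (carrier A) (carrier T)"
    and \<kappa>_zero: "\<zero>\<^bsub>T\<^esub> = \<kappa> (\<lambda>_. 0)"
    and \<kappa>_add: "\<lbrakk>a \<in> carrier A; b \<in> carrier A\<rbrakk> \<Longrightarrow> \<kappa> a \<oplus>\<^bsub>T\<^esub> \<kappa> b = \<kappa> (\<lambda>y. a y + b y)"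
    and \<kappa>_act: "\<lbrakk>g \<in> carrier G; a \<in> carrier A\<rbrakk> \<Longrightarrow> gact T g (\<kappa> a) = \<kappa> (translate \<nu> g a)"
begin

declare A_simps(1) [simp del]

lemma \<kappa>_closed: "a \<in> carrier A \<Longrightarrow> \<kappa> a \<in> carrier T"
  using \<kappa>_bij by (auto simp: bij_betw_def)

lemma \<kappa>_inj: "\<lbrakk>a \<in> carrier A; b \<in> carrier A; \<kappa> a = \<kappa> b\<rbrakk> \<Longrightarrow> a = b"
  using \<kappa>_bij by (auto simp: bij_betw_def inj_on_def)

lemma \<kappa>_surj: "t \<in> carrier T \<Longrightarrow> \<exists>a\<in>carrier A. t = \<kappa> a"
  using \<kappa>_bij by (auto simp: bij_betw_def)

lemma abelian_group_T: "abelian_group T"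
proof (rule abelian_groupI)
  fix x y z assume "x \<in> carrier T" "y \<in> carrier T" "z \<in> carrier T"
  then obtain a b c where "a \<in> carrier A" "b \<in> carrier A" "c \<in> carrier A" "x = \<kappa> a" "y = \<kappa> b" "z = \<kappa> c"
    using \<kappa>_surj by metis
  then show "x \<oplus>\<^bsub>T\<^esub> y \<oplus>\<^bsub>T\<^esub> z = x \<oplus>\<^bsub>T\<^esub> (y \<oplus>\<^bsub>T\<^esub> z)"
    by (simp add: \<kappa>_add A_add_closed add.assoc)
next
  fix x y assume "x \<in> carrier T" "y \<in> carrier T"
  then obtain a b where "a \<in> carrier A" "b \<in> carrier A" "x = \<kappa> a" "y = \<kappa> b"
    using \<kappa>_surj by metis
  then show "x \<oplus>\<^bsub>T\<^esub> y = y \<oplus>\<^bsub>T\<^esub> x" "x \<oplus>\<^bsub>T\<^esub> y \<in> carrier T"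
    by (simp_all add: \<kappa>_add A_add_closed add.commute \<kappa>_closed)
next
  fix x assume "x \<in> carrier T"
  then obtain a where a: "a \<in> carrier A" "x = \<kappa> a"
    using \<kappa>_surj by metis
  show "\<zero>\<^bsub>T\<^esub> \<oplus>\<^bsub>T\<^esub> x = x" using a A_zero_closed by (simp add: \<kappa>_zero \<kappa>_add)
  show "\<exists>y\<in>carrier T. y \<oplus>\<^bsub>T\<^esub> x = \<zero>\<^bsub>T\<^esub>"
    using a A_uminus_closed by (intro bexI[of _ "\<kappa> (\<lambda>y. - a y)"]) (simp_all add: \<kappa>_zero \<kappa>_add \<kappa>_closed)
qed (use A_zero_closed \<kappa>_closed in \<open>simp add: \<kappa>_zero\<close>)

sublocale T: abelian_group T by (rule abelian_group_T)

lemma \<kappa>_alternate: "a \<in> carrier A \<Longrightarrow> alternate T k (\<kappa> a) = \<kappa> (\<lambda>y. (-1) ^ k * a y)"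
proof (cases "even k")
  case False
  assume a: "a \<in> carrier A"
  have "\<kappa> (\<lambda>y. - a y) \<oplus>\<^bsub>T\<^esub> \<kappa> a = \<zero>\<^bsub>T\<^esub>" using a A_uminus_closed by (simp add: \<kappa>_add \<kappa>_zero)
  then have "\<ominus>\<^bsub>T\<^esub> \<kappa> a = \<kappa> (\<lambda>y. - a y)"
    using T.minus_equality a A_uminus_closed \<kappa>_closed by metis
  then show ?thesis using False by (simp add: alternate_def)
qed (simp add: alternate_def)

lemma \<kappa>_finsum:
  assumes "finite I" "\<And>i. i \<in> I \<Longrightarrow> a i \<in> carrier A"
  shows "finsum T (\<lambda>i. \<kappa> (a i)) I = \<kappa> (\<lambda>y. \<Sum>i\<in>I. a i y)"
  using assms
proof (induction I rule: finite_induct)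
  case (insert i I)
  then have "finsum T (\<lambda>i. \<kappa> (a i)) (insert i I) = \<kappa> (a i) \<oplus>\<^bsub>T\<^esub> finsum T (\<lambda>i. \<kappa> (a i)) I"
    by (intro T.finsum_insert) (auto intro: \<kappa>_closed)
  then show ?case using insert A_sum_closed[of I a] by (simp add: \<kappa>_add)
qed (simp add: \<kappa>_zero)

definition chain :: "nat \<Rightarrow> ('g list \<times> 'y \<Rightarrow>\<^sub>0 real) \<Rightarrow> ('g list \<Rightarrow> 't)"
  where "chain n p = (\<lambda>ws\<in>bar_tuples G n. \<kappa> (\<lambda>y. Poly_Mapping.lookup p (ws, y)))"

abbreviation supported :: "nat \<Rightarrow> ('g list \<times> 'y \<Rightarrow>\<^sub>0 real) \<Rightarrow> bool"
  where "supported n p \<equiv> Poly_Mapping.keys p \<subseteq> bar_tuples G n \<times> Y"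

lemma coefficient_closed:
  assumes "supported n p"
  shows "(\<lambda>y. Poly_Mapping.lookup p (ws, y)) \<in> carrier A"
proof -
  have "{y. Poly_Mapping.lookup p (ws, y) \<noteq> 0} \<subseteq> snd ` Poly_Mapping.keys p" by (force simp: in_keys_iff)
  then show ?thesis using assms finite_subset unfolding A_simps by (fastforce simp: in_keys_iff)
qed

lemma carrier_bar_chain_group:
  "carrier (bar_chain_group G T n) =
    {c \<in> \<Pi>\<^sub>E ws\<in>bar_tuples G n. carrier T. finite {ws \<in> bar_tuples G n. c ws \<noteq> \<zero>\<^bsub>T\<^esub>}}"
  unfolding bar_chain_group_def using T.a_group by (simp add: carrier_sum_group)

lemma chain_closed: "supported n p \<Longrightarrow> chain n p \<in> carrier (bar_chain_group G T n)"
proof -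
  assume p: "supported n p"
  have "{ws \<in> bar_tuples G n. chain n p ws \<noteq> \<zero>\<^bsub>T\<^esub>} \<subseteq> fst ` Poly_Mapping.keys p"
  proof clarify
    fix ws assume ws: "ws \<in> bar_tuples G n" "chain n p ws \<noteq> \<zero>\<^bsub>T\<^esub>"
    then have "(\<lambda>y. Poly_Mapping.lookup p (ws, y)) \<noteq> (\<lambda>_. 0)" by (auto simp: chain_def \<kappa>_zero)
    then obtain y where "Poly_Mapping.lookup p (ws, y) \<noteq> 0" by blast
    then show "ws \<in> fst ` Poly_Mapping.keys p" by (force simp: in_keys_iff)
  qed
  then show ?thesis unfolding carrier_bar_chain_group using \<kappa>_closed coefficient_closed[OF p]
    by (auto simp: chain_def finite_subset)
qed

lemma chain_surj:
  assumes "c \<in> carrier (bar_chain_group G T n)"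
  shows "\<exists>p. supported n p \<and> c = chain n p"
proof -
  have c: "c \<in> (\<Pi>\<^sub>E ws\<in>bar_tuples G n. carrier T)" and fin: "finite {ws \<in> bar_tuples G n. c ws \<noteq> \<zero>\<^bsub>T\<^esub>}"
    using assms carrier_bar_chain_group by auto
  have "\<exists>a\<in>carrier A. c ws = \<kappa> a" if "ws \<in> bar_tuples G n" for ws
    using c that \<kappa>_surj by blast
  then obtain a where a: "\<And>ws. ws \<in> bar_tuples G n \<Longrightarrow> a ws \<in> carrier A \<and> c ws = \<kappa> (a ws)"
    by metis
  define f where "f = (\<lambda>(ws, y). if ws \<in> bar_tuples G n then a ws y else 0)"
  have "{z. f z \<noteq> 0} \<subseteq> (SIGMA ws:{ws \<in> bar_tuples G n. c ws \<noteq> \<zero>\<^bsub>T\<^esub>}. {y. a ws y \<noteq> 0})"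
  proof
    fix z assume "z \<in> {z. f z \<noteq> 0}"
    moreover obtain ws y where z: "z = (ws, y)" by (cases z)
    ultimately have "f (ws, y) \<noteq> 0" by simp
    then have ws: "ws \<in> bar_tuples G n" and y: "a ws y \<noteq> 0" by (auto simp: f_def split: if_splits)
    have "c ws \<noteq> \<zero>\<^bsub>T\<^esub>" using a[OF ws] \<kappa>_inj[of "a ws" "\<lambda>_. 0"] A_zero_closed y by (auto simp: \<kappa>_zero)
    then show "z \<in> (SIGMA ws:{ws \<in> bar_tuples G n. c ws \<noteq> \<zero>\<^bsub>T\<^esub>}. {y. a ws y \<noteq> 0})" using ws y z by simp
  qed
  moreover have "finite (SIGMA ws:{ws \<in> bar_tuples G n. c ws \<noteq> \<zero>\<^bsub>T\<^esub>}. {y. a ws y \<noteq> 0})"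
    using a fin by (intro finite_SigmaI) (auto simp: A_simps)
  ultimately have finf: "finite {z. f z \<noteq> 0}" by (rule finite_subset)
  define p where "p = Abs_poly_mapping f"
  have p: "Poly_Mapping.lookup p = f" using finf by (simp add: p_def Abs_poly_mapping_inverse)
  have "supported n p"
  proof clarify
    fix ws y assume "(ws, y) \<in> Poly_Mapping.keys p"
    then have "f (ws, y) \<noteq> 0" by (simp add: in_keys_iff p)
    then have "ws \<in> bar_tuples G n" "a ws y \<noteq> 0" by (auto simp: f_def split: if_splits)
    then show "ws \<in> bar_tuples G n \<and> y \<in> Y" using a[of ws] by (auto simp: A_simps)
  qed
  moreover have "c = chain n p"
  proof
    fix ws show "c ws = chain n p ws"
    proof (cases "ws \<in> bar_tuples G n")
      case True
      then show ?thesis using a[OF True] by (simp add: chain_def p f_def)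
    next
      case False
      then show ?thesis using PiE_arb[OF c False] by (simp add: chain_def)
    qed
  qed
  ultimately show ?thesis by blast
qed

lemma chain_add: "\<lbrakk>supported n p; supported n q\<rbrakk> \<Longrightarrow>
    chain n p \<otimes>\<^bsub>bar_chain_group G T n\<^esub> chain n q = chain n (p + q)"
  by (auto simp: bar_chain_group_def sum_group_def product_group_def chain_def \<kappa>_add coefficient_closed lookup_add)

lemma chain_eq_one:
  assumes "supported n p" "chain n p = \<one>\<^bsub>bar_chain_group G T n\<^esub>"
  shows "p = 0"
proof (rule poly_mapping_eqI, clarify)
  fix ws y
  show "Poly_Mapping.lookup p (ws, y) = Poly_Mapping.lookup 0 (ws, y)"
  proof (cases "ws \<in> bar_tuples G n")
    case True
    have "chain n p ws = \<zero>\<^bsub>T\<^esub>" unfolding assms(2) using True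
      by (simp add: bar_chain_group_def sum_group_def product_group_def)
    then have "(\<lambda>y. Poly_Mapping.lookup p (ws, y)) = (\<lambda>_. 0)"
      using True coefficient_closed[OF assms(1)] A_zero_closed by (intro \<kappa>_inj) (auto simp: chain_def \<kappa>_zero)
    then show ?thesis by (metis lookup_zero)
  next
    case False
    then have "(ws, y) \<notin> Poly_Mapping.keys p" using assms(1) by blast
    then show ?thesis by (simp add: in_keys_iff)
  qed
qed

lemma supported_face_sum:
  assumes "supported (Suc n) p"
  shows "supported n (lin face_sum p)"
proof (rule keys_lin_subset[OF assms])
  fix a assume "a \<in> bar_tuples G (Suc n) \<times> Y"
  then obtain vs y where a: "a = (vs, y)" "vs \<in> bar_tuples G (Suc n)" "y \<in> Y" by blast
  have hd: "hd vs \<in> carrier G" using a(2) by (cases vs) (auto simp: bar_tuples_def)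
  have "Poly_Mapping.lookup (face_sum a) z = 0" if z: "z \<notin> bar_tuples G n \<times> Y" for z
    unfolding face_sum_def a(1) case_prod_conv lookup_sum_poly
  proof (rule sum.neutral, rule ballI)
    fix k assume "k \<in> {..length vs}"
    then have "bar_face G k vs \<in> bar_tuples G n" using a(2) bar_face_closed by (auto simp: bar_tuples_def)
    then show "Poly_Mapping.lookup (smul ((-1) ^ k) (if k = 0 then smul (\<nu> (inv hd vs)) (gen (bar_face G 0 vs, act (inv hd vs) y)) else gen (bar_face G k vs, y))) z = 0"
      using z a hd by (auto simp: lookup_single when_def)
  qed
  then show "Poly_Mapping.keys (face_sum a) \<subseteq> bar_tuples G n \<times> Y" by (auto simp: in_keys_iff)
qed

text \<open>
  The definition of the boundary sums over all faces equal to a given tuple, whereas \<open>face_sum\<close> lists the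
  faces of each generator. The two double sums agree term by term, once the sum over the points is
  evaluated: in a face that acts, only the point \<open>act (hd vs) y\<close> contributes to the coefficient at \<open>y\<close>.
\<close>

lemma bar_boundary_chain:
  assumes p: "supported (Suc n) p"
  shows "bar_boundary G T n (chain (Suc n) p) = chain n (lin face_sum p)"
proof
  fix ws
  show "bar_boundary G T n (chain (Suc n) p) ws = chain n (lin face_sum p) ws"
  proof (cases "ws \<in> bar_tuples G n")
    case ws: True
    let ?c = "chain (Suc n) p"
    define coef where "coef vs = (\<lambda>y. Poly_Mapping.lookup p (vs, y))" for vs
    define m where "m = (\<lambda>(vs, k) y. (-1) ^ k * (if k = 0 then translate \<nu> (inv (hd vs)) (coef vs) y else coef vs y))"
    define I where "I = {(vs, k). vs \<in> bar_tuples G (Suc n) \<and> ?c vs \<noteq> \<zero>\<^bsub>T\<^esub> \<and> k \<le> Suc n \<and> bar_face G k vs = ws}"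
    define S where "S = fst ` Poly_Mapping.keys p"
    define Z where "Z = snd ` Poly_Mapping.keys p"
    define J where "J = {(vs, k). vs \<in> S \<and> k \<le> Suc n \<and> bar_face G k vs = ws}"
    have finS: "finite S" "finite Z" by (simp_all add: S_def Z_def)
    have S: "S \<subseteq> bar_tuples G (Suc n)" and Z: "Z \<subseteq> Y" using p by (auto simp: S_def Z_def)
    have coef0: "coef vs = (\<lambda>_. 0)" if "vs \<notin> S" for vs
    proof
      fix y show "coef vs y = 0"
      proof (rule ccontr)
        assume "coef vs y \<noteq> 0"
        then have "(vs, y) \<in> Poly_Mapping.keys p" by (simp add: coef_def in_keys_iff)
        then show False using that unfolding S_def by (metis fst_conv image_eqI)
      qed
    qed
    have hd: "hd vs \<in> carrier G" if "vs \<in> bar_tuples G (Suc n)" for vs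
      using that by (cases vs) (auto simp: bar_tuples_def)
    have c: "?c vs = \<kappa> (coef vs)" if "vs \<in> bar_tuples G (Suc n)" for vs
      using that by (simp add: chain_def coef_def)
    have coefA: "coef vs \<in> carrier A" for vs unfolding coef_def by (rule coefficient_closed[OF p])
    have IJ: "I \<subseteq> J"
      using coef0 c by (force simp: I_def J_def \<kappa>_zero)
    have finJ: "finite J"
      by (rule finite_subset[of _ "S \<times> {..Suc n}"]) (auto simp: J_def finS)
    have mA: "m (vs, k) \<in> carrier A" if "vs \<in> bar_tuples G (Suc n)" for vs k
      using translate_closed[OF coefA, of "inv (hd vs)"] A_smult_closed[OF coefA] hd[OF that]
      by (cases "k = 0") (auto simp: m_def)
    have "bar_boundary G T n ?c ws = finsum T (\<lambda>i. \<kappa> (m i)) I"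
      unfolding bar_boundary_def restrict_apply'[OF ws] I_def[symmetric]
    proof (rule T.finsum_cong'[OF refl])
      show "(\<lambda>i. \<kappa> (m i)) \<in> I \<rightarrow> carrier T" using mA by (auto simp: I_def intro!: \<kappa>_closed)
      fix i assume "i \<in> I"
      then obtain vs k where i: "i = (vs, k)" "vs \<in> bar_tuples G (Suc n)" by (auto simp: I_def)
      have "alternate T k (if k = 0 then gact T (inv (hd vs)) (?c vs) else ?c vs) = \<kappa> (m (vs, k))"
      proof (cases "k = 0")
        case True
        then show ?thesis using hd[OF i(2)] coefA by (simp add: m_def c[OF i(2)] \<kappa>_act alternate_def)
      next
        case False
        then show ?thesis using coefA by (simp add: m_def c[OF i(2)] \<kappa>_alternate)
      qed
      then show "(case i of (vs, k) \<Rightarrow> alternate T k (if k = 0 then gact T (inv (hd vs)) (?c vs) else ?c vs)) = \<kappa> (m i)"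
        by (simp add: i)
    qed
    also have "\<dots> = \<kappa> (\<lambda>y. \<Sum>i\<in>I. m i y)"
      using mA by (intro \<kappa>_finsum finite_subset[OF IJ finJ]) (auto simp: I_def)
    also have "(\<lambda>y. \<Sum>i\<in>I. m i y) = (\<lambda>y. Poly_Mapping.lookup (lin face_sum p) (ws, y))"
    proof
      fix y
      have "(\<Sum>i\<in>I. m i y) = (\<Sum>i\<in>J. m i y)"
      proof (rule sum.mono_neutral_left[OF finJ IJ], rule ballI)
        fix i assume i: "i \<in> J - I"
        then obtain vs k where i': "i = (vs, k)" "vs \<in> S" by (auto simp: J_def)
        then have vs: "vs \<in> bar_tuples G (Suc n)" using S by blast
        then have "?c vs = \<zero>\<^bsub>T\<^esub>" using i i' by (auto simp: I_def J_def)
        then have "coef vs = (\<lambda>_. 0)" using c[OF vs] coefA A_zero_closed by (intro \<kappa>_inj) (auto simp: \<kappa>_zero)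
        then show "m i y = 0" by (simp add: m_def i' translate_def)
      qed
      also have "\<dots> = (\<Sum>(vs, k)\<in>S \<times> {..Suc n}. if bar_face G k vs = ws then m (vs, k) y else 0)"
        by (rule sum.mono_neutral_cong_left) (auto simp: J_def finS split: if_splits)
      also have "\<dots> = (\<Sum>(vs, k)\<in>S \<times> {..Suc n}. \<Sum>y'\<in>Z. Poly_Mapping.lookup p (vs, y') * ((-1) ^ k *
          (if k = 0 then \<nu> (inv (hd vs)) * (1 when (bar_face G 0 vs, act (inv (hd vs)) y') = (ws, y))
           else (1 when (bar_face G k vs, y') = (ws, y)))))"
      proof (rule sum.cong[OF refl], clarify)
        fix vs k assume vs: "vs \<in> S"
        then have h: "hd vs \<in> carrier G" using hd S by blast
        have eq: "act (inv (hd vs)) y' = y \<longleftrightarrow> y \<in> Y \<and> y' = act (hd vs) y" if "y' \<in> Z" for y'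
          using that Z h by auto
        have notZ: "Poly_Mapping.lookup p (vs, z) = 0" if "z \<notin> Z" for z
          using that by (force simp: Z_def in_keys_iff image_iff)
        show "(if bar_face G k vs = ws then m (vs, k) y else 0) =
          (\<Sum>y'\<in>Z. Poly_Mapping.lookup p (vs, y') * ((-1) ^ k *
          (if k = 0 then \<nu> (inv (hd vs)) * (1 when (bar_face G 0 vs, act (inv (hd vs)) y') = (ws, y))
           else (1 when (bar_face G k vs, y') = (ws, y)))))"
        proof (cases "bar_face G k vs = ws")
          case False
          then show ?thesis by (cases "k = 0") (simp_all add: when_def)
        next
          case True
          show ?thesis
          proof (cases "k = 0")
            case k: True
            have "(\<Sum>y'\<in>Z. Poly_Mapping.lookup p (vs, y') * (\<nu> (inv (hd vs)) * (1 when act (inv (hd vs)) y' = y)))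
                = (\<Sum>y'\<in>Z. if y' = act (hd vs) y then (if y \<in> Y then Poly_Mapping.lookup p (vs, y') * \<nu> (inv (hd vs)) else 0) else 0)"
              by (rule sum.cong[OF refl]) (simp add: eq when_def)
            also have "\<dots> = translate \<nu> (inv (hd vs)) (coef vs) y"
              using finS notZ h by (simp add: translate_def coef_def)
            finally show ?thesis using True k by (simp add: m_def)
          next
            case False
            have "(\<Sum>y'\<in>Z. Poly_Mapping.lookup p (vs, y') * ((-1) ^ k * (1 when y' = y)))
                = (\<Sum>y'\<in>Z. if y' = y then Poly_Mapping.lookup p (vs, y') * (-1) ^ k else 0)"
              by (rule sum.cong[OF refl]) (simp add: when_def)
            also have "\<dots> = (-1) ^ k * coef vs y" using finS notZ by (simp add: coef_def)
            finally show ?thesis using True False by (simp add: m_def)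
          qed
        qed
      qed
      also have "\<dots> = (\<Sum>(vs, y')\<in>S \<times> Z. \<Sum>k\<le>Suc n. Poly_Mapping.lookup p (vs, y') * ((-1) ^ k *
          (if k = 0 then \<nu> (inv (hd vs)) * (1 when (bar_face G 0 vs, act (inv (hd vs)) y') = (ws, y))
           else (1 when (bar_face G k vs, y') = (ws, y)))))"
        unfolding sum.cartesian_product[symmetric] by (rule sum.cong[OF refl]) (rule sum.swap)
      also have "\<dots> = (\<Sum>(vs, y')\<in>S \<times> Z. Poly_Mapping.lookup p (vs, y') * Poly_Mapping.lookup (face_sum (vs, y')) (ws, y))"
      proof (rule sum.cong[OF refl], clarify)
        fix vs y' assume "vs \<in> S"
        then have "length vs = Suc n" using S by (auto simp: bar_tuples_def)
        then show "(\<Sum>k\<le>Suc n. Poly_Mapping.lookup p (vs, y') * ((-1) ^ k *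
          (if k = 0 then \<nu> (inv (hd vs)) * (1 when (bar_face G 0 vs, act (inv (hd vs)) y') = (ws, y))
           else (1 when (bar_face G k vs, y') = (ws, y))))) =
           Poly_Mapping.lookup p (vs, y') * Poly_Mapping.lookup (face_sum (vs, y')) (ws, y)"
          unfolding face_sum_def case_prod_conv lookup_sum_poly sum_distrib_left
          by (intro sum.cong) (auto simp: lookup_single)
      qed
      also have "\<dots> = Poly_Mapping.lookup (lin face_sum p) (ws, y)"
      proof -
        have "Poly_Mapping.keys p \<subseteq> S \<times> Z" by (force simp: S_def Z_def)
        then show ?thesis using lookup_lin[of "S \<times> Z" p face_sum "(ws, y)"] finS by (simp add: case_prod_unfold)
      qed
      finally show "(\<Sum>i\<in>I. m i y) = Poly_Mapping.lookup (lin face_sum p) (ws, y)" .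
    qed
    finally show ?thesis using ws by (simp add: chain_def[of n])
  qed (simp add: bar_boundary_def chain_def)
qed

lemma bar_boundaries_chain: "bar_boundaries G T n = {chain n (lin face_sum p) | p. supported (Suc n) p}"
proof
  show "bar_boundaries G T n \<subseteq> {chain n (lin face_sum p) | p. supported (Suc n) p}"
  proof
    fix b assume "b \<in> bar_boundaries G T n"
    then obtain c where c: "c \<in> carrier (bar_chain_group G T (Suc n))" "b = bar_boundary G T n c"
      unfolding bar_boundaries_def by blast
    obtain p where "supported (Suc n) p" "c = chain (Suc n) p" using chain_surj[OF c(1)] by blast
    then show "b \<in> {chain n (lin face_sum p) | p. supported (Suc n) p}"
      using c(2) bar_boundary_chain[of p n] by blast
  qed
  show "{chain n (lin face_sum p) | p. supported (Suc n) p} \<subseteq> bar_boundaries G T n"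
  proof clarify
    fix p assume "supported (Suc n) p"
    then show "chain n (lin face_sum p) \<in> bar_boundaries G T n"
      unfolding bar_boundaries_def using bar_boundary_chain[of p n] chain_closed[of p "Suc n"] by (metis imageI)
  qed
qed

end

locale cyclic_coefficients = monomial_coefficients G Y act \<nu> T \<kappa> + cyclic_stabilizers G Y act \<nu>
  for G :: "('g, 'b) monoid_scheme" (structure) and Y :: "'y set" and act \<nu>
    and T :: "('r, 't, 'g, 'e) gmodule_scheme" and \<kappa>
begin

text \<open>
  The homology group is a set of cosets, so its triviality means that every coset of a cycle is the
  group of boundaries itself.
\<close>

lemma homology_vanishes:
  assumes "k \<ge> 2" "X \<in> carrier (homology G T k)"
  shows "X = bar_boundaries G T k"
proof -
  obtain j where j: "k = Suc j" using assms by (cases k) auto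
  obtain z where z: "z \<in> bar_cycles G T k"
      "X = bar_boundaries G T k #>\<^bsub>(bar_chain_group G T k)\<lparr>carrier := bar_cycles G T k\<rparr>\<^esub> z"
    using assms(2) unfolding homology_def by (auto simp: FactGroup_def RCOSETS_def)
  have zc: "z \<in> carrier (bar_chain_group G T k)" "bar_boundary G T j z = \<one>\<^bsub>bar_chain_group G T j\<^esub>"
    using z(1) by (simp_all add: bar_cycles_def j kernel_def)
  obtain p where p: "supported k p" "z = chain k p" using chain_surj[OF zc(1)] by blast
  have "lin face_sum p = 0"
    using zc(2) bar_boundary_chain[where n = j and p = p] p j by (intro chain_eq_one[where n = j, OF supported_face_sum]) auto
  then obtain q where q: "supported (Suc k) q" "lin face_sum q = p"
    using cycle_is_boundary[OF assms(1) p(1)] by blast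
  have X: "X = {chain k (lin face_sum r) \<otimes>\<^bsub>bar_chain_group G T k\<^esub> chain k p | r. supported (Suc k) r}"
    unfolding z(2) bar_boundaries_chain r_coset_def p(2) by auto
  have step: "chain k (lin face_sum r) \<otimes>\<^bsub>bar_chain_group G T k\<^esub> chain k p = chain k (lin face_sum (r + q))"
    if "supported (Suc k) r" for r
    using chain_add[OF supported_face_sum[OF that] p(1)] q by simp
  show ?thesis
  proof
    show "X \<subseteq> bar_boundaries G T k"
    proof
      fix x assume "x \<in> X"
      then obtain r where r: "supported (Suc k) r" "x = chain k (lin face_sum (r + q))" using X step by auto
      moreover have "supported (Suc k) (r + q)" using r q keys_add[of r q] by blast
      ultimately show "x \<in> bar_boundaries G T k" unfolding bar_boundaries_chain by blast
    qed
    show "bar_boundaries G T k \<subseteq> X"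
    proof
      fix x assume "x \<in> bar_boundaries G T k"
      then obtain r where r: "supported (Suc k) r" "x = chain k (lin face_sum r)" unfolding bar_boundaries_chain by blast
      have rq: "supported (Suc k) (r - q)" using r q by (intro keys_diff_subset)
      have "x = chain k (lin face_sum (r - q)) \<otimes>\<^bsub>bar_chain_group G T k\<^esub> chain k p"
        using step[OF rq] r by simp
      then show "x \<in> X" unfolding X using rq by blast
    qed
  qed
qed

end

section \<open>Tensoring with the dualizing module\<close>

text \<open>
  As \<open>D\<close> is one-dimensional, \<open>G\<close> acts on it by a character \<open>\<omega>\<close>. Tensoring with \<open>D\<close> therefore turns a
  monomial module into a monomial module, with multipliers \<open>\<omega> g * \<epsilon> g\<close>.
\<close>

locale twisted_monomial = monomial_action G Y act \<epsilon>
  for G :: "('g, 'b) monoid_scheme" (structure) and Y :: "'y set" and act \<epsilon> +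
  fixes D :: "(real, real, 'g) gmodule" and \<phi> :: "real \<Rightarrow> real"
  assumes D: "gmodule real_ring G D"
    and \<phi>_bij: "bij_betw \<phi> UNIV (carrier D)"
    and \<phi>_add: "\<phi> (x + y) = \<phi> x \<oplus>\<^bsub>D\<^esub> \<phi> y"
    and \<phi>_mult: "\<phi> (r * x) = r \<odot>\<^bsub>D\<^esub> \<phi> x"
begin

declare A_simps(1) [simp del]

definition \<psi> where "\<psi> = inv_into UNIV \<phi>"
definition \<omega> where "\<omega> g = \<psi> (gact D g (\<phi> 1))"

lemma \<psi>_\<phi> [simp]: "\<psi> (\<phi> x) = x"
  unfolding \<psi>_def using \<phi>_bij by (simp add: bij_betw_def)

lemma \<phi>_\<psi> [simp]: "d \<in> carrier D \<Longrightarrow> \<phi> (\<psi> d) = d"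
  unfolding \<psi>_def using \<phi>_bij by (simp add: bij_betw_def f_inv_into_f)

lemma \<phi>_closed [simp]: "\<phi> x \<in> carrier D"
  using \<phi>_bij by (auto simp: bij_betw_def)

lemma act_\<phi>:
  assumes "g \<in> carrier G"
  shows "gact D g (\<phi> x) = \<phi> (x * \<omega> g)"
proof -
  interpret D: gmodule real_ring G D by (rule D)
  have c: "gact D g (\<phi> 1) \<in> carrier D" using assms D.gact_closed by simp
  have "gact D g (\<phi> (x * 1)) = x \<odot>\<^bsub>D\<^esub> gact D g (\<phi> 1)"
    unfolding \<phi>_mult using assms by (intro D.gact_smult) (auto simp: real_ring_def)
  also have "\<dots> = \<phi> (x * \<omega> g)" using c by (simp add: \<phi>_mult \<omega>_def)
  finally show ?thesis by simp
qed

lemma \<psi>_act: "g \<in> carrier G \<Longrightarrow> d \<in> carrier D \<Longrightarrow> \<psi> (gact D g d) = \<psi> d * \<omega> g"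
  using act_\<phi>[of g "\<psi> d"] by simp

lemma \<psi>_add: "x \<in> carrier D \<Longrightarrow> y \<in> carrier D \<Longrightarrow> \<psi> (x \<oplus>\<^bsub>D\<^esub> y) = \<psi> x + \<psi> y"
  using \<phi>_add[of "\<psi> x" "\<psi> y"] by (metis \<phi>_\<psi> \<psi>_\<phi>)

lemma \<psi>_smult: "x \<in> carrier D \<Longrightarrow> \<psi> (r \<odot>\<^bsub>D\<^esub> x) = r * \<psi> x"
  using \<phi>_mult[of r "\<psi> x"] by (metis \<phi>_\<psi> \<psi>_\<phi>)

lemma \<omega>_one: "\<omega> \<one> = 1"
proof -
  interpret D: gmodule real_ring G D by (rule D)
  show ?thesis by (simp add: \<omega>_def D.gact_one)
qed

lemma \<omega>_mult:
  assumes "g \<in> carrier G" "h \<in> carrier G"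
  shows "\<omega> (g \<otimes> h) = \<omega> g * \<omega> h"
proof -
  interpret D: gmodule real_ring G D by (rule D)
  have "\<omega> (g \<otimes> h) = \<psi> (gact D g (gact D h (\<phi> 1)))" using assms by (simp add: \<omega>_def D.gact_mult)
  also have "\<dots> = \<omega> h * \<omega> g" using assms by (simp add: act_\<phi>)
  finally show ?thesis by simp
qed

abbreviation \<nu> where "\<nu> \<equiv> \<lambda>g. \<omega> g * \<epsilon> g"

lemma monomial_\<nu>: "monomial_action G Y act \<nu>"
  by unfold_locales (auto simp: act_mult \<omega>_one \<omega>_mult \<mu>_mult)

abbreviation F where "F \<equiv> tensor_free D A"
abbreviation Rel where "Rel \<equiv> tensor_relations real_ring D A"
abbreviation cls where "cls \<equiv> tensor_class real_ring D A"
abbreviation T where "T \<equiv> tensor real_ring D A"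

text \<open>
  The value of a formal sum of pairs under the balanced biadditive map that sends \<open>(\<phi> r, a)\<close> to \<open>r a\<close>.
  It separates the classes of the tensor product (\<open>cls_eq_iff\<close>).
\<close>

definition eval :: "(real \<times> ('y \<Rightarrow> real) \<Rightarrow>\<^sub>0 int) \<Rightarrow> 'y \<Rightarrow> real" where
  "eval t y = (\<Sum>p\<in>Poly_Mapping.keys t. of_int (Poly_Mapping.lookup t p) * (\<psi> (fst p) * snd p y))"

lemma eval_superset: "finite S \<Longrightarrow> Poly_Mapping.keys t \<subseteq> S \<Longrightarrow>
    eval t y = (\<Sum>p\<in>S. of_int (Poly_Mapping.lookup t p) * (\<psi> (fst p) * snd p y))"
  unfolding eval_def by (rule sum.mono_neutral_left) (auto simp: in_keys_iff)

lemma eval_diff: "eval (s - t) = (\<lambda>y. eval s y - eval t y)"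
proof
  fix y
  let ?S = "Poly_Mapping.keys s \<union> Poly_Mapping.keys t"
  have "Poly_Mapping.keys (s - t) \<subseteq> ?S" by (rule keys_diff)
  then show "eval (s - t) y = eval s y - eval t y"
    by (simp add: eval_superset[where S = ?S] lookup_minus sum_subtractf[symmetric] algebra_simps)
qed

lemma eval_0 [simp]: "eval 0 = (\<lambda>_. 0)"
  by (simp add: eval_def fun_eq_iff)

lemma eval_minus: "eval (- t) = (\<lambda>y. - eval t y)"
  using eval_diff[of 0 t] by simp

lemma eval_add: "eval (s + t) = (\<lambda>y. eval s y + eval t y)"
  using eval_diff[of s "- t"] by (simp add: eval_minus)

lemma eval_frag [simp]: "eval (frag_of (d, a)) = (\<lambda>y. \<psi> d * a y)"
  by (simp add: eval_def fun_eq_iff)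

lemma carrier_F: "t \<in> carrier F \<longleftrightarrow> Poly_Mapping.keys t \<subseteq> carrier D \<times> carrier A"
  by (simp add: tensor_free_def free_Abelian_group_def)

lemma F_simps [simp]: "s \<otimes>\<^bsub>F\<^esub> t = s + t" "\<one>\<^bsub>F\<^esub> = 0"
  by (simp_all add: tensor_free_def free_Abelian_group_def)

lemma comm_group_F: "comm_group F"
  by (simp add: tensor_free_def abelian_free_Abelian_group)

lemma inv_F: "t \<in> carrier F \<Longrightarrow> inv\<^bsub>F\<^esub> t = - t"
  unfolding tensor_free_def by (rule inv_free_Abelian_group) (simp add: carrier_free_Abelian_group_iff)

lemma F_closed: "s \<in> carrier F \<Longrightarrow> t \<in> carrier F \<Longrightarrow> s + t \<in> carrier F"
    "s \<in> carrier F \<Longrightarrow> t \<in> carrier F \<Longrightarrow> s - t \<in> carrier F"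
    "d \<in> carrier D \<Longrightarrow> a \<in> carrier A \<Longrightarrow> frag_of (d, a) \<in> carrier F"
  unfolding carrier_F using keys_add[of s t] keys_diff[of s t] by auto

definition tensor_generators where "tensor_generators =
    ({frag_of (x \<oplus>\<^bsub>D\<^esub> x', y) - (frag_of (x, y) + frag_of (x', y)) | x x' y.
        x \<in> carrier D \<and> x' \<in> carrier D \<and> y \<in> carrier A} \<union>
     {frag_of (x, y \<oplus>\<^bsub>A\<^esub> y') - (frag_of (x, y) + frag_of (x, y')) | x y y'.
        x \<in> carrier D \<and> y \<in> carrier A \<and> y' \<in> carrier A} \<union>
     {frag_of (r \<odot>\<^bsub>D\<^esub> x, y) - frag_of (x, r \<odot>\<^bsub>A\<^esub> y) | r x y.
        r \<in> carrier real_ring \<and> x \<in> carrier D \<and> y \<in> carrier A})"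

lemma Rel_gens: "Rel = generate F tensor_generators"
  unfolding tensor_relations_def tensor_generators_def ..

lemma gens_F: "tensor_generators \<subseteq> carrier F"
proof -
  interpret D: gmodule real_ring G D by (rule D)
  show ?thesis unfolding tensor_generators_def
    by (auto simp del: A_simps(3,4) intro!: F_closed simp: D.smult_closed)
      (auto intro!: A_add_closed A_smult_closed)
qed

lemma subgroup_Rel: "subgroup Rel F"
proof -
  interpret F: comm_group F by (rule comm_group_F)
  show ?thesis unfolding Rel_gens by (rule F.generate_is_subgroup[OF gens_F])
qed

lemma Rel_closed: "s \<in> Rel \<Longrightarrow> t \<in> Rel \<Longrightarrow> s + t \<in> Rel" "s \<in> Rel \<Longrightarrow> - s \<in> Rel" "0 \<in> Rel" "s \<in> Rel \<Longrightarrow> s \<in> carrier F"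
proof -
  interpret R: subgroup Rel F by (rule subgroup_Rel)
  show "s \<in> Rel \<Longrightarrow> t \<in> Rel \<Longrightarrow> s + t \<in> Rel" using R.m_closed by simp
  show "s \<in> Rel \<Longrightarrow> s \<in> carrier F" by (rule R.mem_carrier)
  show "s \<in> Rel \<Longrightarrow> - s \<in> Rel" using R.m_inv_closed inv_F R.mem_carrier by metis
  show "0 \<in> Rel" using R.one_closed by simp
qed

lemma eval_gens: "t \<in> tensor_generators \<Longrightarrow> eval t = (\<lambda>_. 0)"
  unfolding tensor_generators_def
  by (elim UnE CollectE exE conjE; hypsubst)
    (simp_all add: eval_diff eval_add \<psi>_add \<psi>_smult algebra_simps)

lemma eval_Rel: "t \<in> Rel \<Longrightarrow> eval t = (\<lambda>_. 0)"
  unfolding Rel_gens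
proof (induction rule: generate.induct)
  case (incl h)
  then show ?case by (rule eval_gens)
next
  case (inv h)
  moreover have "h \<in> carrier F" using inv gens_F by blast
  ultimately show ?case
    using eval_gens by (simp add: inv_F eval_minus)
next
  case (eng h1 h2)
  then show ?case by (simp add: eval_add)
qed simp

lemma eval_closed:
  assumes "t \<in> carrier F"
  shows "eval t \<in> carrier A"
  unfolding eval_def
  by (rule A_sum_closed) (use assms A_smult_closed in \<open>auto simp: carrier_F mult.assoc[symmetric]\<close>)

text \<open>
  The scalars can be moved from \<open>D\<close> to the module, where sums can be formed; so every tensor is pure,
  with first factor \<open>\<phi> 1\<close>. Together with the invariance of \<open>eval\<close> under the relations this identifies the
  tensor product.
\<close>

lemma pure_tensor: "t \<in> carrier F \<Longrightarrow> t - frag_of (\<phi> 1, eval t) \<in> Rel"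
proof -
  have gen: "x \<in> tensor_generators \<Longrightarrow> x \<in> Rel" for x unfolding Rel_gens by (rule generate.incl)
  have zero: "frag_of (\<phi> 1, (\<lambda>_. 0)) \<in> Rel"
  proof -
    have "frag_of (\<phi> 1, (\<lambda>_. 0) \<oplus>\<^bsub>A\<^esub> (\<lambda>_. 0)) - (frag_of (\<phi> 1, (\<lambda>_. 0)) + frag_of (\<phi> 1, (\<lambda>_. 0))) \<in> tensor_generators"
      unfolding tensor_generators_def using A_zero_closed \<phi>_closed by blast
    from Rel_closed(2)[OF gen[OF this]] show ?thesis by simp
  qed
  assume "t \<in> carrier F"
  then have "Poly_Mapping.keys t \<subseteq> carrier D \<times> carrier A" by (simp add: carrier_F)
  then have "t \<in> carrier F \<and> t - frag_of (\<phi> 1, eval t) \<in> Rel"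
  proof (induction rule: frag_induction)
    case zero
    then show ?case using Rel_closed(2)[OF \<open>frag_of (\<phi> 1, (\<lambda>_. 0)) \<in> Rel\<close>] by (simp add: carrier_F)
  next
    case (one x)
    then obtain d a where x: "x = (d, a)" "d \<in> carrier D" "a \<in> carrier A" by auto
    have "frag_of (\<psi> d \<odot>\<^bsub>D\<^esub> \<phi> 1, a) - frag_of (\<phi> 1, \<psi> d \<odot>\<^bsub>A\<^esub> a) \<in> tensor_generators"
      unfolding tensor_generators_def
      by (intro UnI2 CollectI exI conjI, rule refl) (use x in \<open>auto simp: real_ring_def\<close>)
    moreover have "\<psi> d \<odot>\<^bsub>D\<^esub> \<phi> 1 = d" using \<phi>_mult[of "\<psi> d" 1] x by simp
    ultimately show ?case using x gen F_closed(3) by simp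
  next
    case (diff s t)
    then have c: "eval s \<in> carrier A" "eval t \<in> carrier A" using eval_closed by auto
    have c': "(\<lambda>y. eval s y - eval t y) \<in> carrier A"
      using A_add_closed[OF c(1) A_uminus_closed[OF c(2)]] by simp
    let ?f = "\<lambda>a. frag_of (\<phi> 1, a)"
    have "?f ((\<lambda>y. eval s y - eval t y) \<oplus>\<^bsub>A\<^esub> eval t) - (?f (\<lambda>y. eval s y - eval t y) + ?f (eval t)) \<in> tensor_generators"
      unfolding tensor_generators_def using c c' \<phi>_closed by blast
    then have "?f (eval s) - (?f (\<lambda>y. eval s y - eval t y) + ?f (eval t)) \<in> Rel" using gen by simp
    then have "((s - ?f (eval s)) + - (t - ?f (eval t))) +
        (?f (eval s) - (?f (\<lambda>y. eval s y - eval t y) + ?f (eval t))) \<in> Rel"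
      using diff by (intro Rel_closed) auto
    then show ?case using diff F_closed(2) by (simp add: eval_diff algebra_simps)
  qed
  then show ?thesis ..
qed

lemma cls_def': "cls t = {r + t | r. r \<in> Rel}"
  by (auto simp: tensor_class_def r_coset_def)

lemma cls_eq_iff: "s \<in> carrier F \<Longrightarrow> t \<in> carrier F \<Longrightarrow> cls s = cls t \<longleftrightarrow> eval s = eval t"
proof
  assume st: "s \<in> carrier F" "t \<in> carrier F"
  {
    assume "cls s = cls t"
    moreover have "s \<in> cls s" unfolding cls_def' using Rel_closed(3) by (metis (mono_tags, lifting) add_0 mem_Collect_eq)
    ultimately obtain r where "r \<in> Rel" "s = r + t" unfolding cls_def' by blast
    then show "eval s = eval t" by (simp add: eval_add eval_Rel)
  next
    assume eq: "eval s = eval t"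
    have "(s - frag_of (\<phi> 1, eval s)) + - (t - frag_of (\<phi> 1, eval t)) \<in> Rel"
      using st pure_tensor by (intro Rel_closed)
    then have d: "s - t \<in> Rel" by (simp add: eq)
    have "r + s = (r + (s - t)) + t" "r + t = (r - (s - t)) + s" for r by simp_all
    moreover have "r \<in> Rel \<Longrightarrow> r + (s - t) \<in> Rel" "r \<in> Rel \<Longrightarrow> r - (s - t) \<in> Rel" for r
      using Rel_closed(1,2) d by (metis, metis diff_conv_add_uminus)
    ultimately show "cls s = cls t" unfolding cls_def' by blast
  }
qed

definition \<kappa> where "\<kappa> a = cls (frag_of (\<phi> 1, a))"

lemma \<kappa>_eval: "t \<in> carrier F \<Longrightarrow> cls t = \<kappa> (eval t)"
  unfolding \<kappa>_def by (subst cls_eq_iff) (auto intro: F_closed eval_closed)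

lemma carrier_T: "carrier T = \<kappa> ` carrier A"
proof -
  have "carrier T = cls ` carrier F" by (auto simp: tensor_def RCOSETS_def tensor_class_def)
  also have "\<dots> = \<kappa> ` carrier A"
  proof
    show "cls ` carrier F \<subseteq> \<kappa> ` carrier A" using \<kappa>_eval eval_closed by auto
    show "\<kappa> ` carrier A \<subseteq> cls ` carrier F" unfolding \<kappa>_def using F_closed(3) by auto
  qed
  finally show ?thesis .
qed

lemma eval_action:
  assumes "g \<in> carrier G" "t \<in> carrier F"
  defines "s \<equiv> frag_extend (\<lambda>(x, y). frag_of (gact D g x, gact A g y)) t"
  shows "s \<in> carrier F \<and> eval s = translate \<nu> g (eval t)"
proof -
  interpret D: gmodule real_ring G D by (rule D)
  have "Poly_Mapping.keys t \<subseteq> carrier D \<times> carrier A" using assms by (simp add: carrier_F)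
  then show ?thesis unfolding s_def
  proof (induction rule: frag_induction)
    case zero
    then show ?case by (simp add: carrier_F translate_def fun_eq_iff)
  next
    case (one x)
    then obtain d a where x: "x = (d, a)" "d \<in> carrier D" "a \<in> carrier A" by auto
    then show ?case using assms(1) D.gact_closed[of g d] translate_closed[of a g \<epsilon>]
      by (auto simp: \<psi>_act translate_def fun_eq_iff intro!: F_closed)
  next
    case (diff a b)
    then show ?case using F_closed(2) by (auto simp: frag_extend_diff eval_diff translate_def fun_eq_iff algebra_simps)
  qed
qed

lemma coefficients_T: "monomial_coefficients G Y act \<nu> T \<kappa>"
proof -
  interpret \<nu>: monomial_action G Y act \<nu> by (rule monomial_\<nu>)
  have same: "carrier (monomial_module G Y act \<nu>) = carrier A"
    by (simp add: monomial_module_def)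
  have inj: "inj_on \<kappa> (carrier A)"
  proof (rule inj_onI)
    fix a b assume ab: "a \<in> carrier A" "b \<in> carrier A" "\<kappa> a = \<kappa> b"
    then have "eval (frag_of (\<phi> 1, a)) = eval (frag_of (\<phi> 1, b))"
      unfolding \<kappa>_def by (subst (asm) cls_eq_iff) (auto intro: F_closed)
    then show "a = b" by simp
  qed
  show ?thesis
  proof (unfold_locales, unfold same)
    show "bij_betw \<kappa> (carrier A) (carrier T)" using inj carrier_T by (simp add: bij_betw_def)
    have "\<zero>\<^bsub>T\<^esub> = cls 0" by (simp add: tensor_def cls_def')
    also have "\<dots> = \<kappa> (\<lambda>_. 0)" using \<kappa>_eval[of 0] by (simp add: carrier_F)
    finally show "\<zero>\<^bsub>T\<^esub> = \<kappa> (\<lambda>_. 0)" .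
  next
    fix a b assume ab: "a \<in> carrier A" "b \<in> carrier A"
    let ?f = "\<lambda>a. frag_of (\<phi> 1, a)"
    interpret F: comm_group F by (rule comm_group_F)
    have n: "Rel \<lhd> F" using F.normal_iff_subgroup subgroup_Rel by blast
    have "\<kappa> a \<oplus>\<^bsub>T\<^esub> \<kappa> b = cls (?f a + ?f b)"
      using normal.rcos_sum[OF n, of "?f a" "?f b"] ab F_closed(3)
      by (simp add: tensor_def \<kappa>_def tensor_class_def)
    also have "\<dots> = \<kappa> (eval (?f a + ?f b))" using ab by (intro \<kappa>_eval F_closed \<phi>_closed)
    finally show "\<kappa> a \<oplus>\<^bsub>T\<^esub> \<kappa> b = \<kappa> (\<lambda>y. a y + b y)" by (simp add: eval_add)
  next
    fix g a assume g: "g \<in> carrier G" and a: "a \<in> carrier A"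
    let ?F = "\<lambda>t. frag_extend (\<lambda>(x, y). frag_of (gact D g x, gact A g y)) t"
    have t: "t \<in> carrier F \<and> eval t = a" if t: "t \<in> \<kappa> a" for t
    proof -
      obtain r where "r \<in> Rel" "t = r + frag_of (\<phi> 1, a)" using t unfolding \<kappa>_def cls_def' by blast
      then show ?thesis using a Rel_closed(4) by (simp add: F_closed eval_add eval_Rel)
    qed
    have "cls (?F t) = \<kappa> (translate \<nu> g a)" if "t \<in> \<kappa> a" for t
      using t[OF that] eval_action[OF g, of t] \<kappa>_eval by simp
    moreover have "frag_of (\<phi> 1, a) \<in> \<kappa> a" unfolding \<kappa>_def cls_def' using Rel_closed(3)
      by (metis (mono_tags, lifting) add_0 mem_Collect_eq)
    ultimately have "(\<Union>t\<in>\<kappa> a. cls (?F t)) = \<kappa> (translate \<nu> g a)" by blast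
    then show "gact T g (\<kappa> a) = \<kappa> (\<nu>.translate \<nu> g a)"
      by (simp add: tensor_def translate_def \<nu>.translate_def)
  qed
qed

end

section \<open>Duality\<close>

lemma (in monomial_action) cocycle_closed:
  assumes "u \<in> cocycles G A i"
  shows "u \<in> (\<Pi>\<^sub>E ws\<in>bar_tuples G i. carrier A)"
  using assms by (auto simp: cocycles_def kernel_def cochain_group_def product_group_def)

lemma (in monomial_action) coboundary_eq:
  assumes u: "u \<in> bar_tuples G n \<rightarrow> carrier A" and ws: "ws \<in> bar_tuples G (Suc n)"
  shows "coboundary G A n u ws = (\<lambda>y. \<Sum>k\<le>Suc n. (-1) ^ k *
    (if k = 0 then translate \<mu> (hd ws) (u (bar_face G 0 ws)) y else u (bar_face G k ws) y))"
proof -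
  interpret A: monomial_coefficients G Y act \<mu> A id by unfold_locales auto
  define t where "t k = (if k = 0 then translate \<mu> (hd ws) (u (bar_face G 0 ws)) else u (bar_face G k ws))" for k
  have hd: "hd ws \<in> carrier G" using ws by (cases ws) (auto simp: bar_tuples_def)
  have tA: "t k \<in> carrier A" if "k \<in> {0..Suc n}" for k
    using translate_closed[OF funcset_mem[OF u bar_face_closed[OF ws, of 0]] hd]
      funcset_mem[OF u bar_face_closed[OF ws, of k]] that by (simp add: t_def)
  have "coboundary G A n u ws = finsum A (\<lambda>k. id (\<lambda>y. (-1) ^ k * t k y)) {0..Suc n}"
    unfolding coboundary_def restrict_apply'[OF ws]
  proof (rule A.T.finsum_cong'[OF refl])
    show "(\<lambda>k. id (\<lambda>y. (-1) ^ k * t k y)) \<in> {0..Suc n} \<rightarrow> carrier A"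
      using A_smult_closed[OF tA] by auto
    fix k assume k: "k \<in> {0..Suc n}"
    have "(if k = 0 then gact A (hd ws) (u (bar_face G k ws)) else u (bar_face G k ws)) = id (t k)"
      by (cases "k = 0") (simp_all add: t_def)
    then show "alternate A k (if k = 0 then gact A (hd ws) (u (bar_face G k ws)) else u (bar_face G k ws))
      = id (\<lambda>y. (-1) ^ k * t k y)"
      using A.\<kappa>_alternate[OF tA[OF k], of k] by simp
  qed
  also have "\<dots> = id (\<lambda>y. \<Sum>k\<in>{0..Suc n}. (-1) ^ k * t k y)"
    by (rule A.\<kappa>_finsum) (use A_smult_closed[OF tA] in auto)
  finally show ?thesis by (simp add: t_def atLeast0AtMost if_distrib[of "\<lambda>f. f _"] del: sum.atMost_Suc)
qed

lemma (in monomial_action) coboundary_zero: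
  "coboundary G A n (\<lambda>ws\<in>bar_tuples G n. (\<lambda>_. 0)) = (\<lambda>ws\<in>bar_tuples G (Suc n). (\<lambda>_. 0))"
proof
  fix ws
  show "coboundary G A n (\<lambda>ws\<in>bar_tuples G n. (\<lambda>_. 0)) ws = (\<lambda>ws\<in>bar_tuples G (Suc n). (\<lambda>_. 0)) ws"
  proof (cases "ws \<in> bar_tuples G (Suc n)")
    case True
    then show ?thesis
      using bar_face_closed[OF True] by (subst coboundary_eq) (auto simp: translate_def fun_eq_iff intro!: sum.neutral)
  qed (simp add: coboundary_def)
qed

text \<open>
  Cap product with the fundamental class embeds \<open>H\<^sup>i\<close> into the homology of degree \<open>n - i \<ge> 2\<close>, which is
  trivial. So the class of \<open>u\<close> is the class of the zero cochain. Points are coded by lists of elements of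
  \<open>G\<close>, since these form the type over which the coefficients of duality range.
\<close>

theorem PD_cocycle_is_coboundary:
  fixes G :: "('g, 'b) monoid_scheme" and Y :: "'g list set"
  assumes PD: "PD_group real_ring G n" and cyc: "cyclic_stabilizers G Y act \<epsilon>" and i: "i + 2 \<le> n"
    and u: "u \<in> cocycles G (monomial_module G Y act \<epsilon>) i"
  shows "u \<in> coboundaries G (monomial_module G Y act \<epsilon>) i"
proof -
  interpret cyclic_stabilizers G Y act \<epsilon> by (rule cyc)
  obtain D m where D: "dualizing_module real_ring G D" and
    duality: "\<And>A :: (real, 'g list \<Rightarrow> real, 'g) gmodule. gmodule real_ring G A \<Longrightarrow>
      \<forall>i\<le>n. cap_product real_ring G D A n i m \<in> iso (cohomology G A i) (homology G (tensor real_ring D A) (n - i))"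
    using PD unfolding PD_group_def by blast
  have iso: "cap_product real_ring G D A n i m \<in> iso (cohomology G A i) (homology G (tensor real_ring D A) (n - i))"
    using duality[OF gmodule_A] i by simp
  obtain \<phi> where \<phi>: "gmodule real_ring G D" "bij_betw \<phi> (carrier real_ring) (carrier D)"
      "\<forall>x\<in>carrier real_ring. \<forall>y\<in>carrier real_ring. \<phi> (x \<oplus>\<^bsub>real_ring\<^esub> y) = \<phi> x \<oplus>\<^bsub>D\<^esub> \<phi> y"
      "\<forall>r\<in>carrier real_ring. \<forall>x\<in>carrier real_ring. \<phi> (r \<otimes>\<^bsub>real_ring\<^esub> x) = r \<odot>\<^bsub>D\<^esub> \<phi> x"
    using D unfolding dualizing_module_def by blast
  interpret twisted_monomial G Y act \<epsilon> D \<phi>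
    using \<phi> by (intro twisted_monomial.intro twisted_monomial_axioms.intro monomial_action_axioms)
      (simp_all add: real_ring_def)
  interpret T: monomial_coefficients G Y act \<nu> T \<kappa> by (rule coefficients_T)
  interpret T: cyclic_coefficients G Y act \<nu> T \<kappa>
    by unfold_locales (use cyclic in \<open>simp add: stab_def T.stab_def\<close>)
  have sing: "X = X'" if "X \<in> carrier (cohomology G A i)" "X' \<in> carrier (cohomology G A i)" for X X'
  proof -
    let ?f = "cap_product real_ring G D A n i m"
    have b: "bij_betw ?f (carrier (cohomology G A i)) (carrier (homology G T (n - i)))"
      using iso by (simp add: iso_def)
    then have "?f X \<in> carrier (homology G T (n - i))" "?f X' \<in> carrier (homology G T (n - i))"
      using that by (auto simp: bij_betw_def)
    then have "?f X = ?f X'" using T.homology_vanishes[of "n - i"] i by (metis le_diff_conv2 add.commute add_leD1)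
    then show ?thesis using b that by (auto simp: bij_betw_def inj_on_def)
  qed
  let ?z = "\<lambda>ws\<in>bar_tuples G i. (\<lambda>_. 0) :: 'g list \<Rightarrow> real"
  let ?B = "coboundaries G A i"
  have zc: "?z \<in> carrier (cochain_group G A j)" if "j = i" for j
    using A_zero_closed that by (auto simp: cochain_group_def product_group_def)
  have z: "?z \<in> cocycles G A i"
    using zc coboundary_zero[of i] by (simp add: cocycles_def kernel_def) (simp add: cochain_group_def product_group_def)
  have zB: "?z \<in> ?B"
  proof (cases i)
    case 0
    then show ?thesis by (simp add: coboundaries_def cochain_group_def product_group_def)
  next
    case (Suc j)
    have "(\<lambda>ws\<in>bar_tuples G j. (\<lambda>_. 0)) \<in> carrier (cochain_group G A j)"
      using A_zero_closed by (auto simp: cochain_group_def product_group_def)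
    then show ?thesis using coboundary_zero[of j] Suc by (auto simp: coboundaries_def intro!: image_eqI)
  qed
  let ?C = "(cochain_group G A i)\<lparr>carrier := cocycles G A i\<rparr>"
  have "?B #>\<^bsub>?C\<^esub> u = ?B #>\<^bsub>?C\<^esub> ?z"
    using u z by (intro sing) (auto simp: cohomology_def FactGroup_def RCOSETS_def)
  moreover have "u \<in> ?B #>\<^bsub>?C\<^esub> u"
  proof -
    have "u = ?z \<otimes>\<^bsub>?C\<^esub> u"
    proof
      fix ws show "u ws = (?z \<otimes>\<^bsub>?C\<^esub> u) ws"
        using PiE_arb[OF cocycle_closed[OF u], of ws] by (simp add: cochain_group_def product_group_def restrict_def)
    qed
    then show ?thesis using zB by (auto simp: r_coset_def)
  qed
  ultimately obtain b where b: "b \<in> ?B" "u = b \<otimes>\<^bsub>?C\<^esub> ?z" by (auto simp: r_coset_def)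
  have "b ws = undefined" if "ws \<notin> bar_tuples G i" for ws
    using b(1) that by (cases i) (auto simp: coboundaries_def coboundary_def cochain_group_def product_group_def)
  then have "u = b" unfolding b(2) by (auto simp: cochain_group_def product_group_def restrict_def)
  then show ?thesis using b(1) by simp
qed

section \<open>Lifts of circle maps\<close>

definition is_lift :: "(circle \<Rightarrow> circle) \<Rightarrow> (real \<Rightarrow> real) \<Rightarrow> bool"
  where "is_lift f \<theta> \<longleftrightarrow> continuous_on UNIV \<theta> \<and> (\<forall>x. circle_of (\<theta> x) = f (circle_of x))"

lemma circle_of_eq_iff: "circle_of x = circle_of y \<longleftrightarrow> (\<exists>k::int. x = y + of_int k)"
  unfolding circle.abs_eq_iff by (metis Ints_cases Ints_of_int add_diff_cancel_left' diff_add_cancel add.commute)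

lemma circle_of_rep [simp]: "circle_of (rep_circle c) = c"
  by (rule Quotient_abs_rep[OF Quotient_circle])

lemma continuous_circle_of: "continuous_on UNIV circle_of"
  unfolding continuous_on_open_vimage[OF open_UNIV] by (simp add: open_circle_def)

text \<open>
  An embedding of the circle into the complex plane, which gives lifts as logarithms.
\<close>

definition circle_cis :: "circle \<Rightarrow> complex" where "circle_cis c = cis (2 * pi * rep_circle c)"

lemma circle_cis_of [simp]: "circle_cis (circle_of x) = cis (2 * pi * x)"
proof -
  obtain k :: int where k: "rep_circle (circle_of x) = x + of_int k"
    using circle_of_eq_iff[of "rep_circle (circle_of x)" x] by auto
  have "cis (2 * pi * (x + of_int k)) = cis (2 * pi * x) * cis (2 * pi * of_int k)"
    by (simp add: cis_mult ring_distribs del: cis_multiple_2pi)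
  also have "cis (2 * pi * of_int k) = 1" by (rule cis_multiple_2pi) simp
  finally show ?thesis by (simp add: circle_cis_def k)
qed

lemma continuous_circle_cis: "continuous_on UNIV circle_cis"
  unfolding continuous_on_open_vimage[OF open_UNIV]
proof (intro allI impI)
  fix U :: "complex set" assume U: "open U"
  have "continuous_on UNIV (\<lambda>x::real. cis (2 * pi * x))" by (intro continuous_intros)
  then have "open ((\<lambda>x::real. cis (2 * pi * x)) -` U)" using U by (rule open_vimage[rotated])
  moreover have "circle_of -` (circle_cis -` U) = (\<lambda>x::real. cis (2 * pi * x)) -` U" by auto
  ultimately show "open (circle_cis -` U \<inter> UNIV)" by (simp add: open_circle_def)
qed

lemma circle_cis_inj: "circle_cis c = circle_cis c' \<Longrightarrow> c = c'"
proof (induction c rule: circle.abs_induct, induction c' rule: circle.abs_induct)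
  fix x y assume "circle_cis (circle_of x) = circle_cis (circle_of y)"
  then have "exp (\<i> * of_real (2 * pi * x)) = exp (\<i> * of_real (2 * pi * y))" by (simp add: cis_conv_exp)
  then obtain n :: int where "\<i> * of_real (2 * pi * x) = \<i> * of_real (2 * pi * y) + complex_of_real (2 * of_int n * pi) * \<i>"
    unfolding exp_eq by auto
  then have "\<i> * of_real (2 * pi * x) = \<i> * of_real (2 * pi * y + 2 * of_int n * pi)" by (simp add: algebra_simps)
  then have "2 * pi * x = 2 * pi * y + 2 * of_int n * pi"
    by (metis complex_i_not_zero mult_cancel_left of_real_eq_iff)
  then have "2 * pi * x = 2 * pi * (y + of_int n)" by (simp add: algebra_simps)
  then have "x = y + of_int n" by simp
  then show "circle_of x = circle_of y" unfolding circle_of_eq_iff by blast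
qed

lemma lift_exists:
  assumes "continuous_on UNIV f"
  shows "\<exists>\<theta>. is_lift f \<theta>"
proof -
  define F where "F x = circle_cis (f (circle_of x))" for x
  have "continuous_on UNIV F" unfolding F_def
    by (intro continuous_on_compose2[OF continuous_circle_cis] continuous_on_compose2[OF assms] continuous_circle_of) auto
  moreover have norm: "norm (F x) = 1" for x by (simp add: F_def circle_cis_def)
  ultimately obtain g where g: "continuous_on UNIV g" "\<And>x. F x = exp (g x)"
    using continuous_logarithm_on_contractible[of UNIV F] by (metis UNIV_I contractible_UNIV norm_zero zero_neq_one)
  define \<theta> where "\<theta> x = Im (g x) / (2 * pi)" for x
  have "circle_of (\<theta> x) = f (circle_of x)" for x
  proof (rule circle_cis_inj)
    have "Re (g x) = 0" using norm[of x] by (simp add: g(2))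
    then have "g x = \<i> * of_real (2 * pi * \<theta> x)" by (simp add: complex_eq_iff \<theta>_def)
    then show "circle_cis (circle_of (\<theta> x)) = circle_cis (f (circle_of x))"
      using g(2)[of x] by (simp add: F_def cis_conv_exp)
  qed
  moreover have "continuous_on UNIV \<theta>" unfolding \<theta>_def by (intro continuous_intros g) auto
  ultimately show ?thesis unfolding is_lift_def by blast
qed

lemma integer_valued_constant:
  fixes f :: "real \<Rightarrow> real"
  assumes "connected S" "continuous_on S f" "\<And>x. x \<in> S \<Longrightarrow> f x \<in> \<int>" "x \<in> S" "y \<in> S"
  shows "f x = f y"
proof -
  have "f constant_on S"
  proof (rule continuous_discrete_range_constant[OF assms(1,2)])
    fix x assume x: "x \<in> S"
    have "1 \<le> norm (f y - f x)" if "y \<in> S" "f y \<noteq> f x" for y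
      using Ints_nonzero_abs_ge1[of "f y - f x"] assms(3) x that by simp
    then show "\<exists>e>0. \<forall>y. y \<in> S \<and> f y \<noteq> f x \<longrightarrow> e \<le> norm (f y - f x)" by (intro exI[of _ 1]) auto
  qed
  then show ?thesis using assms(4,5) by (auto simp: constant_on_def)
qed

lemma lift_unique:
  assumes "is_lift f \<theta>" "is_lift f \<eta>"
  shows "\<exists>k::int. \<forall>x. \<eta> x = \<theta> x + of_int k"
proof -
  have "\<eta> x - \<theta> x = \<eta> 0 - \<theta> 0" for x
  proof (rule integer_valued_constant[of UNIV "\<lambda>x. \<eta> x - \<theta> x"])
    show "continuous_on UNIV (\<lambda>x. \<eta> x - \<theta> x)" using assms by (intro continuous_intros) (auto simp: is_lift_def)
    fix x show "\<eta> x - \<theta> x \<in> \<int>" using assms by (metis circle.abs_eq_iff is_lift_def)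
  qed auto
  moreover obtain k :: int where "\<eta> 0 - \<theta> 0 = of_int k"
    using assms by (metis circle.abs_eq_iff is_lift_def Ints_cases)
  ultimately show ?thesis by (metis add.commute diff_add_cancel)
qed

lemma lift_compose: "\<lbrakk>is_lift f \<theta>; is_lift g \<eta>\<rbrakk> \<Longrightarrow> is_lift (g \<circ> f) (\<eta> \<circ> \<theta>)"
  unfolding is_lift_def by (auto intro: continuous_on_compose2[of UNIV \<eta> UNIV \<theta>])

text \<open>
  A lift satisfies \<open>\<theta> (x + 1) = \<theta> x + d\<close> with an integer \<open>d\<close>. If \<open>d = 0\<close>, then by the intermediate value
  theorem \<open>\<theta>\<close> takes some value twice within a period, and if \<open>\<bar>d\<bar> \<ge> 2\<close>, then it takes a value \<open>\<theta> 0 \<plusminus> 1\<close>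
  strictly inside a period. Both contradict injectivity of \<open>f\<close>. For \<open>d = \<plusminus>1\<close> the lift is injective, hence
  monotone.
\<close>

lemma lift_degree:
  assumes \<theta>: "is_lift f \<theta>" and inj: "inj f"
  shows "(strict_mono \<theta> \<and> (\<forall>x. \<theta> (x + 1) = \<theta> x + 1)) \<or> (strict_mono (\<lambda>x. - \<theta> x) \<and> (\<forall>x. \<theta> (x + 1) = \<theta> x - 1))"
proof -
  have cont: "continuous_on S \<theta>" for S using \<theta> continuous_on_subset by (auto simp: is_lift_def)
  have lift: "circle_of (\<theta> x) = f (circle_of x)" for x using \<theta> by (simp add: is_lift_def)
  have "is_lift f (\<lambda>x. \<theta> (x + 1))"
    unfolding is_lift_def lift circle_of_eq_iff
  proof
    show "continuous_on UNIV (\<lambda>x. \<theta> (x + 1))" by (intro continuous_on_compose2[OF cont[of UNIV]] continuous_intros) auto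
    have "circle_of (x + 1) = circle_of x" for x unfolding circle_of_eq_iff by (intro exI[of _ 1]) simp
    then show "\<forall>x. f (circle_of (x + 1)) = f (circle_of x)" by simp
  qed
  then obtain d :: int where d: "\<And>x. \<theta> (x + 1) = \<theta> x + of_int d" using lift_unique[OF \<theta>] by blast
  have near: "\<exists>k::int. x = y + of_int k" if "\<theta> x = \<theta> y + of_int l" for x y and l :: int
  proof -
    have "f (circle_of x) = f (circle_of y)" using that lift circle_of_eq_iff by metis
    then show ?thesis using inj circle_of_eq_iff by (metis injD)
  qed
  have near1: False if "\<theta> x = \<theta> y + of_int l" "x < y" "y < x + 1" for x y and l :: int
  proof -
    obtain k :: int where "x = y + of_int k" using near \<open>\<theta> x = \<theta> y + of_int l\<close> by blast
    then show False using that(2,3) by auto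
  qed
  have d0: "d \<noteq> 0"
  proof
    assume "d = 0"
    then have eq: "\<theta> 1 = \<theta> 0" using d[of 0] by simp
    define h where "h = (\<theta> 0 + \<theta> (1/2)) / 2"
    have "\<theta> 0 \<noteq> \<theta> (1/2)" using near1[of 0 "1/2" 0] by auto
    then have "\<exists>x y. 0 < x \<and> x < 1/2 \<and> 1/2 < y \<and> y < 1 \<and> \<theta> x = \<theta> y"
    proof (cases "\<theta> 0 < \<theta> (1/2)")
      case True
      have "\<exists>x\<ge>0. x \<le> 1/2 \<and> \<theta> x = h" by (rule IVT') (use True cont in \<open>auto simp: h_def\<close>)
      moreover have "\<exists>x\<ge>1/2. x \<le> 1 \<and> \<theta> x = h" by (rule IVT2') (use True cont eq in \<open>auto simp: h_def\<close>)
      moreover have "h \<noteq> \<theta> 0" "h \<noteq> \<theta> (1/2)" using True by (auto simp: h_def)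
      ultimately show ?thesis by (metis eq order_le_less)
    next
      case False
      then have L: "\<theta> (1/2) < \<theta> 0" using \<open>\<theta> 0 \<noteq> \<theta> (1/2)\<close> by simp
      have "\<exists>x\<ge>0. x \<le> 1/2 \<and> \<theta> x = h" by (rule IVT2') (use L cont in \<open>auto simp: h_def\<close>)
      moreover have "\<exists>x\<ge>1/2. x \<le> 1 \<and> \<theta> x = h" by (rule IVT') (use L cont eq in \<open>auto simp: h_def\<close>)
      moreover have "h \<noteq> \<theta> 0" "h \<noteq> \<theta> (1/2)" using L by (auto simp: h_def)
      ultimately show ?thesis by (metis eq order_le_less)
    qed
    then obtain x y where "0 < x" "x < 1/2" "1/2 < y" "y < 1" "\<theta> x = \<theta> y" by blast
    then show False using near1[of x y 0] by simp
  qed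
  have d1: "\<bar>d\<bar> = 1"
  proof (rule ccontr)
    assume "\<bar>d\<bar> \<noteq> 1"
    then have "d \<ge> 2 \<or> d \<le> -2" using d0 by linarith
    have t1: "\<theta> 1 = \<theta> 0 + of_int d" using d[of 0] by simp
    from \<open>d \<ge> 2 \<or> d \<le> -2\<close> have "\<exists>x\<ge>0. x \<le> 1 \<and> \<theta> x = \<theta> 0 + of_int (sgn d)"
    proof
      assume "d \<ge> 2"
      then have "sgn d = 1" "real_of_int d \<ge> 2" by auto
      then show ?thesis using t1 cont by (intro IVT') auto
    next
      assume "d \<le> -2"
      then have "sgn d = -1" "real_of_int d \<le> -2" by auto
      then show ?thesis using t1 cont by (intro IVT2') auto
    qed
    then obtain x where x: "0 \<le> x" "x \<le> 1" "\<theta> x = \<theta> 0 + of_int (sgn d)" by blast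
    have "x \<noteq> 0" using x d0 by (auto simp: sgn_if split: if_splits)
    moreover have "x \<noteq> 1" using x t1 \<open>\<bar>d\<bar> \<noteq> 1\<close> d0 by (auto simp: sgn_if split: if_splits)
    moreover have "\<theta> 0 = \<theta> x + of_int (- sgn d)" using x(3) by simp
    ultimately show False using near1[of 0 x "- sgn d"] x by simp
  qed
  have dn: "\<theta> (x + real n) = \<theta> x + real n * of_int d" for x n
  proof (induction n)
    case (Suc n)
    have "\<theta> (x + real (Suc n)) = \<theta> ((x + real n) + 1)" by (simp add: algebra_simps)
    then show ?case using d[of "x + real n"] Suc by (simp add: algebra_simps)
  qed simp
  have inj\<theta>: "inj \<theta>"
  proof (rule injI)
    fix x y assume eq: "\<theta> x = \<theta> y"
    then obtain k :: int where k: "x = y + of_int k" using near[of x y 0] by auto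
    then consider n where "k = int n" | n where "k = - int n" by (metis int_cases2)
    then show "x = y"
    proof cases
      case (1 n)
      then show ?thesis using dn[of y n] k eq d0 by simp
    next
      case (2 n)
      then have "y = x + real n" using k by simp
      then show ?thesis using dn[of x n] eq d0 by simp
    qed
  qed
  have mono: "(\<theta> x < \<theta> y \<and> d = 1) \<or> (\<theta> y < \<theta> x \<and> d = -1)" if "x < y" for x y
  proof -
    obtain n :: nat where n: "y < x + real n" using reals_Archimedean2[of "y - x"] by (auto simp: algebra_simps)
    then have "n > 0" using that by (cases n) auto
    have "(\<theta> x < \<theta> y \<and> \<theta> y < \<theta> (x + real n)) \<or> (\<theta> (x + real n) < \<theta> y \<and> \<theta> y < \<theta> x)"
      by (rule continuous_inj_imp_mono[of x y "x + real n" \<theta>])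
        (use that n cont inj_on_subset[OF inj\<theta>] in auto)
    moreover have "d = 1 \<or> d = -1" using d1 by linarith
    ultimately show ?thesis using dn[of x n] \<open>n > 0\<close> by auto
  qed
  have "d = 1 \<or> d = -1" using d1 by linarith
  then show ?thesis
  proof
    assume "d = 1"
    then show ?thesis using mono d by (intro disjI1) (auto simp: strict_mono_def)
  next
    assume "d = -1"
    then show ?thesis using mono d by (intro disjI2) (auto simp: strict_mono_def)
  qed
qed

section \<open>One-sided slopes\<close>

text \<open>
  The left slope is \<open>a\<close> and the right slope is \<open>b\<close>; they have the same sign, as is the case for
  piecewise linear homeomorphisms.
\<close>

definition has_slopes :: "(real \<Rightarrow> real) \<Rightarrow> real \<Rightarrow> real \<Rightarrow> real \<Rightarrow> bool"
  where "has_slopes \<theta> x a b \<longleftrightarrow> a * b > 0 \<and>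
    (\<exists>\<epsilon>>0. \<forall>y. \<bar>y - x\<bar> < \<epsilon> \<longrightarrow> \<theta> y = \<theta> x + (if x \<le> y then b else a) * (y - x))"

definition slope_jump :: "(real \<Rightarrow> real) \<Rightarrow> real \<Rightarrow> real"
  where "slope_jump \<theta> x = (THE j. \<exists>a b. has_slopes \<theta> x a b \<and> j = ln (b / a))"

lemma has_slopes_unique:
  assumes "has_slopes \<theta> x a b" "has_slopes \<theta> x a' b'"
  shows "a = a' \<and> b = b'"
proof -
  obtain \<epsilon> where e: "\<epsilon> > 0" "\<And>y. \<bar>y - x\<bar> < \<epsilon> \<Longrightarrow> \<theta> y = \<theta> x + (if x \<le> y then b else a) * (y - x)"
    using assms(1) unfolding has_slopes_def by blast
  obtain \<epsilon>' where e': "\<epsilon>' > 0" "\<And>y. \<bar>y - x\<bar> < \<epsilon>' \<Longrightarrow> \<theta> y = \<theta> x + (if x \<le> y then b' else a') * (y - x)"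
    using assms(2) unfolding has_slopes_def by blast
  define t where "t = min \<epsilon> \<epsilon>' / 2"
  have t: "t > 0" "t < \<epsilon>" "t < \<epsilon>'" using e(1) e'(1) by (auto simp: t_def min_def)
  show ?thesis using e(2)[of "x + t"] e'(2)[of "x + t"] e(2)[of "x - t"] e'(2)[of "x - t"] t by simp
qed

lemma slope_jump_eq: "has_slopes \<theta> x a b \<Longrightarrow> slope_jump \<theta> x = ln (b / a)"
  unfolding slope_jump_def by (rule the_equality) (use has_slopes_unique in blast)+

lemma has_slopes_compose:
  assumes "has_slopes \<theta> x a b" "has_slopes \<eta> (\<theta> x) a' b'"
  shows "has_slopes (\<eta> \<circ> \<theta>) x (if b > 0 then a * a' else a * b') (if b > 0 then b * b' else b * a')"
proof -
  obtain \<epsilon> where e: "\<epsilon> > 0" "\<And>y. \<bar>y - x\<bar> < \<epsilon> \<Longrightarrow> \<theta> y = \<theta> x + (if x \<le> y then b else a) * (y - x)" and ab: "a * b > 0"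
    using assms(1) unfolding has_slopes_def by blast
  obtain \<epsilon>' where e': "\<epsilon>' > 0" and e2: "\<And>y. \<bar>y - \<theta> x\<bar> < \<epsilon>' \<Longrightarrow> \<eta> y = \<eta> (\<theta> x) + (if \<theta> x \<le> y then b' else a') * (y - \<theta> x)" and ab': "a' * b' > 0"
    using assms(2) unfolding has_slopes_def by blast
  define M where "M = \<bar>a\<bar> + \<bar>b\<bar>"
  have M: "M > 0" using ab by (cases "a = 0") (auto simp: M_def)
  define t where "t = min \<epsilon> (\<epsilon>' / M)"
  have t: "t > 0" "t \<le> \<epsilon>" "t * M \<le> \<epsilon>'" using e e' M by (auto simp: t_def min_def field_simps)
  have main: "(\<eta> \<circ> \<theta>) y = (\<eta> \<circ> \<theta>) x + (if x \<le> y then (if b > 0 then b * b' else b * a') else (if b > 0 then a * a' else a * b')) * (y - x)"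
    if y: "\<bar>y - x\<bar> < t" for y
  proof -
    define s where "s = (if x \<le> y then b else a)"
    have eq: "\<theta> y - \<theta> x = s * (y - x)" using e(2)[of y] y t by (simp add: s_def)
    have "\<bar>\<theta> y - \<theta> x\<bar> \<le> M * \<bar>y - x\<bar>" unfolding eq abs_mult by (intro mult_right_mono) (auto simp: s_def M_def)
    also have "\<dots> < M * t" using y M by simp
    finally have "\<bar>\<theta> y - \<theta> x\<bar> < \<epsilon>'" using t by (simp add: mult.commute)
    then have ee: "\<eta> (\<theta> y) = \<eta> (\<theta> x) + (if \<theta> x \<le> \<theta> y then b' else a') * (s * (y - x))"
      using e2[of "\<theta> y"] eq by simp
    show ?thesis
    proof (cases "x = y")
      case False
      have "\<theta> x \<le> \<theta> y \<longleftrightarrow> 0 \<le> s * (y - x)" using eq by linarith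
      also have "\<dots> \<longleftrightarrow> (x \<le> y \<longleftrightarrow> b > 0)"
        using ab False by (auto simp: s_def zero_le_mult_iff zero_less_mult_iff)
      finally show ?thesis using ee False by (auto simp: s_def)
    qed simp
  qed
  moreover have "(if b > 0 then a * a' else a * b') * (if b > 0 then b * b' else b * a') > 0"
  proof -
    have "(if b > 0 then a * a' else a * b') * (if b > 0 then b * b' else b * a') = (a * b) * (a' * b')" by auto
    then show ?thesis using ab ab' by simp
  qed
  ultimately show ?thesis unfolding has_slopes_def using t(1) by blast
qed

text \<open>
  The chain rule. If \<open>\<theta>\<close> is decreasing, then it exchanges the two sides of the point, which inverts the
  quotient of the slopes of \<open>\<eta>\<close>.
\<close>

lemma slope_jump_compose:
  assumes "has_slopes \<theta> x a b" "has_slopes \<eta> (\<theta> x) a' b'"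
  shows "slope_jump (\<eta> \<circ> \<theta>) x = slope_jump \<theta> x + (if b > 0 then 1 else -1) * slope_jump \<eta> (\<theta> x)"
proof -
  have pos: "a * b > 0" "a' * b' > 0" using assms unfolding has_slopes_def by blast+
  then have ab: "b / a > 0" "b' / a' > 0" by (simp_all add: zero_less_mult_iff zero_less_divide_iff) blast+
  have "slope_jump (\<eta> \<circ> \<theta>) x = ln (if b > 0 then (b / a) * (b' / a') else (b / a) / (b' / a'))"
    using slope_jump_eq[OF has_slopes_compose[OF assms]] by (simp split: if_splits)
  also have "\<dots> = ln (b / a) + (if b > 0 then 1 else -1) * ln (b' / a')"
    using ln_mult_pos[OF ab] ln_divide_pos[OF ab] by simp
  finally show ?thesis by (simp add: slope_jump_eq[OF assms(1)] slope_jump_eq[OF assms(2)])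
qed

lemma has_slopes_shift: "has_slopes (\<lambda>x. \<theta> x + k) x a b \<longleftrightarrow> has_slopes \<theta> x a b"
  unfolding has_slopes_def by (simp add: algebra_simps)

lemma slope_jump_shift: "slope_jump (\<lambda>x. \<theta> x + k) x = slope_jump \<theta> x"
  unfolding slope_jump_def has_slopes_shift ..

lemma has_slopes_translate:
  assumes "\<And>x. \<theta> (x + k) = \<theta> x + l"
  shows "has_slopes \<theta> (x + k) a b \<longleftrightarrow> has_slopes \<theta> x a b"
proof -
  have "(\<forall>y. \<bar>y - (x + k)\<bar> < \<epsilon> \<longrightarrow> \<theta> y = \<theta> (x + k) + (if x + k \<le> y then b else a) * (y - (x + k))) \<longleftrightarrow>
      (\<forall>y. \<bar>y - x\<bar> < \<epsilon> \<longrightarrow> \<theta> y = \<theta> x + (if x \<le> y then b else a) * (y - x))" (is "?L \<longleftrightarrow> ?R") for \<epsilon>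
  proof
    assume L: ?L
    show ?R
    proof (intro allI impI)
      fix y assume "\<bar>y - x\<bar> < \<epsilon>"
      then show "\<theta> y = \<theta> x + (if x \<le> y then b else a) * (y - x)"
        using L[rule_format, of "y + k"] assms[of y] assms[of x] by simp
    qed
  next
    assume R: ?R
    show ?L
    proof (intro allI impI)
      fix y assume "\<bar>y - (x + k)\<bar> < \<epsilon>"
      then show "\<theta> y = \<theta> (x + k) + (if x + k \<le> y then b else a) * (y - (x + k))"
        using R[rule_format, of "y - k"] assms[of "y - k"] assms[of x] by (auto simp: algebra_simps split: if_splits)
    qed
  qed
  then show ?thesis unfolding has_slopes_def by simp
qed

lemma slope_jump_translate: "(\<And>x. \<theta> (x + k) = \<theta> x + l) \<Longrightarrow> slope_jump \<theta> (x + k) = slope_jump \<theta> x"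
  unfolding slope_jump_def by (simp add: has_slopes_translate)

text \<open>
  The derivative is locally constant on the open interval, hence constant. Continuity at the ends
  extends the formula to the closed interval.
\<close>

lemma affine_on_interval:
  fixes \<theta> :: "real \<Rightarrow> real"
  assumes "u < v" "continuous_on {u..v} \<theta>"
    and loc: "\<And>y. u < y \<Longrightarrow> y < v \<Longrightarrow> \<exists>\<alpha>. \<alpha> \<noteq> 0 \<and> (\<exists>\<epsilon>>0. \<forall>z. \<bar>z - y\<bar> < \<epsilon> \<longrightarrow> \<theta> z = \<theta> y + \<alpha> * (z - y))"
  shows "\<exists>\<alpha>. \<alpha> \<noteq> 0 \<and> (\<forall>y\<in>{u..v}. \<theta> y = \<theta> u + \<alpha> * (y - u))"
proof -
  obtain D where D: "\<And>y. u < y \<Longrightarrow> y < v \<Longrightarrow> D y \<noteq> 0 \<and> (\<exists>\<epsilon>>0. \<forall>z. \<bar>z - y\<bar> < \<epsilon> \<longrightarrow> \<theta> z = \<theta> y + D y * (z - y))"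
    using loc by metis
  have der: "(\<theta> has_real_derivative D y) (at y)" if y: "u < y" "y < v" for y
  proof -
    obtain \<epsilon> where e: "\<epsilon> > 0" "\<And>z. \<bar>z - y\<bar> < \<epsilon> \<Longrightarrow> \<theta> z = \<theta> y + D y * (z - y)" using D[OF y] by blast
    have "((\<lambda>z. \<theta> y + D y * (z - y)) has_real_derivative D y) (at y)" by (auto intro!: derivative_eq_intros)
    then show ?thesis
      by (rule has_field_derivative_transform_within_open[where S = "ball y \<epsilon>"])
        (rule open_ball, use e(1) in simp, rule e(2)[symmetric], simp add: dist_real_def abs_minus_commute)
  qed
  have "D constant_on {u<..<v}"
  proof (rule locally_constant_imp_constant)
    fix y assume "y \<in> {u<..<v}"
    then have y: "u < y" "y < v" by auto
    obtain \<epsilon> where e: "\<epsilon> > 0" "\<And>z. \<bar>z - y\<bar> < \<epsilon> \<Longrightarrow> \<theta> z = \<theta> y + D y * (z - y)" using D[OF y] by blast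
    have "D z = D y" if z: "z \<in> {u<..<v}" "\<bar>z - y\<bar> < \<epsilon>" for z
    proof (rule DERIV_unique)
      show "(\<theta> has_real_derivative D z) (at z)" using der z by auto
      have "((\<lambda>z. \<theta> y + D y * (z - y)) has_real_derivative D y) (at z)" by (auto intro!: derivative_eq_intros)
      then show "(\<theta> has_real_derivative D y) (at z)"
        by (rule has_field_derivative_transform_within_open[where S = "ball y \<epsilon>"])
          (rule open_ball, use z in \<open>simp add: dist_real_def abs_minus_commute\<close>,
            rule e(2)[symmetric], simp add: dist_real_def abs_minus_commute)
    qed
    moreover have "openin (top_of_set {u<..<v}) ({u<..<v} \<inter> ball y \<epsilon>)" by (simp add: openin_open_Int)
    ultimately show "\<exists>T. openin (top_of_set {u<..<v}) T \<and> y \<in> T \<and> (\<forall>x\<in>T. D x = D y)"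
    proof (intro exI[of _ "{u<..<v} \<inter> ball y \<epsilon>"] conjI ballI)
      show "y \<in> {u<..<v} \<inter> ball y \<epsilon>" using y e(1) by simp
      fix z assume "z \<in> {u<..<v} \<inter> ball y \<epsilon>"
      then have "z \<in> {u<..<v}" "\<bar>z - y\<bar> < \<epsilon>" by (auto simp: dist_real_def abs_minus_commute)
      then show "D z = D y" by (rule \<open>\<And>z. z \<in> {u<..<v} \<Longrightarrow> \<bar>z - y\<bar> < \<epsilon> \<Longrightarrow> D z = D y\<close>)
    qed
  qed auto
  then obtain \<alpha> where \<alpha>: "\<And>y. u < y \<Longrightarrow> y < v \<Longrightarrow> D y = \<alpha>" by (auto simp: constant_on_def)
  have "\<alpha> \<noteq> 0" using \<alpha>[of "(u + v) / 2"] D[of "(u + v) / 2"] assms(1) by auto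
  moreover have "\<theta> y = \<theta> u + \<alpha> * (y - u)" if "y \<in> {u..v}" for y
  proof (cases "u = y")
    case False
    then have uy: "u < y" using that by auto
    have "\<theta> y - \<alpha> * y = \<theta> u - \<alpha> * u"
    proof (rule DERIV_isconst_end[OF uy, of "\<lambda>t. \<theta> t - \<alpha> * t"])
      show "continuous_on {u..y} (\<lambda>t. \<theta> t - \<alpha> * t)"
        using assms(2) that by (intro continuous_intros) (auto intro: continuous_on_subset)
      fix x assume x: "u < x" "x < y"
      then have "x < v" using that by auto
      show "((\<lambda>t. \<theta> t - \<alpha> * t) has_real_derivative 0) (at x)"
        using der[OF x(1) \<open>x < v\<close>] \<alpha>[OF x(1) \<open>x < v\<close>] by (auto intro!: derivative_eq_intros)
    qed
    then show ?thesis by (simp add: algebra_simps)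
  qed simp
  ultimately show ?thesis by blast
qed

lemma lift_locally_affine:
  assumes \<theta>: "is_lift f \<theta>" and loc: "locally_affine_at f x"
  shows "\<exists>\<alpha>. \<alpha> \<noteq> 0 \<and> (\<exists>\<epsilon>>0. \<forall>y. \<bar>y - x\<bar> < \<epsilon> \<longrightarrow> \<theta> y = \<theta> x + \<alpha> * (y - x))"
proof -
  obtain \<alpha> \<beta> \<epsilon> where a: "\<alpha> \<noteq> 0" "\<epsilon> > 0" "\<And>y. \<bar>y - x\<bar> < \<epsilon> \<Longrightarrow> f (circle_of y) = circle_of (\<alpha> * y + \<beta>)"
    using loc unfolding locally_affine_at_def by blast
  let ?I = "{x - \<epsilon><..<x + \<epsilon>}"
  have "\<theta> y = \<theta> x + \<alpha> * (y - x)" if y: "\<bar>y - x\<bar> < \<epsilon>" for y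
  proof -
    have "\<theta> y - (\<alpha> * y + \<beta>) = \<theta> x - (\<alpha> * x + \<beta>)"
    proof (rule integer_valued_constant[of ?I "\<lambda>y. \<theta> y - (\<alpha> * y + \<beta>)"])
      show "continuous_on ?I (\<lambda>y. \<theta> y - (\<alpha> * y + \<beta>))"
        using \<theta> by (intro continuous_intros) (auto simp: is_lift_def intro: continuous_on_subset)
      fix z assume "z \<in> ?I"
      then have "circle_of (\<theta> z) = circle_of (\<alpha> * z + \<beta>)" using \<theta> a(3)[of z] by (auto simp: is_lift_def)
      then show "\<theta> z - (\<alpha> * z + \<beta>) \<in> \<int>" by (simp add: circle.abs_eq_iff)
    qed (use y a in auto)
    then show ?thesis by (simp add: algebra_simps)
  qed
  then show ?thesis using a by blast
qed

lemma finite_circle_preimage: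
  assumes "finite F"
  shows "finite {y. circle_of y \<in> F \<and> \<bar>y - x\<bar> \<le> r}"
proof -
  have "{y. circle_of y \<in> F \<and> \<bar>y - x\<bar> \<le> r} \<subseteq>
      (\<Union>c\<in>F. (\<lambda>k. rep_circle c + of_int k) ` {\<lceil>x - r - rep_circle c\<rceil>..\<lfloor>x + r - rep_circle c\<rfloor>})"
  proof
    fix y assume y: "y \<in> {y. circle_of y \<in> F \<and> \<bar>y - x\<bar> \<le> r}"
    then obtain k :: int where k: "y = rep_circle (circle_of y) + of_int k"
      using circle_of_eq_iff[of y "rep_circle (circle_of y)"] by auto
    then have "k \<in> {\<lceil>x - r - rep_circle (circle_of y)\<rceil>..\<lfloor>x + r - rep_circle (circle_of y)\<rfloor>}"
      using y by (auto simp: ceiling_le_iff le_floor_iff abs_le_iff)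
    then show "y \<in> (\<Union>c\<in>F. (\<lambda>k. rep_circle c + of_int k) ` {\<lceil>x - r - rep_circle c\<rceil>..\<lfloor>x + r - rep_circle c\<rfloor>})"
      using y k by blast
  qed
  then show ?thesis using assms by (meson finite_UN_I finite_atLeastAtMost_int finite_imageI finite_subset)
qed

lemma circle_preimage_isolated:
  assumes "finite F"
  shows "\<exists>\<epsilon>>0. \<forall>y. 0 < \<bar>y - x\<bar> \<and> \<bar>y - x\<bar> < \<epsilon> \<longrightarrow> circle_of y \<notin> F"
proof -
  obtain d where d: "d > 0" "\<And>y. y \<in> {y. circle_of y \<in> F \<and> \<bar>y - x\<bar> \<le> 1} \<Longrightarrow> y \<noteq> x \<Longrightarrow> d \<le> dist x y"
    using finite_set_avoid[OF finite_circle_preimage[OF assms]] by blast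
  show ?thesis
  proof (intro exI[of _ "min d 1"] conjI allI impI notI)
    fix y assume "0 < \<bar>y - x\<bar> \<and> \<bar>y - x\<bar> < min d 1" "circle_of y \<in> F"
    then show False using d(2)[of y] by (auto simp: dist_real_def abs_minus_commute)
  qed (use d in auto)
qed

lemma lift_has_slopes:
  assumes \<theta>: "is_lift f \<theta>" and inj: "inj f" and F: "finite F" "\<And>x. circle_of x \<notin> F \<Longrightarrow> locally_affine_at f x"
  shows "\<exists>a b. has_slopes \<theta> x a b \<and> (circle_of x \<notin> F \<longrightarrow> a = b)"
proof -
  have cont: "continuous_on S \<theta>" for S using \<theta> continuous_on_subset by (auto simp: is_lift_def)
  obtain \<epsilon> where e: "\<epsilon> > 0" "\<And>y. 0 < \<bar>y - x\<bar> \<Longrightarrow> \<bar>y - x\<bar> < \<epsilon> \<Longrightarrow> circle_of y \<notin> F"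
    using circle_preimage_isolated[OF F(1)] by blast
  have loc: "\<exists>\<alpha>. \<alpha> \<noteq> 0 \<and> (\<exists>\<epsilon>>0. \<forall>z. \<bar>z - y\<bar> < \<epsilon> \<longrightarrow> \<theta> z = \<theta> y + \<alpha> * (z - y))"
    if "circle_of y \<notin> F" for y using lift_locally_affine[OF \<theta> F(2)[OF that]] .
  have "\<exists>\<alpha>. \<alpha> \<noteq> 0 \<and> (\<forall>y\<in>{x..x + \<epsilon>}. \<theta> y = \<theta> x + \<alpha> * (y - x))"
  proof (rule affine_on_interval[OF _ cont])
    fix y assume "x < y" "y < x + \<epsilon>"
    then have "circle_of y \<notin> F" using e(2)[of y] by simp
    then show "\<exists>\<alpha>. \<alpha> \<noteq> 0 \<and> (\<exists>\<epsilon>>0. \<forall>z. \<bar>z - y\<bar> < \<epsilon> \<longrightarrow> \<theta> z = \<theta> y + \<alpha> * (z - y))" by (rule loc)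
  qed (use e in simp)
  then obtain b where b: "b \<noteq> 0" "\<And>y. x \<le> y \<Longrightarrow> y \<le> x + \<epsilon> \<Longrightarrow> \<theta> y = \<theta> x + b * (y - x)"
    by (metis atLeastAtMost_iff)
  have "\<exists>\<alpha>. \<alpha> \<noteq> 0 \<and> (\<forall>y\<in>{x - \<epsilon>..x}. \<theta> y = \<theta> (x - \<epsilon>) + \<alpha> * (y - (x - \<epsilon>)))"
  proof (rule affine_on_interval[OF _ cont])
    fix y assume "x - \<epsilon> < y" "y < x"
    then have "circle_of y \<notin> F" using e(2)[of y] by simp
    then show "\<exists>\<alpha>. \<alpha> \<noteq> 0 \<and> (\<exists>\<epsilon>>0. \<forall>z. \<bar>z - y\<bar> < \<epsilon> \<longrightarrow> \<theta> z = \<theta> y + \<alpha> * (z - y))" by (rule loc)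
  qed (use e in simp)
  then obtain a where a: "a \<noteq> 0" "\<And>y. x - \<epsilon> \<le> y \<Longrightarrow> y \<le> x \<Longrightarrow> \<theta> y = \<theta> (x - \<epsilon>) + a * (y - (x - \<epsilon>))"
    by (metis atLeastAtMost_iff)
  have a': "\<theta> y = \<theta> x + a * (y - x)" if "x - \<epsilon> \<le> y" "y \<le> x" for y
    using a(2)[of y] a(2)[of x] that e(1) by (simp add: algebra_simps)
  have "a * b > 0"
    using lift_degree[OF \<theta> inj]
  proof
    assume "strict_mono \<theta> \<and> (\<forall>x. \<theta> (x + 1) = \<theta> x + 1)"
    then have "\<theta> x < \<theta> (x + \<epsilon>)" "\<theta> (x - \<epsilon>) < \<theta> x" using e(1) by (auto simp: strict_mono_def)
    then show ?thesis using b(2)[of "x + \<epsilon>"] a'[of "x - \<epsilon>"] e(1) by (simp add: zero_less_mult_iff)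
  next
    assume "strict_mono (\<lambda>x. - \<theta> x) \<and> (\<forall>x. \<theta> (x + 1) = \<theta> x - 1)"
    then have "\<theta> (x + \<epsilon>) < \<theta> x" "\<theta> x < \<theta> (x - \<epsilon>)" using e(1) by (auto simp: strict_mono_def)
    then show ?thesis using b(2)[of "x + \<epsilon>"] a'[of "x - \<epsilon>"] e(1) by (simp add: zero_less_mult_iff mult_less_0_iff)
  qed
  then have s: "has_slopes \<theta> x a b" unfolding has_slopes_def
  proof (intro conjI exI[of _ \<epsilon>] allI impI)
    fix y assume "\<bar>y - x\<bar> < \<epsilon>"
    then show "\<theta> y = \<theta> x + (if x \<le> y then b else a) * (y - x)"
      using b(2)[of y] a'[of y] by (cases "x \<le> y") auto
  qed (use e in auto)
  show ?thesis
  proof (cases "circle_of x \<in> F")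
    case False
    then obtain \<alpha> d where al: "\<alpha> \<noteq> 0" "d > 0" "\<forall>y. \<bar>y - x\<bar> < d \<longrightarrow> \<theta> y = \<theta> x + \<alpha> * (y - x)" using loc by blast
    have "\<alpha> * \<alpha> > 0" using al(1) not_real_square_gt_zero by blast
    then have "has_slopes \<theta> x \<alpha> \<alpha>" unfolding has_slopes_def if_cancel using al(2,3) by blast
    then show ?thesis by blast
  qed (use s in blast)
qed

section \<open>Groups of piecewise linear maps of an interval\<close>

locale interval_action = group G for G :: "('g, 'b) monoid_scheme" (structure) +
  fixes H :: "'g set" and \<theta> :: "'g \<Rightarrow> real \<Rightarrow> real" and p q :: real
  assumes H: "subgroup H G"
    and mono: "g \<in> H \<Longrightarrow> strict_mono (\<theta> g)"
    and cont: "g \<in> H \<Longrightarrow> continuous_on UNIV (\<theta> g)"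
    and slopes: "g \<in> H \<Longrightarrow> \<exists>a b. has_slopes (\<theta> g) x a b"
    and ends: "g \<in> H \<Longrightarrow> \<theta> g p = p" "g \<in> H \<Longrightarrow> \<theta> g q = q"
    and mult: "\<lbrakk>g \<in> H; h \<in> H\<rbrakk> \<Longrightarrow> \<theta> (g \<otimes> h) x = \<theta> g (\<theta> h x)"
    and faithful: "\<lbrakk>g \<in> H; \<And>x. x \<in> {p..q} \<Longrightarrow> \<theta> g x = x\<rbrakk> \<Longrightarrow> g = \<one>"
begin

interpretation H: subgroup H G by (rule H)

lemma one: "\<theta> \<one> x = x"
proof -
  have "\<theta> \<one> (\<theta> \<one> x) = \<theta> \<one> x" using mult[of \<one> \<one> x] by simp
  then show ?thesis using strict_mono_eq[OF mono[OF H.one_closed]] by blast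
qed

lemma inv_cancel: "g \<in> H \<Longrightarrow> \<theta> (inv g) (\<theta> g x) = x" "g \<in> H \<Longrightarrow> \<theta> g (\<theta> (inv g) x) = x"
  using mult[of "inv g" g x] mult[of g "inv g" x] one by simp_all

lemma less_iff: "g \<in> H \<Longrightarrow> \<theta> g x < \<theta> g y \<longleftrightarrow> x < y" and le_iff: "g \<in> H \<Longrightarrow> \<theta> g x \<le> \<theta> g y \<longleftrightarrow> x \<le> y"
  and eq_iff: "g \<in> H \<Longrightarrow> \<theta> g x = \<theta> g y \<longleftrightarrow> x = y"
  using strict_mono_less[OF mono] strict_mono_less_eq[OF mono] strict_mono_eq[OF mono] by auto

definition Fix where "Fix = {x \<in> {p..q}. \<forall>g\<in>H. \<theta> g x = x}"

lemma Fix_ends: "p \<le> q \<Longrightarrow> p \<in> Fix \<and> q \<in> Fix"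
  by (simp add: Fix_def ends)

lemma Fix_fixed: "z \<in> Fix \<Longrightarrow> g \<in> H \<Longrightarrow> \<theta> g z = z"
  by (simp add: Fix_def)

lemma closed_Fix: "closed Fix"
proof -
  have "Fix = {p..q} \<inter> (\<Inter>g\<in>H. {x. \<theta> g x = x})" by (auto simp: Fix_def)
  moreover have "closed {x. \<theta> g x = x}" if "g \<in> H" for g
    by (intro closed_Collect_eq cont[OF that] continuous_intros)
  ultimately show ?thesis by (auto intro!: closed_Int closed_INT)
qed

lemma stays: "\<lbrakk>z \<in> Fix; z' \<in> Fix; g \<in> H; z < x; x < z'\<rbrakk> \<Longrightarrow> z < \<theta> g x \<and> \<theta> g x < z'"
  using less_iff[of g z x] less_iff[of g x z'] Fix_fixed by simp

text \<open>
  The gaps of the set of common fixed points are the intervals between \<open>lo x\<close> and \<open>hi x\<close>. Each gap is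
  invariant under \<open>H\<close>, and its left end serves as its name.
\<close>

definition lo where "lo x = Sup {z \<in> Fix. z \<le> x}"
definition hi where "hi x = Inf {z \<in> Fix. x \<le> z}"

lemma gap:
  assumes "x \<in> {p..q}" "x \<notin> Fix"
  shows "lo x \<in> Fix" "hi x \<in> Fix" "lo x < x" "x < hi x" "z \<in> Fix \<Longrightarrow> z \<le> lo x \<or> hi x \<le> z"
proof -
  have pq: "p \<in> Fix" "q \<in> Fix" using Fix_ends assms by auto
  have bdd: "bdd_above {z \<in> Fix. z \<le> x}" "bdd_below {z \<in> Fix. x \<le> z}" by (auto intro: bdd_aboveI bdd_belowI)
  have "{z \<in> Fix. z \<le> x} = Fix \<inter> {..x}" "{z \<in> Fix. x \<le> z} = Fix \<inter> {x..}" by auto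
  then have cl: "closed {z \<in> Fix. z \<le> x}" "closed {z \<in> Fix. x \<le> z}" using closed_Fix by auto
  have "lo x \<in> {z \<in> Fix. z \<le> x}" unfolding lo_def
    using pq assms by (intro closed_contains_Sup bdd cl) auto
  moreover have "hi x \<in> {z \<in> Fix. x \<le> z}" unfolding hi_def
    using pq assms by (intro closed_contains_Inf bdd cl) auto
  ultimately show *: "lo x \<in> Fix" "hi x \<in> Fix" "lo x < x" "x < hi x" using assms(2) by (auto simp: order_le_less)
  show "z \<le> lo x \<or> hi x \<le> z" if "z \<in> Fix"
  proof (cases "z \<le> x")
    case True
    then show ?thesis unfolding lo_def using that bdd by (intro disjI1 cSup_upper) auto
  next
    case False
    then show ?thesis unfolding hi_def using that bdd by (intro disjI2 cInf_lower) auto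
  qed
qed

lemma lo_eqI:
  assumes "x \<in> {p..q}" "x \<notin> Fix" "lo x < y" "y < hi x"
  shows "y \<in> {p..q}" "y \<notin> Fix" "lo y = lo x"
proof -
  note g = gap[OF assms(1,2)]
  show y: "y \<in> {p..q}" "y \<notin> Fix" using g(1,2) g(5)[of y] assms(3,4) by (auto simp: Fix_def)
  note h = gap[OF y]
  show "lo y = lo x" using h(1,3) h(5)[OF g(1)] g(5)[OF h(1)] h(4) assms(3,4) by linarith
qed

definition germ_trivial where
  "germ_trivial w \<longleftrightarrow> w \<in> H \<and> (\<forall>z\<in>Fix. \<exists>\<epsilon>>0. \<forall>y. \<bar>y - z\<bar> < \<epsilon> \<longrightarrow> \<theta> w y = y)"

definition supp where "supp w = {x \<in> {p..q}. \<theta> w x \<noteq> x}"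

lemma supp_not_Fix: "w \<in> H \<Longrightarrow> x \<in> supp w \<Longrightarrow> x \<in> {p..q} \<and> x \<notin> Fix"
  by (auto simp: supp_def Fix_def)

text \<open>
  At a common fixed point the one-sided slopes are multiplicative, so \<open>f g\<close> and \<open>g f\<close> have the same slopes
  and agree near that point.
\<close>

lemma commutator_germ_trivial:
  assumes f: "f \<in> H" and g: "g \<in> H"
  shows "germ_trivial (f \<otimes> g \<otimes> inv (g \<otimes> f))"
  unfolding germ_trivial_def
proof (intro conjI ballI)
  show "f \<otimes> g \<otimes> inv (g \<otimes> f) \<in> H" using assms by blast
  fix z assume z: "z \<in> Fix"
  obtain a b where ab: "has_slopes (\<theta> f) z a b" using slopes[OF f] by blast
  obtain a' b' where ab': "has_slopes (\<theta> g) z a' b'" using slopes[OF g] by blast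
  have pos: "b > 0" if "has_slopes (\<theta> h) z a b" "h \<in> H" for h a b
  proof -
    obtain \<epsilon> where e: "\<epsilon> > 0" "\<And>y. \<bar>y - z\<bar> < \<epsilon> \<Longrightarrow> \<theta> h y = \<theta> h z + (if z \<le> y then b else a) * (y - z)"
      using \<open>has_slopes (\<theta> h) z a b\<close> unfolding has_slopes_def by blast
    have "\<theta> h z < \<theta> h (z + \<epsilon> / 2)" using less_iff[OF that(2)] e(1) by simp
    then show ?thesis using e(2)[of "z + \<epsilon> / 2"] e(1) by (simp add: zero_less_mult_iff)
  qed
  have "has_slopes (\<theta> f \<circ> \<theta> g) z (a' * a) (b' * b)"
    using has_slopes_compose[OF ab', of "\<theta> f" a b] ab pos[OF ab' g] Fix_fixed[OF z g] by simp
  moreover have "has_slopes (\<theta> g \<circ> \<theta> f) z (a * a') (b * b')"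
    using has_slopes_compose[OF ab, of "\<theta> g" a' b'] ab' pos[OF ab f] Fix_fixed[OF z f] by simp
  ultimately obtain \<epsilon>1 \<epsilon>2 where e: "\<epsilon>1 > 0" "\<epsilon>2 > 0"
      and e1: "\<And>y. \<bar>y - z\<bar> < \<epsilon>1 \<Longrightarrow> (\<theta> f \<circ> \<theta> g) y = (\<theta> f \<circ> \<theta> g) z + (if z \<le> y then b' * b else a' * a) * (y - z)"
      and e2: "\<And>y. \<bar>y - z\<bar> < \<epsilon>2 \<Longrightarrow> (\<theta> g \<circ> \<theta> f) y = (\<theta> g \<circ> \<theta> f) z + (if z \<le> y then b * b' else a * a') * (y - z)"
    unfolding has_slopes_def by blast
  have agree: "\<theta> f (\<theta> g y) = \<theta> g (\<theta> f y)" if "\<bar>y - z\<bar> < min \<epsilon>1 \<epsilon>2" for y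
  proof -
    have "(\<theta> f \<circ> \<theta> g) y = (\<theta> g \<circ> \<theta> f) y"
      unfolding e1[of y, OF less_le_trans[OF that min.cobounded1]] e2[of y, OF less_le_trans[OF that min.cobounded2]]
      using Fix_fixed[OF z] f g by (simp add: mult.commute)
    then show ?thesis by simp
  qed
  let ?k = "inv (g \<otimes> f)"
  have k: "?k \<in> H" using f g by blast
  have "continuous (at z) (\<theta> ?k)" using cont[OF k] continuous_on_eq_continuous_at[OF open_UNIV] by blast
  then obtain d where d: "d > 0" "\<And>y. \<bar>y - z\<bar> < d \<Longrightarrow> \<bar>\<theta> ?k y - z\<bar> < min \<epsilon>1 \<epsilon>2"
    unfolding continuous_at_eps_delta using Fix_fixed[OF z k] e
    by (metis dist_real_def min_less_iff_conj)
  have "\<theta> (f \<otimes> g \<otimes> ?k) y = y" if "\<bar>y - z\<bar> < d" for y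
  proof -
    have "\<theta> (f \<otimes> g \<otimes> ?k) y = \<theta> f (\<theta> g (\<theta> ?k y))" using f g k by (simp add: mult)
    also have "\<dots> = \<theta> (g \<otimes> f) (\<theta> ?k y)" using agree[OF d(2)[OF that]] f g by (simp add: mult)
    also have "\<dots> = y" using inv_cancel(2)[of "g \<otimes> f"] f g by blast
    finally show ?thesis .
  qed
  then show "\<exists>\<epsilon>>0. \<forall>y. \<bar>y - z\<bar> < \<epsilon> \<longrightarrow> \<theta> (f \<otimes> g \<otimes> ?k) y = y" using d(1) by blast
qed

text \<open>
  If the support of \<open>w\<close> met infinitely many gaps, then their left ends would accumulate at a common fixed
  point. Gaps close to it would lie in the neighbourhood where \<open>w\<close> is the identity.
\<close>

lemma finite_gaps:
  assumes "germ_trivial w"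
  shows "finite (lo ` supp w)"
proof (rule ccontr)
  have w: "w \<in> H" using assms by (simp add: germ_trivial_def)
  assume inf: "infinite (lo ` supp w)"
  have sub: "lo ` supp w \<subseteq> Fix" using supp_not_Fix[OF w] gap(1) by blast
  then have "lo ` supp w \<subseteq> {p..q}" by (auto simp: Fix_def)
  then obtain l where l: "l islimpt lo ` supp w"
    using inf compact_eq_Bolzano_Weierstrass[of "{p..q}"] by (metis compact_Icc)
  then have "l islimpt Fix" using sub islimpt_subset by blast
  then have lF: "l \<in> Fix" using closed_Fix closed_limpt by blast
  then obtain \<epsilon> where e: "\<epsilon> > 0" "\<And>y. \<bar>y - l\<bar> < \<epsilon> \<Longrightarrow> \<theta> w y = y" using assms unfolding germ_trivial_def by blast
  have near: "\<exists>x\<in>supp w. lo x \<noteq> l \<and> \<bar>lo x - l\<bar> < d" if "d > 0" for d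
    using l that unfolding islimpt_approachable by (auto simp: dist_real_def)
  have left: "l \<le> lo x" if x: "x \<in> supp w" "\<bar>lo x - l\<bar> < \<epsilon>" for x
  proof (rule ccontr)
    assume "\<not> l \<le> lo x"
    note g = gap[OF supp_not_Fix[OF w x(1), THEN conjunct1] supp_not_Fix[OF w x(1), THEN conjunct2]]
    have "hi x \<le> l" using g(5)[OF lF] \<open>\<not> l \<le> lo x\<close> by linarith
    then have "\<bar>x - l\<bar> < \<epsilon>" using g(3,4) x(2) by linarith
    then show False using e(2) x(1) by (auto simp: supp_def)
  qed
  obtain x where x: "x \<in> supp w" "lo x \<noteq> l" "\<bar>lo x - l\<bar> < \<epsilon>" using near[OF e(1)] by blast
  then have "l < lo x" using left by force
  then obtain y where y: "y \<in> supp w" "lo y \<noteq> l" "\<bar>lo y - l\<bar> < lo x - l" using near[of "lo x - l"] by auto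
  note gx = gap[OF supp_not_Fix[OF w x(1), THEN conjunct1] supp_not_Fix[OF w x(1), THEN conjunct2]]
  note gy = gap[OF supp_not_Fix[OF w y(1), THEN conjunct1] supp_not_Fix[OF w y(1), THEN conjunct2]]
  have "l < lo y" using left[OF y(1)] y x by force
  moreover have "hi y \<le> lo x" using gy(5)[OF gx(1)] y(3) by linarith
  ultimately have "\<bar>y - l\<bar> < \<epsilon>" using gy(3,4) x(3) by linarith
  then show False using e(2) y(1) by (auto simp: supp_def)
qed

text \<open>
  Otherwise the supremum of the orbit of \<open>c\<close> would be a common fixed point inside a gap.
\<close>

lemma orbit_reaches:
  assumes x: "x \<in> {p..q}" "x \<notin> Fix" and c: "lo x < c" "c < hi x" and d: "d < hi x"
  shows "\<exists>h\<in>H. d < \<theta> h c"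
proof (rule ccontr)
  assume no: "\<not> ?thesis"
  note g = gap[OF x]
  define s where "s = Sup ((\<lambda>h. \<theta> h c) ` H)"
  have ne: "(\<lambda>h. \<theta> h c) ` H \<noteq> {}" using H.one_closed by blast
  have bdd: "bdd_above ((\<lambda>h. \<theta> h c) ` H)" using no by (intro bdd_aboveI[of _ d]) auto
  have upper: "\<theta> h c \<le> s" if "h \<in> H" for h unfolding s_def using bdd that by (intro cSup_upper) auto
  have sd: "s \<le> d" unfolding s_def using ne no by (intro cSup_least) auto
  have cs: "c \<le> s" using upper[OF H.one_closed] one by simp
  have below: "\<theta> h s \<le> s" if h: "h \<in> H" for h
  proof (rule ccontr)
    assume "\<not> \<theta> h s \<le> s"
    then have "\<theta> (inv h) s < s" using less_iff[OF h, of "\<theta> (inv h) s" s] inv_cancel(2)[OF h] by simp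
    then obtain k where k: "k \<in> H" "\<theta> (inv h) s < \<theta> k c" unfolding s_def using less_cSup_iff[OF ne bdd] by auto
    then have "s < \<theta> (h \<otimes> k) c" using less_iff[OF h, of "\<theta> (inv h) s"] inv_cancel(2)[OF h] h by (simp add: mult)
    then show False using upper[of "h \<otimes> k"] h k by fastforce
  qed
  have "\<theta> h s = s" if h: "h \<in> H" for h
    using below[OF h] below[of "inv h"] h le_iff[OF h, of "\<theta> (inv h) s" s] inv_cancel(2)[OF h, of s] by force
  moreover have "s \<in> {p..q}" using lo_eqI(1)[OF x, of s] cs c sd d by simp
  ultimately have "s \<in> Fix" by (simp add: Fix_def)
  then show False using g(5)[of s] cs c sd d by linarith
qed

text \<open>
  The argument of Brin and Squier. Among the nontrivial elements whose germs at the common fixed points are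
  trivial, which exist because commutators are of this kind, let \<open>w\<close> be one whose support meets the
  least number of gaps. In one of these gaps its support lies in a compact interval \<open>[c, d]\<close>, and some
  \<open>h\<close> moves this interval off itself. Let \<open>v = h w h\<^sup>-\<^sup>1\<close>. In the chosen gap \<open>v\<close> and \<open>w\<close> have disjoint supports,
  and in a gap where \<open>w\<close> is trivial, so is \<open>v\<close>. So the support of the commutator of \<open>v\<close> and \<open>w\<close> meets fewer
  gaps, and by minimality this commutator is trivial.
\<close>

theorem noncommuting_imp_disjoint_commuting:
  assumes fg: "f \<in> H" "g \<in> H" "f \<otimes> g \<noteq> g \<otimes> f"
  shows "\<exists>v\<in>H. \<exists>w\<in>H. \<exists>x. v \<otimes> w = w \<otimes> v \<and> w \<noteq> \<one> \<and> \<theta> w x = x \<and> \<theta> v x \<noteq> x"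
proof -
  let ?P = "\<lambda>w. germ_trivial w \<and> w \<noteq> \<one>"
  have "?P (f \<otimes> g \<otimes> inv (g \<otimes> f))"
  proof
    show "germ_trivial (f \<otimes> g \<otimes> inv (g \<otimes> f))" by (rule commutator_germ_trivial[OF fg(1,2)])
    show "f \<otimes> g \<otimes> inv (g \<otimes> f) \<noteq> \<one>"
      using fg H.mem_carrier by (metis inv_solve_right' l_one m_closed one_closed)
  qed
  then obtain w where w: "?P w" and least: "\<And>u. ?P u \<Longrightarrow> card (lo ` supp w) \<le> card (lo ` supp u)"
    using ex_has_least_nat[of ?P _ "\<lambda>w. card (lo ` supp w)"] by blast
  have wH: "w \<in> H" using w by (simp add: germ_trivial_def)
  obtain x0 where x0: "x0 \<in> supp w" using faithful[OF wH] w by (auto simp: supp_def)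
  then have x0': "x0 \<in> {p..q}" "x0 \<notin> Fix" using supp_not_Fix[OF wH] by blast+
  note g0 = gap[OF x0']
  obtain \<epsilon>1 where e1: "\<epsilon>1 > 0" "\<And>y. \<bar>y - lo x0\<bar> < \<epsilon>1 \<Longrightarrow> \<theta> w y = y" using w g0(1) unfolding germ_trivial_def by blast
  obtain \<epsilon>2 where e2: "\<epsilon>2 > 0" "\<And>y. \<bar>y - hi x0\<bar> < \<epsilon>2 \<Longrightarrow> \<theta> w y = y" using w g0(2) unfolding germ_trivial_def by blast
  define c where "c = lo x0 + \<epsilon>1"
  define d where "d = hi x0 - \<epsilon>2"
  have cd: "c \<le> y \<and> y \<le> d" if "lo x0 < y" "y < hi x0" "\<theta> w y \<noteq> y" for y
    using e1(2)[of y] e2(2)[of y] that unfolding c_def d_def by linarith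
  have x0cd: "c \<le> x0" "x0 \<le> d" using cd[of x0] g0 x0 by (auto simp: supp_def)
  obtain h where h: "h \<in> H" "d < \<theta> h c"
    using orbit_reaches[OF x0', of c d] e1(1) e2(1) x0cd g0(3,4) unfolding c_def d_def by auto
  define v where "v = h \<otimes> w \<otimes> inv h"
  have vH: "v \<in> H" unfolding v_def using h wH by blast
  have v: "\<theta> v y = \<theta> h (\<theta> w (\<theta> (inv h) y))" for y unfolding v_def using h(1) wH by (simp add: mult)
  have v_fix: "\<theta> v y = y \<longleftrightarrow> \<theta> w (\<theta> (inv h) y) = \<theta> (inv h) y" for y
    unfolding v using eq_iff[OF h(1), of "\<theta> w (\<theta> (inv h) y)" "\<theta> (inv h) y"] inv_cancel(2)[OF h(1)] by simp
  have v_d: "d < y" if y: "lo x0 < y" "y < hi x0" "\<theta> v y \<noteq> y" for y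
  proof -
    have "c \<le> \<theta> (inv h) y"
      using cd stays[OF g0(1,2) _ y(1,2), of "inv h"] y(3) h(1) unfolding v_fix by blast
    then have "\<theta> h c \<le> y" using le_iff[OF h(1), of c "\<theta> (inv h) y"] inv_cancel(2)[OF h(1)] by simp
    then show ?thesis using h(2) by simp
  qed
  have comm0: "\<theta> w (\<theta> v y) = \<theta> v (\<theta> w y)" if y: "lo x0 < y" "y < hi x0" for y
  proof (cases "y \<le> d")
    case True
    have vy: "\<theta> v y = y" using v_d[OF y] True by force
    have "\<theta> v (\<theta> w y) = \<theta> w y"
    proof (rule ccontr)
      assume ne: "\<theta> v (\<theta> w y) \<noteq> \<theta> w y"
      have s: "lo x0 < \<theta> w y" "\<theta> w y < hi x0" using stays[OF g0(1,2) wH y] by auto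
      have "d < \<theta> w y" using v_d[OF s ne] .
      then have "\<theta> w (\<theta> w y) = \<theta> w y" using cd[OF s] by force
      then have "\<theta> w y = y" using eq_iff[OF wH] by blast
      then show False using True \<open>d < \<theta> w y\<close> by simp
    qed
    then show ?thesis using vy by simp
  next
    case False
    have wy: "\<theta> w y = y" using cd[OF y] False by force
    have "\<theta> w (\<theta> v y) = \<theta> v y"
    proof (rule ccontr)
      assume ne: "\<theta> w (\<theta> v y) \<noteq> \<theta> v y"
      have s: "lo x0 < \<theta> v y" "\<theta> v y < hi x0" using stays[OF g0(1,2) vH y] by auto
      have "\<theta> v y \<le> d" using cd[OF s ne] by simp
      then have "\<theta> v (\<theta> v y) = \<theta> v y" using v_d[OF s] by force
      then have "\<theta> v y = y" using eq_iff[OF vH] by blast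
      then show False using False \<open>\<theta> v y \<le> d\<close> by simp
    qed
    then show ?thesis using wy by simp
  qed
  define u where "u = w \<otimes> v \<otimes> inv (v \<otimes> w)"
  have u: "germ_trivial u" unfolding u_def by (rule commutator_germ_trivial[OF wH vH])
  have uH: "u \<in> H" using u by (simp add: germ_trivial_def)
  have u_fix: "\<theta> u y = y" if "\<theta> w (\<theta> v z) = \<theta> v (\<theta> w z)" "z = \<theta> (inv (v \<otimes> w)) y" for y z
  proof -
    have k: "inv (v \<otimes> w) \<in> H" "v \<otimes> w \<in> H" using vH wH by blast+
    have "\<theta> u y = \<theta> w (\<theta> v z)" unfolding u_def using that(2) k wH vH by (simp add: mult)
    also have "\<dots> = \<theta> (v \<otimes> w) z" using that(1) vH wH by (simp add: mult)
    also have "\<dots> = y" using inv_cancel(2)[OF k(2)] that(2) by simp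
    finally show ?thesis .
  qed
  have k: "inv (v \<otimes> w) \<in> H" using vH wH by blast
  have "lo ` supp u \<subseteq> lo ` supp w - {lo x0}"
  proof clarify
    fix y assume y: "y \<in> supp u"
    have y': "y \<in> {p..q}" "y \<notin> Fix" using supp_not_Fix[OF uH y] by blast+
    note gy = gap[OF y']
    have moved: "\<exists>t. lo y < t \<and> t < hi y \<and> \<theta> w t \<noteq> t"
    proof (rule ccontr)
      assume none: "\<not> ?thesis"
      let ?z = "\<theta> (inv (v \<otimes> w)) y"
      have fixw: "\<theta> w t = t" if "lo y < t" "t < hi y" for t using none that by blast
      have fixv: "\<theta> v t = t" if "lo y < t" "t < hi y" for t
        unfolding v_fix using fixw stays[OF gy(1,2) _ that, of "inv h"] h(1) by blast
      have z: "lo y < ?z" "?z < hi y" using stays[OF gy(1,2) k gy(3,4)] by auto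
      have "\<theta> u y = y" by (rule u_fix[of ?z]) (simp_all add: fixw[OF z] fixv[OF z])
      then show False using y by (simp add: supp_def)
    qed
    then obtain t where t: "lo y < t" "t < hi y" "\<theta> w t \<noteq> t" by blast
    then have "t \<in> supp w" "lo t = lo y" using lo_eqI[OF y' t(1,2)] by (auto simp: supp_def)
    moreover have "lo y \<noteq> lo x0"
    proof
      assume eq: "lo y = lo x0"
      have "hi y = hi x0" using gy(5)[OF g0(2)] g0(5)[OF gy(2)] gy(3,4) g0(3,4) eq by linarith
      then have z: "lo x0 < \<theta> (inv (v \<otimes> w)) y" "\<theta> (inv (v \<otimes> w)) y < hi x0"
        using stays[OF gy(1,2) k gy(3,4)] eq by auto
      have "\<theta> u y = y" by (rule u_fix[OF comm0[OF z] refl])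
      then show False using y by (simp add: supp_def)
    qed
    ultimately show "lo y \<in> lo ` supp w - {lo x0}" by (metis DiffI image_eqI singletonD)
  qed
  then have "card (lo ` supp u) \<le> card (lo ` supp w - {lo x0})"
    using finite_gaps w by (intro card_mono) auto
  also have "\<dots> < card (lo ` supp w)" using finite_gaps w x0 by (intro card_Diff1_less) auto
  finally have "u = \<one>" using least[of u] u by force
  then have "w \<otimes> v = v \<otimes> w"
    unfolding u_def using vH wH H.mem_carrier by (metis inv_solve_right' l_one m_closed one_closed)
  moreover have x1: "lo x0 < \<theta> h x0" "\<theta> h x0 < hi x0" using stays[OF g0(1,2) h(1) g0(3,4)] by auto
  have "d < \<theta> h x0" using h(2) x0cd(1) le_iff[OF h(1), of c x0] by simp
  then have "\<theta> w (\<theta> h x0) = \<theta> h x0" using cd[OF x1] by force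
  moreover have "\<theta> v (\<theta> h x0) \<noteq> \<theta> h x0"
    unfolding v_fix using inv_cancel(1)[OF h(1)] x0 by (simp add: supp_def)
  ultimately show ?thesis using vH wH w by metis
qed

lemma power_fixes: "w \<in> H \<Longrightarrow> \<theta> w x = x \<Longrightarrow> \<theta> (w [^] (n::int)) x = x"
proof -
  assume w: "w \<in> H" "\<theta> w x = x"
  have nat: "\<theta> (u [^] n) x = x \<and> u [^] n \<in> H" if "u \<in> H" "\<theta> u x = x" for u and n :: nat
    by (induction n) (use that in \<open>auto simp: one mult\<close>)
  have "\<theta> (inv w) x = x" using inv_cancel(1)[OF w(1), of x] w(2) by simp
  then have i: "\<theta> (inv w [^] n) x = x" for n :: nat using nat[of "inv w"] w by blast
  obtain m :: nat where "n = int m \<or> n = - int m" by (metis int_cases2)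
  then show ?thesis using nat[OF w, of m] i[of m] w by (auto simp: int_pow_int int_pow_neg nat_pow_inv)
qed

lemma power_moves: "v \<in> H \<Longrightarrow> \<theta> v x \<noteq> x \<Longrightarrow> k > 0 \<Longrightarrow> \<theta> (v [^] (k::nat)) x \<noteq> x"
proof -
  assume v: "v \<in> H" "\<theta> v x \<noteq> x" and k: "k > 0"
  have pow: "v [^] n \<in> H" for n :: nat by (induction n) (use v in auto)
  show ?thesis
  proof (cases "x < \<theta> v x")
    case True
    have "x < \<theta> (v [^] Suc n) x" for n
    proof (induction n)
      case (Suc n)
      have "\<theta> (v [^] Suc n) x < \<theta> (v [^] Suc n) (\<theta> v x)" using less_iff[OF pow] True by blast
      then show ?case using Suc pow[of "Suc n"] v(1) by (simp add: mult)
    qed (use True v in simp)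
    then show ?thesis using k by (metis gr0_conv_Suc order_less_irrefl)
  next
    case False
    then have L: "\<theta> v x < x" using v by simp
    have "\<theta> (v [^] Suc n) x < x" for n
    proof (induction n)
      case (Suc n)
      have "\<theta> (v [^] Suc n) (\<theta> v x) < \<theta> (v [^] Suc n) x" using less_iff[OF pow] L by blast
      then show ?case using Suc pow[of "Suc n"] v(1) by (simp add: mult)
    qed (use L v in simp)
    then show ?thesis using k by (metis gr0_conv_Suc order_less_irrefl)
  qed
qed

text \<open>
  Otherwise a positive power of \<open>v\<close> is a power of \<open>w\<close>. But \<open>w\<close> and its powers fix a point that every
  positive power of the increasing map \<open>v\<close> moves.
\<close>

theorem hyperbolic_commutative:
  assumes "torsion_free G" "word_hyperbolic G" "f \<in> H" "g \<in> H"
  shows "f \<otimes> g = g \<otimes> f"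
proof (rule ccontr)
  assume "f \<otimes> g \<noteq> g \<otimes> f"
  then obtain v w x where vw: "v \<in> H" "w \<in> H" "v \<otimes> w = w \<otimes> v" "w \<noteq> \<one>" "\<theta> w x = x" "\<theta> v x \<noteq> x"
    using noncommuting_imp_disjoint_commuting[OF assms(3,4)] by auto
  obtain M :: nat where "\<forall>x\<in>carrier G. w \<otimes> x = x \<otimes> w \<longrightarrow> (\<exists>k\<in>{1..M}. \<exists>n::int. x [^] k = w [^] n)"
    using hyperbolic_commensurable[OF is_group assms(1,2) H.mem_carrier[OF vw(2)] vw(4)] by blast
  then obtain k and n :: int where k: "k \<in> {1..M}" "v [^] k = w [^] n"
    using H.mem_carrier[OF vw(1)] vw(3)[symmetric] by blast
  have "\<theta> (v [^] k) x = x" unfolding k(2) by (rule power_fixes[OF vw(2,5)])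
  moreover have "\<theta> (v [^] k) x \<noteq> x" using power_moves[OF vw(1,6)] k(1) by simp
  ultimately show False by blast
qed

end

section \<open>Piecewise linear functions with prescribed jumps\<close>

lemma locally_constant_real:
  fixes f :: "real \<Rightarrow> real"
  assumes "\<And>x. \<exists>\<epsilon>>0. \<forall>y. \<bar>y - x\<bar> < \<epsilon> \<longrightarrow> f y = f x"
  shows "f x = f y"
proof -
  have "(f has_real_derivative 0) (at x)" for x
  proof -
    obtain \<epsilon> where e: "\<epsilon> > 0" "\<And>y. \<bar>y - x\<bar> < \<epsilon> \<Longrightarrow> f y = f x" using assms[of x] by blast
    have "((\<lambda>_. f x) has_real_derivative 0) (at x)" by simp
    then show ?thesis
      by (rule has_field_derivative_transform_within_open[where S = "ball x \<epsilon>"])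
        (rule open_ball, use e(1) in simp, rule e(2)[symmetric], simp add: dist_real_def abs_minus_commute)
  qed
  then show ?thesis by (intro DERIV_isconst_all) blast
qed

lemma has_slopes_near:
  assumes "has_slopes f x a b"
  shows "\<exists>\<epsilon>>0. \<forall>y. \<bar>y - x\<bar> < \<epsilon> \<longrightarrow> f y = f x + (if x \<le> y then b else a) * (y - x) \<and>
    (x < y \<longrightarrow> has_slopes f y b b) \<and> (y < x \<longrightarrow> has_slopes f y a a)"
proof -
  obtain \<epsilon> where e: "\<epsilon> > 0" "\<And>y. \<bar>y - x\<bar> < \<epsilon> \<Longrightarrow> f y = f x + (if x \<le> y then b else a) * (y - x)" and ab: "a * b > 0"
    using assms unfolding has_slopes_def by blast
  then have sq: "a * a > 0" "b * b > 0" by (auto simp: zero_less_mult_iff)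
  have "has_slopes f y s s"
    if y: "\<bar>y - x\<bar> < \<epsilon>" "y \<noteq> x" and s: "s = (if x \<le> y then b else a)" for y s
    unfolding has_slopes_def if_cancel
  proof (intro conjI exI[of _ "min \<bar>y - x\<bar> (\<epsilon> - \<bar>y - x\<bar>)"] allI impI)
    show "s * s > 0" using sq s by simp
    fix z assume z: "\<bar>z - y\<bar> < min \<bar>y - x\<bar> (\<epsilon> - \<bar>y - x\<bar>)"
    then have "\<bar>z - x\<bar> < \<epsilon>" "x \<le> z \<longleftrightarrow> x \<le> y" by linarith+
    then have "f z = f x + s * (z - x)" "f y = f x + s * (y - x)" using e(2)[of z] e(2)[of y] y s by simp_all
    then show "f z = f y + s * (z - y)" by (simp add: algebra_simps)
  qed (use y in auto)
  note slope = this
  show ?thesis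
  proof (intro exI[of _ \<epsilon>] conjI allI impI)
    fix y assume y: "\<bar>y - x\<bar> < \<epsilon>"
    show "f y = f x + (if x \<le> y then b else a) * (y - x)" by (rule e(2)[OF y])
    show "has_slopes f y b b" if "x < y" using slope[OF y, of b] that by simp
    show "has_slopes f y a a" if "y < x" using slope[OF y, of a] that by simp
  qed (rule e(1))
qed

text \<open>
  The quotient of the slopes of \<open>f\<close> and \<open>g\<close> is the same on both sides of every point, so it is locally
  constant, hence equal to a constant \<open>A\<close>. Then \<open>f - A g\<close> is locally constant.
\<close>

lemma same_jumps_affine:
  assumes f: "\<And>x. \<exists>a b. has_slopes f x a b \<and> a > 0" and g: "\<And>x. \<exists>a b. has_slopes g x a b \<and> a > 0"
    and jumps: "\<And>x. slope_jump f x = slope_jump g x"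
  shows "\<exists>A B. \<forall>x. f x = A * g x + B"
proof -
  obtain fa fb where fs: "\<And>x. has_slopes f x (fa x) (fb x)" "\<And>x. fa x > 0" using f by metis
  obtain ga gb where gs: "\<And>x. has_slopes g x (ga x) (gb x)" "\<And>x. ga x > 0" using g by metis
  have pos: "fb x > 0" "gb x > 0" for x
    using fs(1)[of x] fs(2)[of x] gs(1)[of x] gs(2)[of x] unfolding has_slopes_def by (auto simp: zero_less_mult_iff)
  have ratio: "fa x / ga x = fb x / gb x" for x
  proof -
    have "ln (fb x / fa x) = ln (gb x / ga x)"
      using jumps[of x] slope_jump_eq[OF fs(1)] slope_jump_eq[OF gs(1)] by simp
    then have "fb x / fa x = gb x / ga x" using pos fs(2) gs(2) by (subst (asm) ln_inj_iff) auto
    then show ?thesis using pos[of x] fs(2)[of x] gs(2)[of x] by (simp add: field_simps)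
  qed
  define R where "R x = fb x / gb x" for x
  have near: "\<exists>\<epsilon>>0. \<forall>y. \<bar>y - x\<bar> < \<epsilon> \<longrightarrow> R y = R x \<and> f y - R x * g y = f x - R x * g x" for x
  proof -
    obtain e1 where e1: "e1 > 0" "\<And>y. \<bar>y - x\<bar> < e1 \<Longrightarrow> f y = f x + (if x \<le> y then fb x else fa x) * (y - x) \<and>
        (x < y \<longrightarrow> has_slopes f y (fb x) (fb x)) \<and> (y < x \<longrightarrow> has_slopes f y (fa x) (fa x))"
      using has_slopes_near[OF fs(1)] by blast
    obtain e2 where e2: "e2 > 0" "\<And>y. \<bar>y - x\<bar> < e2 \<Longrightarrow> g y = g x + (if x \<le> y then gb x else ga x) * (y - x) \<and>
        (x < y \<longrightarrow> has_slopes g y (gb x) (gb x)) \<and> (y < x \<longrightarrow> has_slopes g y (ga x) (ga x))"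
      using has_slopes_near[OF gs(1)] by blast
    have "R y = R x \<and> f y - R x * g y = f x - R x * g x" if y: "\<bar>y - x\<bar> < min e1 e2" for y
    proof -
      have m: "\<bar>y - x\<bar> < e1" "\<bar>y - x\<bar> < e2" using y by auto
      have Rb: "R x * gb x = fb x" "R x * ga x = fa x"
      proof -
        show "R x * gb x = fb x" using pos(2)[of x] by (simp add: R_def)
        show "R x * ga x = fa x" using gs(2)[of x] by (simp add: R_def ratio[symmetric])
      qed
      consider "x < y" | "y < x" | "x = y" by linarith
      then show ?thesis
      proof cases
        case 1
        then have "fb y = fb x" "gb y = gb x"
          using e1(2)[OF m(1)] e2(2)[OF m(2)] has_slopes_unique fs(1) gs(1) by blast+
        then have "R y = R x" by (simp add: R_def)
        moreover have fg: "f y = f x + R x * gb x * (y - x)" "g y = g x + gb x * (y - x)"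
          using e1(2)[OF m(1)] e2(2)[OF m(2)] 1 by (simp_all add: Rb)
        have "f y - R x * g y = f x - R x * g x" unfolding fg by (simp add: algebra_simps)
        ultimately show ?thesis by blast
      next
        case 2
        have *: "fb y = fa x" "gb y = ga x"
          using e1(2)[OF m(1)] e2(2)[OF m(2)] has_slopes_unique fs(1) gs(1) 2 by blast+
        have fg: "f y = f x + R x * ga x * (y - x)" "g y = g x + ga x * (y - x)"
          using e1(2)[OF m(1)] e2(2)[OF m(2)] 2 by (simp_all add: Rb)
        have "f y - R x * g y = f x - R x * g x" unfolding fg by (simp add: algebra_simps)
        moreover have "R y = R x" using * ratio[of x] by (simp add: R_def)
        ultimately show ?thesis by blast
      qed auto
    qed
    moreover have "min e1 e2 > 0" using e1(1) e2(1) by simp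
    ultimately show ?thesis by blast
  qed
  have R: "R x = R 0" for x by (rule locally_constant_real) (use near in meson)
  have "f x - R 0 * g x = f 0 - R 0 * g 0" for x
  proof (rule locally_constant_real[of "\<lambda>x. f x - R 0 * g x"])
    fix x show "\<exists>\<epsilon>>0. \<forall>y. \<bar>y - x\<bar> < \<epsilon> \<longrightarrow> f y - R 0 * g y = f x - R 0 * g x"
      using near[of x] unfolding R[of x] by meson
  qed
  then have "f x = R 0 * g x + (f 0 - R 0 * g 0)" for x by (metis add.commute diff_add_cancel)
  then show ?thesis by blast
qed

lemma positive_slopes_strict_mono:
  assumes slopes: "\<And>x. \<exists>a b. has_slopes f x a b \<and> a > 0"
  shows "strict_mono f"
proof (rule strict_monoI, rule ccontr)
  fix x y :: real assume xy: "x < y" and neg: "\<not> f x < f y"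
  have right: "\<exists>\<epsilon>>0. \<forall>t. x < t \<and> t < x + \<epsilon> \<longrightarrow> f x < f t" for x
  proof -
    obtain a b where ab: "has_slopes f x a b" "a > 0" using slopes by blast
    then obtain \<epsilon> where e: "\<epsilon> > 0" "\<And>y. \<bar>y - x\<bar> < \<epsilon> \<Longrightarrow> f y = f x + (if x \<le> y then b else a) * (y - x)" "b > 0"
      unfolding has_slopes_def by (auto simp: zero_less_mult_iff)
    have "f x < f t" if "x < t \<and> t < x + \<epsilon>" for t using e(2)[of t] e(3) that by simp
    then show ?thesis using e(1) by blast
  qed
  have "isCont f x" for x
  proof -
    obtain a b where ab: "has_slopes f x a b" "a > 0" using slopes by blast
    then obtain \<epsilon> where e: "\<epsilon> > 0" "\<And>y. \<bar>y - x\<bar> < \<epsilon> \<Longrightarrow> f y = f x + (if x \<le> y then b else a) * (y - x)"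
      unfolding has_slopes_def by blast
    have "isCont (\<lambda>y. f x + (b * max 0 (y - x) + a * min 0 (y - x))) x" by (intro continuous_intros)
    moreover have "\<forall>\<^sub>F y in nhds x. f y = f x + (b * max 0 (y - x) + a * min 0 (y - x))"
      unfolding eventually_nhds_metric
    proof (intro exI[of _ \<epsilon>] conjI allI impI)
      fix y assume "dist y x < \<epsilon>"
      then show "f y = f x + (b * max 0 (y - x) + a * min 0 (y - x))"
        using e(2)[of y] by (simp add: dist_real_def max_def min_def split: if_splits)
    qed (rule e(1))
    then have "isCont f x = isCont (\<lambda>y. f x + (b * max 0 (y - x) + a * min 0 (y - x))) x" by (rule isCont_cong)
    ultimately show ?thesis by simp
  qed
  then have "continuous_on {x..y} f" by (simp add: continuous_at_imp_continuous_on)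
  then obtain m where m: "m \<in> {x..y}" "\<And>t. t \<in> {x..y} \<Longrightarrow> f t \<le> f m"
    using continuous_attains_sup[of "{x..y}" f] xy by auto
  show False
  proof (cases "m = y")
    case False
    obtain \<epsilon> where e: "\<epsilon> > 0" "\<And>t. m < t \<Longrightarrow> t < m + \<epsilon> \<Longrightarrow> f m < f t" using right[of m] by blast
    define t where "t = m + min \<epsilon> (y - m) / 2"
    have "m < t" "t < m + \<epsilon>" "t \<le> y" using e(1) m(1) False by (auto simp: t_def min_def field_simps)
    then show False using e(2)[of t] m(2)[of t] m(1) by auto
  next
    case True
    obtain \<epsilon> where e: "\<epsilon> > 0" "\<And>t. x < t \<Longrightarrow> t < x + \<epsilon> \<Longrightarrow> f x < f t" using right[of x] by blast
    define t where "t = x + min \<epsilon> (y - x) / 2"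
    have "x < t" "t < x + \<epsilon>" "t \<le> y" using e(1) xy by (auto simp: t_def min_def field_simps)
    then show False using e(2)[of t] m(2)[of t] True neg by auto
  qed
qed

text \<open>
  A step function on the line with jump \<open>g p\<close> at each \<open>p\<close>, normalised to vanish at \<open>0\<close>. It replaces an
  integral over the locally finite set where \<open>g\<close> does not vanish.
\<close>

definition signed_sum :: "(real \<Rightarrow> real) \<Rightarrow> real \<Rightarrow> real"
  where "signed_sum g x = (\<Sum>p | 0 < p \<and> p \<le> x \<and> g p \<noteq> 0. g p) - (\<Sum>p | x < p \<and> p \<le> 0 \<and> g p \<noteq> 0. g p)"

lemma signed_sum_add:
  assumes fin: "\<And>x y. finite {p. x < p \<and> p \<le> y \<and> g p \<noteq> 0}" and "x \<le> y"
  shows "signed_sum g y = signed_sum g x + (\<Sum>p | x < p \<and> p \<le> y \<and> g p \<noteq> 0. g p)"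
proof -
  define I where "I a b = (\<Sum>p | a < p \<and> p \<le> b \<and> g p \<noteq> 0. g p)" for a b
  have split: "I a c = I a b + I b c" if "a \<le> b" "b \<le> c" for a b c
  proof -
    have "{p. a < p \<and> p \<le> c \<and> g p \<noteq> 0} = {p. a < p \<and> p \<le> b \<and> g p \<noteq> 0} \<union> {p. b < p \<and> p \<le> c \<and> g p \<noteq> 0}"
      using that by auto
    then show ?thesis unfolding I_def by (simp add: sum.union_disjoint[OF fin fin] disjoint_iff)
  qed
  have empty: "I b a = 0" if "a \<le> b" for a b
  proof -
    have "{p. b < p \<and> p \<le> a \<and> g p \<noteq> 0} = {}" using that by auto
    then show ?thesis unfolding I_def by simp
  qed
  have s: "signed_sum g x = I 0 x - I x 0" for x by (simp add: signed_sum_def I_def)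
  consider "0 \<le> x" | "x \<le> 0" "0 \<le> y" | "y \<le> 0" by linarith
  then have "signed_sum g y = signed_sum g x + I x y"
  proof cases
    case 1
    then show ?thesis using split[of 0 x y] 1 empty[of 0 x] empty[of 0 y] \<open>x \<le> y\<close> by (simp add: s)
  next
    case 2
    then show ?thesis using split[of x 0 y] 2 empty[of x 0] empty[of 0 y] by (simp add: s)
  next
    case 3
    then show ?thesis using split[of x y 0] 3 empty[of x 0] empty[of y 0] \<open>x \<le> y\<close> by (simp add: s)
  qed
  then show ?thesis by (simp add: I_def)
qed

lemma signed_sum_local:
  assumes fin: "\<And>x y. finite {p. x < p \<and> p \<le> y \<and> g p \<noteq> 0}"
    and isolated: "\<And>y. 0 < \<bar>y - x\<bar> \<Longrightarrow> \<bar>y - x\<bar> < \<epsilon> \<Longrightarrow> g y = 0" and y: "\<bar>y - x\<bar> < \<epsilon>"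
  shows "signed_sum g y = signed_sum g x - (if x \<le> y then 0 else g x)"
proof (cases "x \<le> y")
  case True
  have "{p. x < p \<and> p \<le> y \<and> g p \<noteq> 0} = {}"
  proof -
    have "g p = 0" if "x < p" "p \<le> y" for p using isolated[of p] that y by simp
    then show ?thesis by auto
  qed
  then show ?thesis using signed_sum_add[OF fin True] True by simp
next
  case False
  have "g p = 0" if "y < p" "p \<le> x" "p \<noteq> x" for p using isolated[of p] that y by simp
  then have "{p. y < p \<and> p \<le> x \<and> g p \<noteq> 0} = (if g x = 0 then {} else {x})" using False by auto
  then show ?thesis using signed_sum_add[OF fin, of y x] False by (simp split: if_splits)
qed

text \<open>
  The logarithm of the slope of \<open>\<psi>\<close> has to be a step function with jumps \<open>- F p\<close>, so let \<open>v\<close> be the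
  exponential of such a step function. The slope \<open>v\<close> itself jumps by \<open>w p = v p - v p exp (F p)\<close> at \<open>p\<close>, since
  \<open>v p exp (F p)\<close> is its value on the left of \<open>p\<close>. So \<open>\<psi>\<close> is \<open>x\<close> plus the signed sum of the ramps
  \<open>w p (x - p)\<close>.
\<close>

lemma prescribed_jumps:
  fixes F :: "real \<Rightarrow> real"
  assumes fin: "\<And>x y. finite {p. x < p \<and> p \<le> y \<and> F p \<noteq> 0}"
    and isolated: "\<And>x. \<exists>\<epsilon>>0. \<forall>y. 0 < \<bar>y - x\<bar> \<and> \<bar>y - x\<bar> < \<epsilon> \<longrightarrow> F y = 0"
  shows "\<exists>\<psi>. \<forall>x. \<exists>a b. has_slopes \<psi> x a b \<and> a > 0 \<and> slope_jump \<psi> x = - F x"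
proof -
  define v where "v x = exp (- signed_sum F x)" for x
  define w where "w p = v p - v p * exp (F p)" for p
  define V where "V x = 1 + signed_sum w x" for x
  define Q where "Q = signed_sum (\<lambda>p. w p * p)"
  define \<psi> where "\<psi> x = V x * x - Q x" for x
  have w0: "w p = 0" if "F p = 0" for p using that by (simp add: w_def)
  have finw: "finite {p. x < p \<and> p \<le> y \<and> w p \<noteq> 0}" "finite {p. x < p \<and> p \<le> y \<and> w p * p \<noteq> 0}" for x y
    by (rule finite_subset[OF _ fin[of x y]], use w0 in auto)+
  have near: "\<exists>\<epsilon>>0. \<forall>y. \<bar>y - x\<bar> < \<epsilon> \<longrightarrow> v y = v x * (if x \<le> y then 1 else exp (F x)) \<and>
      V y = V x - (if x \<le> y then 0 else w x) \<and> Q y = Q x - (if x \<le> y then 0 else w x * x)" for x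
  proof -
    obtain \<epsilon> where e: "\<epsilon> > 0" "\<And>y. 0 < \<bar>y - x\<bar> \<Longrightarrow> \<bar>y - x\<bar> < \<epsilon> \<Longrightarrow> F y = 0" using isolated[of x] by blast
    have "v y = v x * (if x \<le> y then 1 else exp (F x)) \<and>
      V y = V x - (if x \<le> y then 0 else w x) \<and> Q y = Q x - (if x \<le> y then 0 else w x * x)"
      if y: "\<bar>y - x\<bar> < \<epsilon>" for y
    proof (intro conjI)
      have "signed_sum F y = signed_sum F x - (if x \<le> y then 0 else F x)"
        by (rule signed_sum_local[OF fin e(2) y])
      then show "v y = v x * (if x \<le> y then 1 else exp (F x))" by (simp add: v_def exp_add[symmetric])
      show "V y = V x - (if x \<le> y then 0 else w x)"
        using signed_sum_local[OF finw(1) w0[OF e(2)] y] by (simp add: V_def)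
      have "w y * y = 0" if "0 < \<bar>y - x\<bar>" "\<bar>y - x\<bar> < \<epsilon>" for y using w0[OF e(2)[OF that]] by simp
      from signed_sum_local[OF finw(2) this y] show "Q y = Q x - (if x \<le> y then 0 else w x * x)"
        by (simp add: Q_def)
    qed
    then show ?thesis using e(1) by blast
  qed
  have "v x - V x = v 0 - V 0" for x
  proof (rule locally_constant_real[of "\<lambda>x. v x - V x"])
    fix x
    obtain \<epsilon> where e: "\<epsilon> > 0" "\<And>y. \<bar>y - x\<bar> < \<epsilon> \<Longrightarrow> v y = v x * (if x \<le> y then 1 else exp (F x)) \<and>
      V y = V x - (if x \<le> y then 0 else w x)" using near[of x] by blast
    have "v y - V y = v x - V x" if "\<bar>y - x\<bar> < \<epsilon>" for y
      using e(2)[OF that] by (simp add: w_def split: if_splits)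
    then show "\<exists>\<epsilon>>0. \<forall>y. \<bar>y - x\<bar> < \<epsilon> \<longrightarrow> v y - V y = v x - V x" using e(1) by blast
  qed
  moreover have "signed_sum g 0 = 0" for g
  proof -
    have "{p::real. 0 < p \<and> p \<le> 0 \<and> g p \<noteq> 0} = {}" by auto
    then show ?thesis by (simp add: signed_sum_def)
  qed
  ultimately have vV: "V x = v x" for x by (simp add: v_def V_def)
  have vpos: "v x > 0" for x by (simp add: v_def)
  have "has_slopes \<psi> x (v x * exp (F x)) (v x)" for x
  proof -
    obtain \<epsilon> where e: "\<epsilon> > 0" "\<And>y. \<bar>y - x\<bar> < \<epsilon> \<Longrightarrow>
      V y = V x - (if x \<le> y then 0 else w x) \<and> Q y = Q x - (if x \<le> y then 0 else w x * x)" using near[of x] by blast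
    have "\<psi> y = \<psi> x + (if x \<le> y then v x else v x * exp (F x)) * (y - x)" if "\<bar>y - x\<bar> < \<epsilon>" for y
    proof (cases "x \<le> y")
      case True
      then have "V y = v x" "Q y = Q x" using e(2)[OF that] vV[of x] by auto
      then show ?thesis using True by (simp add: \<psi>_def vV algebra_simps)
    next
      case False
      then have "V y = v x - w x" "Q y = Q x - w x * x" using e(2)[OF that] vV[of x] by auto
      then show ?thesis using False by (simp add: \<psi>_def vV[of x] w_def algebra_simps)
    qed
    moreover have "v x * exp (F x) * v x > 0" using vpos[of x] by simp
    ultimately show ?thesis unfolding has_slopes_def using e(1) by blast
  qed
  moreover have "ln (v x / (v x * exp (F x))) = - F x" for x
    using vpos[of x] by (simp add: ln_div)
  moreover have "v x * exp (F x) > 0" for x using vpos[of x] by simp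
  ultimately have "has_slopes \<psi> x (v x * exp (F x)) (v x) \<and> v x * exp (F x) > 0 \<and> slope_jump \<psi> x = - F x" for x
    using slope_jump_eq[of \<psi> x "v x * exp (F x)" "v x"] by metis
  then show ?thesis by blast
qed

section \<open>Actions on the circle\<close>

locale PL_action = group G for G :: "('g, 'b) monoid_scheme" (structure) +
  fixes \<rho> :: "'g \<Rightarrow> circle \<Rightarrow> circle"
  assumes mon: "\<rho> \<in> mon G PL_circle"
begin

lemma \<rho>_PL: "g \<in> carrier G \<Longrightarrow> \<rho> g \<in> carrier PL_circle"
  using mon by (auto simp: mon_def hom_def)

lemma \<rho>_mult: "\<lbrakk>g \<in> carrier G; h \<in> carrier G\<rbrakk> \<Longrightarrow> \<rho> (g \<otimes> h) = \<rho> g \<circ> \<rho> h"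
  using mon by (auto simp: mon_def hom_def PL_circle_def)

lemma \<rho>_inject: "\<lbrakk>g \<in> carrier G; h \<in> carrier G; \<rho> g = \<rho> h\<rbrakk> \<Longrightarrow> g = h"
  using mon by (auto simp: mon_def inj_on_def)

lemma \<rho>_homeo: "g \<in> carrier G \<Longrightarrow> continuous_on UNIV (\<rho> g) \<and> inj (\<rho> g)"
  using \<rho>_PL[of g] unfolding PL_circle_def homeomorphism_def by (auto intro: inj_on_inverseI)

lemma \<rho>_one: "\<rho> \<one> = id"
proof -
  have "\<rho> \<one> (\<rho> \<one> c) = \<rho> \<one> c" for c using \<rho>_mult[of \<one> \<one>] by (simp add: fun_eq_iff)
  then show ?thesis using \<rho>_homeo[of \<one>] by (auto simp: fun_eq_iff dest: injD)
qed

lemma \<rho>_inv: "g \<in> carrier G \<Longrightarrow> \<rho> (inv g) (\<rho> g c) = c" "g \<in> carrier G \<Longrightarrow> \<rho> g (\<rho> (inv g) c) = c"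
  using \<rho>_mult[of "inv g" g] \<rho>_mult[of g "inv g"] \<rho>_one by (auto simp: fun_eq_iff)

definition \<Theta> where "\<Theta> g = (SOME \<theta>. is_lift (\<rho> g) \<theta>)"

lemma \<Theta>: "g \<in> carrier G \<Longrightarrow> is_lift (\<rho> g) (\<Theta> g)"
  unfolding \<Theta>_def using lift_exists[OF conjunct1[OF \<rho>_homeo]] by (rule someI_ex)

lemma circle_of_\<Theta>: "g \<in> carrier G \<Longrightarrow> circle_of (\<Theta> g x) = \<rho> g (circle_of x)"
  using \<Theta> by (simp add: is_lift_def)

definition orient where "orient g = \<Theta> g 1 - \<Theta> g 0"

lemma orient_cases:
  assumes "g \<in> carrier G"
  obtains "orient g = 1" "strict_mono (\<Theta> g)" "\<And>x. \<Theta> g (x + 1) = \<Theta> g x + 1"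
  | "orient g = -1" "strict_mono (\<lambda>x. - \<Theta> g x)" "\<And>x. \<Theta> g (x + 1) = \<Theta> g x - 1"
proof -
  have "\<Theta> g 1 = \<Theta> g (0 + 1)" by simp
  then have "orient g = 1" if "\<forall>x. \<Theta> g (x + 1) = \<Theta> g x + 1"
    using spec[OF that, of 0] unfolding orient_def by simp
  moreover have "orient g = -1" if "\<forall>x. \<Theta> g (x + 1) = \<Theta> g x - 1"
    using spec[OF that, of 0] unfolding orient_def by simp
  ultimately show ?thesis
    using lift_degree[OF \<Theta>[OF assms] conjunct2[OF \<rho>_homeo[OF assms]]] that by blast
qed

lemma \<Theta>_translate: "g \<in> carrier G \<Longrightarrow> \<Theta> g (x + 1) = \<Theta> g x + orient g"
  by (rule orient_cases) auto

lemma \<Theta>_translate_int: "g \<in> carrier G \<Longrightarrow> \<Theta> g (x + of_int k) = \<Theta> g x + of_int k * orient g"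
proof (induction k rule: int_induct[where k = 0])
  case (step1 i)
  then show ?case using \<Theta>_translate[of g "x + of_int i"] by (simp add: algebra_simps)
next
  case (step2 i)
  then show ?case using \<Theta>_translate[of g "x + of_int (i - 1)"] by (simp add: algebra_simps)
qed simp

lemma \<Theta>_mult:
  assumes "g \<in> carrier G" "h \<in> carrier G"
  shows "\<exists>k::int. \<forall>x. \<Theta> (g \<otimes> h) x = \<Theta> g (\<Theta> h x) + of_int k"
proof -
  have "is_lift (\<rho> (g \<otimes> h)) (\<Theta> g \<circ> \<Theta> h)"
    unfolding \<rho>_mult[OF assms] using assms by (intro lift_compose \<Theta>)
  from lift_unique[OF this \<Theta>] assms show ?thesis by simp
qed

lemma orient_square: "g \<in> carrier G \<Longrightarrow> orient g * orient g = 1"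
  by (rule orient_cases) auto

lemma orient_mult:
  assumes "g \<in> carrier G" "h \<in> carrier G"
  shows "orient (g \<otimes> h) = orient g * orient h"
proof -
  obtain k :: int where k: "\<And>x. \<Theta> (g \<otimes> h) x = \<Theta> g (\<Theta> h x) + of_int k" using \<Theta>_mult[OF assms] by blast
  have "\<Theta> h 1 = \<Theta> h 0 + orient h" by (simp add: orient_def)
  moreover obtain l :: int where l: "orient h = of_int l"
    using orient_cases[OF assms(2)] by (metis of_int_1 of_int_minus)
  ultimately have "\<Theta> g (\<Theta> h 1) = \<Theta> g (\<Theta> h 0) + orient h * orient g"
    using \<Theta>_translate_int[OF assms(1), of "\<Theta> h 0" l] by simp
  then show ?thesis using k[of 1] k[of 0] by (simp add: orient_def[of "g \<otimes> h"] mult.commute)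
qed

lemma orient_one: "orient \<one> = 1"
  using orient_mult[of \<one> \<one>] orient_square[of \<one>] by simp

lemma orient_inv: "g \<in> carrier G \<Longrightarrow> orient (inv g) = orient g"
  using orient_mult[of g "inv g"] orient_one orient_square[of g] by (metis inv_closed mult.left_commute mult.right_neutral r_inv mult.commute)

lemma \<Theta>_slopes:
  assumes "g \<in> carrier G"
  shows "\<exists>F. finite F \<and> (\<forall>x. \<exists>a b. has_slopes (\<Theta> g) x a b \<and> (circle_of x \<notin> F \<longrightarrow> a = b))"
proof -
  obtain F where "finite F" "\<forall>x. circle_of x \<notin> F \<longrightarrow> locally_affine_at (\<rho> g) x"
    using \<rho>_PL[OF assms] unfolding PL_circle_def by auto
  then show ?thesis using lift_has_slopes[OF \<Theta>[OF assms]] \<rho>_homeo[OF assms] by (intro exI[of _ F]) auto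
qed

lemma slopes_orientation:
  assumes "g \<in> carrier G" "has_slopes (\<Theta> g) x a b"
  shows "b > 0 \<longleftrightarrow> orient g = 1"
proof -
  obtain \<epsilon> where e: "\<epsilon> > 0" "\<And>y. \<bar>y - x\<bar> < \<epsilon> \<Longrightarrow> \<Theta> g y = \<Theta> g x + (if x \<le> y then b else a) * (y - x)"
    using assms(2) unfolding has_slopes_def by blast
  have eq: "\<Theta> g (x + \<epsilon> / 2) - \<Theta> g x = b * (\<epsilon> / 2)" using e(2)[of "x + \<epsilon> / 2"] e(1) by simp
  from assms(1) show ?thesis
  proof (cases rule: orient_cases)
    case 1
    then have "\<Theta> g x < \<Theta> g (x + \<epsilon> / 2)" using e(1) by (auto simp: strict_mono_def)
    then have "b * (\<epsilon> / 2) > 0" using eq by simp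
    then show ?thesis using e(1) 1 by (simp add: zero_less_mult_iff)
  next
    case 2
    then have "\<Theta> g (x + \<epsilon> / 2) < \<Theta> g x" using e(1) by (auto simp: strict_mono_def)
    then have "b * (\<epsilon> / 2) < 0" using eq by simp
    then show ?thesis using e(1) 2 by (simp add: mult_less_0_iff)
  qed
qed

definition jump where "jump g c = slope_jump (\<Theta> g) (rep_circle c)"

lemma jump_circle_of: "g \<in> carrier G \<Longrightarrow> jump g (circle_of x) = slope_jump (\<Theta> g) x"
proof -
  assume g: "g \<in> carrier G"
  obtain k :: int where "rep_circle (circle_of x) = x + of_int k"
    using circle_of_eq_iff[of "rep_circle (circle_of x)" x] by auto
  then show ?thesis unfolding jump_def
    using slope_jump_translate[of "\<Theta> g" "of_int k" "of_int k * orient g" x] \<Theta>_translate_int[OF g] by simp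
qed

lemma jump_mult:
  assumes g: "g \<in> carrier G" and h: "h \<in> carrier G"
  shows "jump (g \<otimes> h) c = jump h c + orient h * jump g (\<rho> h c)"
proof (induction c rule: circle.abs_induct)
  fix x
  obtain k :: int where "\<And>x. \<Theta> (g \<otimes> h) x = \<Theta> g (\<Theta> h x) + of_int k" using \<Theta>_mult[OF g h] by blast
  then have "\<Theta> (g \<otimes> h) = (\<lambda>x. (\<Theta> g \<circ> \<Theta> h) x + of_int k)" by auto
  then have "jump (g \<otimes> h) (circle_of x) = slope_jump (\<Theta> g \<circ> \<Theta> h) x"
    using jump_circle_of[of "g \<otimes> h" x] g h by (simp only: slope_jump_shift m_closed)
  moreover obtain a b where ab: "has_slopes (\<Theta> h) x a b" using \<Theta>_slopes[OF h] by blast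
  moreover obtain a' b' where "has_slopes (\<Theta> g) (\<Theta> h x) a' b'" using \<Theta>_slopes[OF g] by blast
  moreover have "(if b > 0 then 1 else -1) = orient h"
    by (rule orient_cases[OF h]) (use slopes_orientation[OF h ab] in auto)
  ultimately show "jump (g \<otimes> h) (circle_of x) = jump h (circle_of x) + orient h * jump g (\<rho> h (circle_of x))"
    using slope_jump_compose[of "\<Theta> h" x a b "\<Theta> g" a' b'] jump_circle_of[OF h] jump_circle_of[OF g]
      circle_of_\<Theta>[OF h, of x, symmetric] by simp
qed

lemma finite_jumps: "g \<in> carrier G \<Longrightarrow> finite {c. jump g c \<noteq> 0}"
proof -
  assume g: "g \<in> carrier G"
  obtain F where F: "finite F" "\<And>x. \<exists>a b. has_slopes (\<Theta> g) x a b \<and> (circle_of x \<notin> F \<longrightarrow> a = b)"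
    using \<Theta>_slopes[OF g] by blast
  have "{c. jump g c \<noteq> 0} \<subseteq> F"
  proof (rule ccontr)
    assume "\<not> ?thesis"
    then obtain c where c: "jump g c \<noteq> 0" "c \<notin> F" by blast
    obtain a b where ab: "has_slopes (\<Theta> g) (rep_circle c) a b" "a = b" using F(2)[of "rep_circle c"] c by auto
    have "a \<noteq> 0" using ab unfolding has_slopes_def by auto
    then show False using c slope_jump_eq[OF ab(1)] ab(2) by (simp add: jump_def)
  qed
  then show ?thesis using F(1) finite_subset by blast
qed

definition stabilizer where "stabilizer c = {g \<in> carrier G. \<rho> g c = c}"
definition positive_stabilizer where "positive_stabilizer c = {g \<in> stabilizer c. orient g = 1}"

lemma subgroup_stabilizer: "subgroup (stabilizer c) G" "subgroup (positive_stabilizer c) G"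
proof -
  have inv: "\<rho> (inv g) c = c" if "g \<in> carrier G" "\<rho> g c = c" for g
    using \<rho>_inv(1)[OF that(1), of c] that(2) by simp
  show "subgroup (stabilizer c) G"
    by unfold_locales (auto simp: stabilizer_def \<rho>_mult \<rho>_one inv)
  show "subgroup (positive_stabilizer c) G"
    by unfold_locales (auto simp: positive_stabilizer_def stabilizer_def \<rho>_mult \<rho>_one inv orient_mult orient_one orient_inv)
qed

text \<open>
  Elements that fix \<open>c\<close> and preserve the orientation have a unique lift that fixes the chosen preimage
  \<open>p\<close> of \<open>c\<close>. Uniqueness makes these lifts compose strictly.
\<close>

lemma interval_action_stabilizer:
  fixes c
  defines "p \<equiv> rep_circle c"
  shows "interval_action G (positive_stabilizer c) (\<lambda>g x. \<Theta> g x + (p - \<Theta> g p)) p (p + 1)"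
proof -
  have H: "g \<in> carrier G" "\<rho> g c = c" "orient g = 1" if "g \<in> positive_stabilizer c" for g
    using that by (auto simp: positive_stabilizer_def stabilizer_def)
  have shift: "\<exists>k::int. p - \<Theta> g p = of_int k" if "g \<in> positive_stabilizer c" for g
  proof -
    have "circle_of p = circle_of (\<Theta> g p)"
      using circle_of_\<Theta>[OF H(1)[OF that], of p] H(2)[OF that] by (simp add: p_def)
    then obtain k :: int where "p = \<Theta> g p + of_int k" unfolding circle_of_eq_iff by blast
    then have "p - \<Theta> g p = of_int k" by linarith
    then show ?thesis by blast
  qed
  show ?thesis
  proof (intro interval_action.intro interval_action_axioms.intro is_group subgroup_stabilizer)
    fix g assume g: "g \<in> positive_stabilizer c"
    note gc = H[OF g]
    show "strict_mono (\<lambda>x. \<Theta> g x + (p - \<Theta> g p))"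
      using gc(1) by (rule orient_cases) (use gc(3) in \<open>auto simp: strict_mono_def\<close>)
    show "continuous_on UNIV (\<lambda>x. \<Theta> g x + (p - \<Theta> g p))"
      using \<Theta>[OF gc(1)] by (intro continuous_intros) (simp add: is_lift_def)
    show "\<exists>a b. has_slopes (\<lambda>x. \<Theta> g x + (p - \<Theta> g p)) x a b" for x
      unfolding has_slopes_shift using \<Theta>_slopes[OF gc(1)] by blast
    show "\<Theta> g p + (p - \<Theta> g p) = p" by simp
    show "\<Theta> g (p + 1) + (p - \<Theta> g p) = p + 1" using \<Theta>_translate[OF gc(1)] gc(3) by simp
    show "\<Theta> (g \<otimes> h) x + (p - \<Theta> (g \<otimes> h) p) = \<Theta> g (\<Theta> h x + (p - \<Theta> h p)) + (p - \<Theta> g p)"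
      if h: "h \<in> positive_stabilizer c" for h x
    proof -
      obtain k :: int where k: "\<And>x. \<Theta> (g \<otimes> h) x = \<Theta> g (\<Theta> h x) + of_int k" using \<Theta>_mult[OF gc(1) H(1)[OF h]] by blast
      obtain l :: int where l: "p - \<Theta> h p = of_int l" using shift[OF h] by blast
      have "\<Theta> g (\<Theta> h y + of_int l) = \<Theta> g (\<Theta> h y) + of_int l" for y
        using \<Theta>_translate_int[OF gc(1), of "\<Theta> h y" l] gc(3) by simp
      from this[of x] this[of p] show ?thesis unfolding k l[symmetric] by simp
    qed
    show "g = \<one>" if fixed: "\<And>x. x \<in> {p..p + 1} \<Longrightarrow> \<Theta> g x + (p - \<Theta> g p) = x"
    proof (rule \<rho>_inject[OF gc(1) one_closed])
      obtain k :: int where k: "p - \<Theta> g p = of_int k" using shift[OF g] by blast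
      have "\<rho> g (circle_of x) = circle_of x" for x
      proof -
        define y where "y = x - of_int \<lfloor>x - p\<rfloor>"
        have "y \<in> {p..p + 1}" unfolding y_def atLeastAtMost_iff by linarith
        then have "\<Theta> g y = y + of_int (- k)" using fixed k by force
        then have "circle_of (\<Theta> g y) = circle_of y" unfolding circle_of_eq_iff by blast
        moreover have "circle_of y = circle_of x" unfolding circle_of_eq_iff y_def
          by (rule exI[of _ "- \<lfloor>x - p\<rfloor>"]) simp
        ultimately show ?thesis using circle_of_\<Theta>[OF gc(1), of y] by simp
      qed
      then have "\<rho> g d = d" for d by (induction d rule: circle.abs_induct)
      then show "\<rho> g = \<rho> \<one>" by (simp add: \<rho>_one fun_eq_iff)
    qed
  qed
qed

end

locale hyperbolic_PL_action = PL_action +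
  assumes tf: "torsion_free G" and hyp: "word_hyperbolic G"
begin

text \<open>
  The orientation preserving part of \<open>H\<close> is cyclic and has index at most 2, so \<open>H\<close> is commutative, and
  therefore cyclic itself.
\<close>

lemma cyclic_if_positive_commutative:
  assumes H: "subgroup H G"
    and comm: "\<And>x y. \<lbrakk>x \<in> H; y \<in> H; orient x = 1; orient y = 1\<rbrakk> \<Longrightarrow> x \<otimes> y = y \<otimes> x"
  shows "\<exists>c\<in>H. \<exists>N::'a \<Rightarrow> int. \<forall>h\<in>H. h = c [^] N h \<and> (\<forall>h'\<in>H. N (h \<otimes> h') = N h + N h')"
proof -
  interpret H: subgroup H G by (rule H)
  let ?K = "{g \<in> H. orient g = 1}"
  have K: "subgroup ?K G"
    by unfold_locales (auto simp: orient_mult orient_one orient_inv)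
  obtain c where c: "c \<in> ?K" "\<forall>x\<in>?K. \<exists>k::int. x = c [^] k"
    using hyperbolic_commutative_subgroup_cyclic[OF is_group tf hyp K] comm by blast
  have "x \<otimes> y = y \<otimes> x" if "x \<in> H" "y \<in> H" for x y
  proof (rule commutative_if_index_two_cyclic[OF is_group tf H K _ _ c(1) _ that])
    fix x y assume "x \<in> H" "y \<in> H" "x \<notin> ?K" "y \<notin> ?K"
    moreover have "orient x = 1 \<or> orient x = -1" if "x \<in> H" for x
      using orient_cases[OF H.mem_carrier[OF that]] by blast
    ultimately have "orient x = -1" "orient y = -1" "x \<in> H" "y \<in> H" by auto
    then show "x \<otimes> y \<in> ?K" by (auto simp: orient_mult)
  qed (use c in auto)
  then obtain d where d: "d \<in> H" "\<forall>x\<in>H. \<exists>k::int. x = d [^] k"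
    using hyperbolic_commutative_subgroup_cyclic[OF is_group tf hyp H] by blast
  have "\<exists>N. \<forall>x\<in>H. x = d [^] (N x :: int) \<and> (\<forall>y\<in>H. x \<otimes> y \<in> H \<longrightarrow> N (x \<otimes> y) = N x + N y)"
    by (rule cyclic_coordinates[OF is_group tf H.mem_carrier[OF d(1)]]) (use d in blast)
  then show ?thesis using d(1) H.m_closed by meson
qed

lemma stabilizer_cyclic:
  "\<exists>d\<in>stabilizer c. \<exists>N::'a \<Rightarrow> int. \<forall>h\<in>stabilizer c. h = d [^] N h \<and>
    (\<forall>h'\<in>stabilizer c. N (h \<otimes> h') = N h + N h')"
proof (rule cyclic_if_positive_commutative[OF subgroup_stabilizer(1)])
  fix x y assume "x \<in> stabilizer c" "y \<in> stabilizer c" "orient x = 1" "orient y = 1"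
  then have "x \<in> positive_stabilizer c" "y \<in> positive_stabilizer c" by (auto simp: positive_stabilizer_def)
  then show "x \<otimes> y = y \<otimes> x"
    by (rule interval_action.hyperbolic_commutative[OF interval_action_stabilizer tf hyp])
qed

text \<open>
  The jumps are supported on the countable invariant set \<open>X\<close> of all translates of break points. As \<open>X\<close> is
  countable, it can be coded injectively by lists of elements of \<open>G\<close>; \<open>Y\<close> is the set of codes. The chain
  rule for jumps is the cocycle equation for \<open>u\<close>, and \<open>f\<close> is the value at the empty list of a 0-cochain
  with coboundary \<open>u\<close>.
\<close>

lemma jump_coboundary:
  assumes PD: "PD_group real_ring G n" and n: "n \<ge> 3"
  shows "\<exists>f. finite {c. f c \<noteq> 0} \<and> (\<forall>g\<in>carrier G. \<forall>c. jump g c = orient g * f (\<rho> g c) - f c)"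
proof -
  define X where "X = (\<Union>g\<in>carrier G. \<Union>h\<in>carrier G. \<rho> g ` {c. jump h c \<noteq> 0})"
  have cX: "countable X" unfolding X_def
    by (intro countable_UN hyperbolic_countable[OF is_group hyp] countable_image countable_finite finite_jumps)
  have X_act: "\<rho> g c \<in> X" if g: "g \<in> carrier G" and c: "c \<in> X" for g c
  proof -
    obtain a b d where d: "a \<in> carrier G" "b \<in> carrier G" "jump b d \<noteq> 0" "c = \<rho> a d"
      using c unfolding X_def by blast
    then have "\<rho> g c = \<rho> (g \<otimes> a) d" using \<rho>_mult[OF g d(1)] by simp
    moreover have "g \<otimes> a \<in> carrier G" using g d by simp
    ultimately show ?thesis unfolding X_def using d(2,3) by blast
  qed
  have X_jump: "c \<in> X" if "g \<in> carrier G" "jump g c \<noteq> 0" for g c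
  proof -
    have "c = \<rho> \<one> c" by (simp add: \<rho>_one)
    then show ?thesis unfolding X_def using that by blast
  qed
  define enc :: "circle \<Rightarrow> 'a list" where "enc c = replicate (to_nat_on X c) undefined" for c
  define dec where "dec = inv_into X enc"
  have inj: "inj_on enc X"
  proof (rule inj_onI)
    fix c d assume "c \<in> X" "d \<in> X" "enc c = enc d"
    then show "c = d" using inj_on_to_nat_on[OF cX] unfolding enc_def
      by (metis inj_onD length_replicate)
  qed
  have dec_enc [simp]: "dec (enc c) = c" if "c \<in> X" for c unfolding dec_def using inj that by simp
  define Y where "Y = enc ` X"
  have enc_dec: "enc (dec y) = y" "dec y \<in> X" if "y \<in> Y" for y
    using that unfolding Y_def by auto
  define act where "act g y = enc (\<rho> g (dec y))" for g y
  have "monomial_action G Y act orient"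
  proof unfold_locales
    show "act g y \<in> Y" if "g \<in> carrier G" "y \<in> Y" for g y
      unfolding act_def Y_def using X_act enc_dec that by blast
    show "act \<one> y = y" if "y \<in> Y" for y unfolding act_def using enc_dec that by (simp add: \<rho>_one)
    show "act (g \<otimes> h) y = act g (act h y)" if "g \<in> carrier G" "h \<in> carrier G" "y \<in> Y" for g h y
      unfolding act_def using enc_dec X_act that by (simp add: \<rho>_mult)
  qed (auto simp: orient_one orient_mult)
  then interpret Y: monomial_action G Y act orient .
  have stab: "Y.stab y = stabilizer (dec y)" if y: "y \<in> Y" for y
  proof -
    have "act g y = y \<longleftrightarrow> \<rho> g (dec y) = dec y" if "g \<in> carrier G" for g
      unfolding act_def using enc_dec[OF y] X_act[OF that] by (metis dec_enc)
    then show ?thesis unfolding Y.stab_def stabilizer_def by blast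
  qed
  have cyc: "cyclic_stabilizers G Y act orient"
    by unfold_locales (use stab stabilizer_cyclic in auto)
  define u where "u = (\<lambda>ws\<in>bar_tuples G 1. \<lambda>y. if y \<in> Y then jump (inv (hd ws)) (dec y) else 0)"
  have u1: "u [g] = (\<lambda>y. if y \<in> Y then jump (inv g) (dec y) else 0)" if "g \<in> carrier G" for g
    using that by (simp add: u_def bar_tuples_def cong: if_cong)
  have uA: "u [g] \<in> carrier Y.A" if g: "g \<in> carrier G" for g
  proof -
    have "{y. u [g] y \<noteq> 0} \<subseteq> enc ` {c. jump (inv g) c \<noteq> 0}"
    proof
      fix y assume "y \<in> {y. u [g] y \<noteq> 0}"
      then have y: "y \<in> Y" "jump (inv g) (dec y) \<noteq> 0" unfolding u1[OF g] by (auto split: if_splits)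
      then show "y \<in> enc ` {c. jump (inv g) c \<noteq> 0}" using enc_dec(1)[OF y(1)]
        by (intro image_eqI[of y enc "dec y"]) simp_all
    qed
    then have "finite {y. u [g] y \<noteq> 0}"
      by (rule finite_subset[OF _ finite_imageI[OF finite_jumps[OF inv_closed[OF g]]]])
    moreover have "{y. u [g] y \<noteq> 0} \<subseteq> Y" by (auto simp: u1[OF g])
    ultimately show ?thesis unfolding Y.A_simps by blast
  qed
  have tuples1: "ws \<in> bar_tuples G 1 \<longleftrightarrow> (\<exists>g\<in>carrier G. ws = [g])" for ws
    by (auto simp: bar_tuples_def length_Suc_conv)
  have uPi: "u \<in> (\<Pi>\<^sub>E ws\<in>bar_tuples G 1. carrier Y.A)"
  proof (rule PiE_I)
    fix ws assume "ws \<in> bar_tuples G 1"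
    then show "u ws \<in> carrier Y.A" using uA unfolding tuples1 by blast
  qed (simp add: u_def)
  then have cochain: "u \<in> carrier (cochain_group G Y.A 1)"
    by (simp add: cochain_group_def product_group_def)
  have "coboundary G Y.A 1 u = (\<lambda>ws\<in>bar_tuples G 2. (\<lambda>_. 0))"
  proof
    fix ws
    show "coboundary G Y.A 1 u ws = (\<lambda>ws\<in>bar_tuples G 2. (\<lambda>_. 0)) ws"
    proof (cases "ws \<in> bar_tuples G 2")
      case True
      then obtain g h where ws: "ws = [g, h]" "g \<in> carrier G" "h \<in> carrier G"
        by (auto simp: bar_tuples_def length_Suc_conv numeral_2_eq_2)
      have faces: "bar_face G 0 ws = [h]" "bar_face G (Suc 0) ws = [g \<otimes> h]"
          "bar_face G (Suc (Suc 0)) ws = [g]" "hd ws = g"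
        by (simp_all add: bar_face_def ws)
      have "coboundary G Y.A 1 u ws = (\<lambda>y. Y.translate orient g (u [h]) y - u [g \<otimes> h] y + u [g] y)"
        using uPi True Y.coboundary_eq[of u 1 ws] by (simp add: PiE_iff numeral_2_eq_2 faces)
      also have "\<dots> = (\<lambda>_. 0)"
      proof
        fix y
        show "Y.translate orient g (u [h]) y - u [g \<otimes> h] y + u [g] y = 0"
        proof (cases "y \<in> Y")
          case y: True
          have a: "act (inv g) y \<in> Y" "dec (act (inv g) y) = \<rho> (inv g) (dec y)"
            using y ws Y.act_closed X_act enc_dec by (auto simp: act_def)
          have "jump (inv (g \<otimes> h)) (dec y) = jump (inv g) (dec y) + orient g * jump (inv h) (\<rho> (inv g) (dec y))"
            using ws jump_mult[of "inv h" "inv g" "dec y"] by (simp add: inv_mult_group orient_inv)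
          then show ?thesis using y a ws by (simp add: u1 Y.translate_def)
        next
          case False
          then show ?thesis using ws by (simp add: u1 Y.translate_def)
        qed
      qed
      finally show ?thesis using True by simp
    qed (simp add: coboundary_def numeral_2_eq_2)
  qed
  then have "u \<in> cocycles G Y.A 1"
    unfolding cocycles_def kernel_def using cochain by (simp add: cochain_group_def product_group_def numeral_2_eq_2)
  then have "u \<in> coboundaries G Y.A 1"
    using PD_cocycle_is_coboundary[OF PD cyc, of 1] n by simp
  then obtain v where v: "v \<in> carrier (cochain_group G Y.A 0)" "u = coboundary G Y.A 0 v"
    unfolding coboundaries_def by auto
  define a where "a = v []"
  have aA: "a \<in> carrier Y.A" using v(1) by (auto simp: a_def cochain_group_def product_group_def bar_tuples_def PiE_iff)
  have ua: "u [g] = (\<lambda>y. Y.translate orient g a y - a y)" if g: "g \<in> carrier G" for g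
  proof -
    have "v \<in> bar_tuples G 0 \<rightarrow> carrier Y.A" using aA by (auto simp: a_def bar_tuples_def)
    moreover have "[g] \<in> bar_tuples G (Suc 0)" using g by (simp add: bar_tuples_def)
    ultimately show ?thesis
      unfolding v(2) a_def by (subst Y.coboundary_eq) (simp_all add: bar_face_def)
  qed
  define f where "f c = (if c \<in> X then a (enc c) else 0)" for c
  have "finite {c. f c \<noteq> 0}"
  proof -
    have "enc ` {c. f c \<noteq> 0} \<subseteq> {y. a y \<noteq> 0}" by (auto simp: f_def)
    moreover have "finite {y. a y \<noteq> 0}" using aA unfolding Y.A_simps by simp
    ultimately have "finite (enc ` {c. f c \<noteq> 0})" by (rule finite_subset)
    moreover have "inj_on enc {c. f c \<noteq> 0}" using inj by (rule inj_on_subset) (auto simp: f_def)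
    ultimately show ?thesis by (rule finite_imageD)
  qed
  moreover have "jump g c = orient g * f (\<rho> g c) - f c" if g: "g \<in> carrier G" for g c
  proof (cases "c \<in> X")
    case c: True
    have "jump g c = u [inv g] (enc c)" using c g by (simp add: u1 Y_def)
    also have "\<dots> = orient g * a (act g (enc c)) - a (enc c)"
      using fun_cong[OF ua[of "inv g"], of "enc c"] g c unfolding Y.translate_def by (simp add: Y_def orient_inv)
    also have "\<dots> = orient g * f (\<rho> g c) - f c" using c X_act[OF g c] by (simp add: f_def act_def)
    finally show ?thesis .
  next
    case False
    then have "\<rho> g c \<notin> X" using X_act[of "inv g" "\<rho> g c"] g \<rho>_inv(1)[OF g] by auto
    moreover have "jump g c = 0" using X_jump[OF g] False by blast
    ultimately show ?thesis using False by (simp add: f_def)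
  qed
  ultimately show ?thesis by blast
qed

text \<open>
  Conjugation by \<open>\<psi>\<close> turns the lifts of \<open>g\<close> and \<open>h\<close> into affine maps that commute with the map
  \<open>s \<mapsto> C s + D\<close> induced by the translation by 1. If \<open>C \<noteq> 1\<close>, they fix the fixed point of that map and are
  homotheties with the same centre. If \<open>C = 1\<close>, that map is a nontrivial translation, so they are translations.
  In both cases they commute.
\<close>

lemma positive_commutative:
  assumes PD: "PD_group real_ring G n" and n: "n \<ge> 3"
    and gh: "g \<in> carrier G" "h \<in> carrier G" "orient g = 1" "orient h = 1"
  shows "g \<otimes> h = h \<otimes> g"
proof -
  obtain f where f: "finite {c. f c \<noteq> 0}" "\<And>g c. g \<in> carrier G \<Longrightarrow> jump g c = orient g * f (\<rho> g c) - f c"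
    using jump_coboundary[OF PD n] by blast
  define F where "F x = f (circle_of x)" for x
  have "\<exists>\<psi>. \<forall>x. \<exists>a b. has_slopes \<psi> x a b \<and> a > 0 \<and> slope_jump \<psi> x = - F x"
  proof (rule prescribed_jumps)
    fix x y :: real
    have "{p. x < p \<and> p \<le> y \<and> F p \<noteq> 0} \<subseteq> {p. circle_of p \<in> {c. f c \<noteq> 0} \<and> \<bar>p - x\<bar> \<le> \<bar>y - x\<bar>}"
      by (auto simp: F_def)
    then show "finite {p. x < p \<and> p \<le> y \<and> F p \<noteq> 0}"
      using finite_circle_preimage[OF f(1), of x "\<bar>y - x\<bar>"] finite_subset by blast
    show "\<exists>\<epsilon>>0. \<forall>y. 0 < \<bar>y - x\<bar> \<and> \<bar>y - x\<bar> < \<epsilon> \<longrightarrow> F y = 0"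
      using circle_preimage_isolated[OF f(1), of x] by (simp add: F_def)
  qed
  then obtain \<psi> where \<psi>: "\<And>x. \<exists>a b. has_slopes \<psi> x a b \<and> a > 0" "\<And>x. slope_jump \<psi> x = - F x" by blast
  have inj: "\<psi> x = \<psi> y \<longleftrightarrow> x = y" for x y
    using positive_slopes_strict_mono[OF \<psi>(1)] strict_mono_eq by blast
  have conj: "\<exists>A B. \<forall>x. \<psi> (\<Theta> k x) = A * \<psi> x + B" if k: "k \<in> carrier G" "orient k = 1" for k
  proof -
    have "\<exists>a b. has_slopes (\<psi> \<circ> \<Theta> k) x a b \<and> a > 0 \<and> slope_jump (\<psi> \<circ> \<Theta> k) x = slope_jump \<psi> x" for x
    proof -
      obtain a b where ab: "has_slopes (\<Theta> k) x a b" using \<Theta>_slopes[OF k(1)] by blast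
      have b: "b > 0" "a > 0" using slopes_orientation[OF k(1) ab] k(2) ab unfolding has_slopes_def
        by (auto simp: zero_less_mult_iff)
      obtain a' b' where ab': "has_slopes \<psi> (\<Theta> k x) a' b'" "a' > 0" using \<psi>(1) by blast
      have "slope_jump (\<psi> \<circ> \<Theta> k) x = slope_jump (\<Theta> k) x - F (\<Theta> k x)"
        using slope_jump_compose[OF ab ab'(1)] b(1) unfolding \<psi>(2) if_P[OF b(1)] by linarith
      also have "slope_jump (\<Theta> k) x = F (\<Theta> k x) - F x"
        using f(2)[OF k(1), of "circle_of x"] k by (simp add: jump_circle_of F_def circle_of_\<Theta>)
      finally have "slope_jump (\<psi> \<circ> \<Theta> k) x = slope_jump \<psi> x" unfolding \<psi>(2) by linarith
      then show ?thesis using has_slopes_compose[OF ab ab'(1)] b ab'(2) by (metis mult_pos_pos)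
    qed
    then have "\<exists>A B. \<forall>x. (\<psi> \<circ> \<Theta> k) x = A * \<psi> x + B" by (intro same_jumps_affine \<psi>(1)) blast+
    then show ?thesis by simp
  qed
  have "\<exists>A B. \<forall>x. \<psi> (x + 1) = A * \<psi> x + B"
  proof -
    have shift: "has_slopes (\<lambda>x. \<psi> (x + 1)) x a b \<longleftrightarrow> has_slopes \<psi> (x + 1) a b" for x a b
    proof -
      have "has_slopes (\<lambda>x. x + 1) x 1 1" unfolding has_slopes_def by (intro conjI exI[of _ 1]) auto
      then have "has_slopes (\<lambda>x. \<psi> (x + 1)) x a b" if "has_slopes \<psi> (x + 1) a b" for a b
        using has_slopes_compose[of "\<lambda>x. x + 1" x 1 1 \<psi> a b] that by (simp add: o_def)
      then show ?thesis using \<psi>(1)[of "x + 1"] has_slopes_unique by blast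
    qed
    have "slope_jump (\<lambda>x. \<psi> (x + 1)) x = slope_jump \<psi> x" for x
    proof -
      have "slope_jump (\<lambda>x. \<psi> (x + 1)) x = slope_jump \<psi> (x + 1)" unfolding slope_jump_def shift ..
      moreover have "circle_of (x + 1) = circle_of x" unfolding circle_of_eq_iff by (intro exI[of _ 1]) simp
      ultimately show ?thesis by (simp add: \<psi>(2) F_def)
    qed
    then show ?thesis using shift \<psi>(1) by (intro same_jumps_affine) auto
  qed
  then obtain C D where CD: "\<And>x. \<psi> (x + 1) = C * \<psi> x + D" by blast
  obtain A B where AB: "\<And>x. \<psi> (\<Theta> g x) = A * \<psi> x + B" using conj gh by blast
  obtain A' B' where AB': "\<And>x. \<psi> (\<Theta> h x) = A' * \<psi> x + B'" using conj gh by blast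
  have comm: "A * D + B = C * B + D" if k: "k \<in> carrier G" "orient k = 1" and AB: "\<And>x. \<psi> (\<Theta> k x) = A * \<psi> x + B" for k A B
  proof -
    have "A * \<psi> (0 + 1) + B = C * \<psi> (\<Theta> k 0) + D"
      using AB[of "0 + 1"] CD[of "\<Theta> k 0"] \<Theta>_translate[OF k(1), of 0] k(2) by simp
    then show ?thesis unfolding AB CD by (simp add: algebra_simps)
  qed
  have "A * B' + B = A' * B + B'"
  proof (cases "C = 1")
    case True
    have "D \<noteq> 0" using CD[of 0] True inj[of 1 0] by auto
    moreover have "A * D = D" "A' * D = D" using comm[OF gh(1,3) AB] comm[OF gh(2,4) AB'] True by simp_all
    ultimately show ?thesis by simp
  next
    case False
    have "B * (C - 1) = D * (A - 1)" "B' * (C - 1) = D * (A' - 1)"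
      using comm[OF gh(1,3) AB] comm[OF gh(2,4) AB'] by (simp_all add: algebra_simps)
    then have "B * (C - 1) * (A' - 1) = B' * (C - 1) * (A - 1)" by simp
    then have "B * (A' - 1) = B' * (A - 1)" using False by simp
    then show ?thesis by (simp add: algebra_simps)
  qed
  then have "\<psi> (\<Theta> g (\<Theta> h x)) = \<psi> (\<Theta> h (\<Theta> g x))" for x
    unfolding AB AB' by (simp add: algebra_simps)
  then have eq: "\<Theta> g (\<Theta> h x) = \<Theta> h (\<Theta> g x)" for x using inj by blast
  have "\<rho> (g \<otimes> h) c = \<rho> (h \<otimes> g) c" for c
  proof (induction c rule: circle.abs_induct)
    fix x show "\<rho> (g \<otimes> h) (circle_of x) = \<rho> (h \<otimes> g) (circle_of x)"
      using gh eq[of x] by (simp add: \<rho>_mult circle_of_\<Theta>[symmetric])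
  qed
  then show ?thesis using gh by (intro \<rho>_inject) auto
qed

text \<open>
  By \<open>positive_commutative\<close> the whole group is cyclic. So it acts on a single point with cyclic
  stabiliser, and duality makes every 0-cocycle with trivial real coefficients vanish. The constant
  cochain with value 1 is a counterexample.
\<close>

lemma no_PD_action:
  assumes PD: "PD_group real_ring G n" and n: "n \<ge> 3"
  shows False
proof -
  obtain c and N :: "'a \<Rightarrow> int" where cN: "c \<in> carrier G"
      "\<forall>h\<in>carrier G. h = c [^] N h \<and> (\<forall>h'\<in>carrier G. N (h \<otimes> h') = N h + N h')"
    using cyclic_if_positive_commutative[OF subgroup_self positive_commutative[OF PD n]] by blast
  define Y where "Y = {[] :: 'a list}"
  define act where "act = (\<lambda>(g::'a) (y::'a list). y)"
  define \<epsilon> where "\<epsilon> = (\<lambda>g::'a. 1::real)"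
  interpret Y: monomial_action G Y act \<epsilon> by unfold_locales (auto simp: act_def \<epsilon>_def)
  have stab: "Y.stab y = carrier G" for y unfolding Y.stab_def by (simp add: act_def)
  have cyc: "cyclic_stabilizers G Y act \<epsilon>"
    by unfold_locales (use cN in \<open>auto simp only: stab\<close>)
  define a where "a = (\<lambda>y::'a list. if y = [] then 1 else 0 :: real)"
  define u where "u = (\<lambda>ws\<in>bar_tuples G 0. a)"
  have aA: "a \<in> carrier Y.A" unfolding Y.A_simps by (simp add: a_def Y_def)
  have tr: "Y.translate \<epsilon> g a = a" for g
    unfolding Y.translate_def by (simp add: a_def fun_eq_iff act_def \<epsilon>_def Y_def)
  have cochain: "u \<in> carrier (cochain_group G Y.A 0)"
    unfolding cochain_group_def product_group_def using aA by (auto simp: u_def)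
  have u: "u [] = a" by (simp add: u_def bar_tuples_def)
  have "coboundary G Y.A 0 u = (\<lambda>ws\<in>bar_tuples G (Suc 0). (\<lambda>_. 0))"
  proof
    fix ws
    show "coboundary G Y.A 0 u ws = (\<lambda>ws\<in>bar_tuples G (Suc 0). (\<lambda>_. 0)) ws"
    proof (cases "ws \<in> bar_tuples G (Suc 0)")
      case True
      then obtain g where ws: "ws = [g]" by (auto simp: bar_tuples_def length_Suc_conv)
      have "u \<in> bar_tuples G 0 \<rightarrow> carrier Y.A" using aA by (simp add: u_def)
      then have "coboundary G Y.A 0 u ws = (\<lambda>y. Y.translate \<epsilon> g a y - a y)"
        using True by (subst Y.coboundary_eq) (simp_all add: bar_face_def ws u)
      then show ?thesis using True by (simp add: tr)
    qed (simp add: coboundary_def)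
  qed
  then have "u \<in> cocycles G Y.A 0"
    unfolding cocycles_def kernel_def using cochain by (simp add: cochain_group_def product_group_def)
  then have "u \<in> coboundaries G Y.A 0"
    using PD_cocycle_is_coboundary[OF PD cyc, of 0] n by simp
  then have "u [] = (\<lambda>_. 0)" by (simp add: coboundaries_def cochain_group_def product_group_def bar_tuples_def)
  then have "a [] = 0" unfolding u by simp
  then show False by (simp add: a_def)
qed

end

theorem theorem1p3:
  fixes G :: "('g, 'b) monoid_scheme" and n :: nat
  assumes "group G" and "torsion_free G" and "word_hyperbolic G"
    and "PD_group real_ring G n" and "n \<ge> 3"
  shows "\<not> (\<exists>\<phi>. \<phi> \<in> mon G PL_circle)"
proof clarify
  fix \<rho> assume "\<rho> \<in> mon G PL_circle"
  then interpret hyperbolic_PL_action G \<rho>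
    using assms by (simp add: hyperbolic_PL_action_def PL_action_def PL_action_axioms_def hyperbolic_PL_action_axioms_def)
  show False by (rule no_PD_action[OF assms(4,5)])
qed

end
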